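(* Let $\mathcal{K}$ be an Erdős–Rado class. Then for every large, $\mathbb{L}_{\infty,\omega}$-elementary category $\mathbb{K}$ there is a faithful functor $\mathcal{K}\to\mathbb{K}$ that preserves directed colimits. In particular, every $\mathbb{L}_{\infty,\omega}$-axiomatizable Erdős–Rado class is minimal amongst the large, $\mathbb{L}_{\infty,\omega}$-elementary categories (that is, it admits a faithful functor preserving directed colimits into every large, $\mathbb{L}_{\infty,\omega}$-elementary category).
   Context: **Abstract classes and types.** An abstract class $\mathcal{K}$ is a class of structures in a fixed language $\tau(\mathcal{K})$ with a partial order $\leq_{\mathcal{K}}$ contained in the substructure relation, such that membership and $\leq_{\mathcal{K}}$ respect isomorphism. A $\mathcal{K}$-embedding $f:M\to N$ is an injection preserving and reflecting atomic formulas with $f(M)\leq_{\mathcal{K}}N$; $\mathcal{K}$ is regarded as a category with these morphisms. $\mathcal{K}$ is ordered if $\tau(\mathcal{K})$ has a distinguished binary relation $<$ that is a total order in every member. Finite tuples $\mathbf{a}_1\in I_1$, $\mathbf{a}_2\in I_2$ have the same $\mathcal{K}$-type iff there are $J_1,\dots,J_n, I_1^*,\dots,I_{n+1}^*\in\mathcal{K}$, tuples $\mathbf{b}_\ell\in I^*_\ell$ and $\mathcal{K}$-embeddings $f_\ell:I^*_{\ell+1}\to J_\ell$ with $I_1^*=I_1$, $I_{n+1}^*=I_2$, $\mathbf{b}_1=\mathbf{a}_1$, $\mathbf{b}_{n+1}=\mathbf{a}_2$, $I_\ell^*\leq_{\mathcal{K}}J_\ell$, and $\mathbf{b}_\ell=f_\ell(\mathbf{b}_{\ell+1})$.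 The equivalence class is $tp_{\mathcal{K}}(\mathbf{a};I)$. $S_{\mathcal{K}}$ is the set of all $\mathcal{K}$-types of finite tuples and $S^{inc}_{\mathcal{K}}$ those of tuples $a_1<\dots<a_n$. For $p=tp_{\mathcal{K}}(i_1,\dots,i_n;I)$ and $s=\{k_1<\dots<k_m\}$ a set of indices, $p^s=tp_{\mathcal{K}}(i_{k_1},\dots,i_{k_m};I)$. For a language $\tau$, $tp_\tau$ and $S_\tau$ are types in the abstract class of all $\tau$-structures with substructure (equivalently, quantifier-free types). **Bigness.** A bigness notion for $\mathcal{K}$ is a family of classes $\mathcal{K}_\mu\subseteq\mathcal{K}$ ($\mu$ a cardinal; members are called $\mu$-big) such that each $\mathcal{K}_\mu$ is nonempty; if $\mu_1\leq\mu_2$, $M\leq_{\mathcal{K}}N$ and $M\in\mathcal{K}_{\mu_2}$ then $N\in\mathcal{K}_{\mu_1}$; and every $M\in\mathcal{K}_{\aleph_0}$ realizes every type in $S_{\mathcal{K}}$. **Erdős–Rado class.** A blueprint $\Phi$ proper for $\mathcal{K}$ is a function $\Phi:S^{inc}_{\mathcal{K}}\to S_\tau$, for some language $\tau=\tau(\Phi)$, sending $n$-types to $n$-types with $\Phi(p^s)=\Phi(p)^s$. An ordered abstract class $\mathcal{K}$ with a bigness notion is an Erdős–Rado class iff there is $f:\mathrm{Card}\to\mathrm{Card}$ such that for every cardinal $\mu$, every language $\tau$ with $|\tau|\leq\mu$, every $f(\mu)$-big $I\in\mathcal{K}$, every $\tau$-structure $M$ and every injection $h:I\to M$, there is a blueprint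 $\Phi$ proper for $\mathcal{K}$ with $\tau(\Phi)=\tau$ such that for each $p\in S^{inc}_{\mathcal{K}}$ there are $i_1<\dots<i_n\in I$ realizing $p$ with $tp_\tau(h(i_1),\dots,h(i_n);M)=\Phi(p)$. **Elementary categories.** An $\mathbb{L}_{\infty,\omega}$-elementary category is (a category equivalent to) one whose objects are the models of some fixed $\mathbb{L}_{\infty,\omega}(\tau)$-theory $T$ and whose arrows are the $\tau$-homomorphisms between models that are elementary for some fixed fragment of $\mathbb{L}_{\infty,\omega}(\tau)$ containing $T$. It is large if it is not equivalent to a small category (so $T$ has models of arbitrarily large cardinality).
   Formalization: For general K only directed colimits carried by the union are preserved (all, if directed colimits in K are unions), as the literal claim fails; "axiomatizable" means models of T ordered by fragment-elementary substructure; classes live in a universe of inaccessible size. *)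

theory Defs
  imports "HOL-Library.FuncSet"
begin

unbundle cardinal_syntax

section \<open>The set-theoretic universe\<close>

text \<open>
  A type \<open>'u\<close> of strongly inaccessible cardinality \<open>\<kappa>\<close> replaces the cumulative hierarchy: a set is,
  up to bijection, a subset of \<open>'u\<close> of cardinality less than \<open>\<kappa>\<close> (``small''), a cardinal is a
  cardinal below \<open>\<kappa>\<close>, and a (possibly proper) class of structures is an arbitrary set of structures
  with small carriers in \<open>'u\<close>.
\<close>

definition inaccessible :: "'u itself \<Rightarrow> bool" where
  "inaccessible _ \<longleftrightarrow>
     natLeq <o |UNIV :: 'u set| \<and>
     regularCard |UNIV :: 'u set| \<and>
     (\<forall>A :: 'u set. |A| <o |UNIV :: 'u set| \<longrightarrow> |Pow A| <o |UNIV :: 'u set| )"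

definition small :: "'u itself \<Rightarrow> 'b set \<Rightarrow> bool" where
  "small _ A \<longleftrightarrow> |A| <o |UNIV :: 'u set|"

definition small_card :: "'u rel \<Rightarrow> bool" where
  "small_card \<mu> \<longleftrightarrow> Card_order \<mu> \<and> \<mu> <o |UNIV :: 'u set|"


section \<open>Languages and structures\<close>

text \<open>
  A symbol is a name together with its arity.  An interpretation is looked up by the name alone;
  the arity is the length of the argument list.
\<close>

record 'u lang =
  funs :: "('u \<times> nat) set"
  rels :: "('u \<times> nat) set"

definition lang_card :: "'u lang \<Rightarrow> (('u \<times> nat) + ('u \<times> nat)) rel" where
  "lang_card L = |funs L <+> rels L|"

definition small_lang :: "'u lang \<Rightarrow> bool" where
  "small_lang L \<longleftrightarrow> lang_card L <o |UNIV :: 'u set|"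

record 'u struct =
  univ :: "'u set"
  fn :: "'u \<Rightarrow> 'u list \<Rightarrow> 'u"
  rl :: "'u \<Rightarrow> 'u list \<Rightarrow> bool"

text \<open>
  The interpretations are normalised outside their domain, so that equality of \<open>'u struct\<close> is equality
  of structures; this matters for the antisymmetry of \<open>\<le>\<^sub>K\<close>.  The empty carrier is allowed.
\<close>

definition is_struct :: "'u lang \<Rightarrow> 'u struct \<Rightarrow> bool" where
  "is_struct L M \<longleftrightarrow>
     small TYPE('u) (univ M) \<and>
     (\<forall>c xs. if (c, length xs) \<in> funs L \<and> set xs \<subseteq> univ M
             then fn M c xs \<in> univ M else fn M c xs = undefined) \<and>
     (\<forall>c xs. rl M c xs \<longrightarrow> (c, length xs) \<in> rels L \<and> set xs \<subseteq> univ M)"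

definition induced :: "'u struct \<Rightarrow> 'u set \<Rightarrow> 'u struct" where
  "induced N A = \<lparr> univ = A,
     fn = (\<lambda>c xs. if set xs \<subseteq> A then fn N c xs else undefined),
     rl = (\<lambda>c xs. set xs \<subseteq> A \<and> rl N c xs) \<rparr>"

definition substruct :: "'u struct \<Rightarrow> 'u struct \<Rightarrow> bool" where
  "substruct M N \<longleftrightarrow> univ M \<subseteq> univ N \<and> M = induced N (univ M)"

definition homomorphism :: "'u lang \<Rightarrow> 'u struct \<Rightarrow> 'u struct \<Rightarrow> ('u \<Rightarrow> 'u) \<Rightarrow> bool" where
  "homomorphism L M N f \<longleftrightarrow>
     f ` univ M \<subseteq> univ N \<and>
     (\<forall>c xs. (c, length xs) \<in> funs L \<and> set xs \<subseteq> univ M \<longrightarrow> f (fn M c xs) = fn N c (map f xs)) \<and>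
     (\<forall>c xs. (c, length xs) \<in> rels L \<and> set xs \<subseteq> univ M \<and> rl M c xs \<longrightarrow> rl N c (map f xs))"

text \<open>Injections that preserve and reflect atomic formulas.\<close>

definition embedding :: "'u lang \<Rightarrow> 'u struct \<Rightarrow> 'u struct \<Rightarrow> ('u \<Rightarrow> 'u) \<Rightarrow> bool" where
  "embedding L M N f \<longleftrightarrow>
     inj_on f (univ M) \<and> homomorphism L M N f \<and>
     (\<forall>c xs. (c, length xs) \<in> rels L \<and> set xs \<subseteq> univ M \<and> rl N c (map f xs) \<longrightarrow> rl M c xs)"

definition struct_iso :: "'u lang \<Rightarrow> 'u struct \<Rightarrow> 'u struct \<Rightarrow> ('u \<Rightarrow> 'u) \<Rightarrow> bool" where
  "struct_iso L M N f \<longleftrightarrow> embedding L M N f \<and> f ` univ M = univ N"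


section \<open>Abstract classes and their types\<close>

record 'u abstract_class =
  clang :: "'u lang"
  mem :: "'u struct set"
  le :: "'u struct rel"

definition is_abstract_class :: "'u abstract_class \<Rightarrow> bool" where
  "is_abstract_class K \<longleftrightarrow>
     small_lang (clang K) \<and>
     (\<forall>M\<in>mem K. is_struct (clang K) M) \<and>
     partial_order_on (mem K) (le K) \<and>
     (\<forall>(M, N)\<in>le K. substruct M N) \<and>
     (\<forall>M N f. M \<in> mem K \<and> is_struct (clang K) N \<and> struct_iso (clang K) M N f \<longrightarrow> N \<in> mem K) \<and>
     (\<forall>M N M' N' f. (M, N) \<in> le K \<and> is_struct (clang K) M' \<and> is_struct (clang K) N' \<and>
        struct_iso (clang K) N N' f \<and> substruct M' N' \<and> struct_iso (clang K) M M' f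
        \<longrightarrow> (M', N') \<in> le K)"

definition K_embedding :: "'u abstract_class \<Rightarrow> 'u struct \<Rightarrow> 'u struct \<Rightarrow> ('u \<Rightarrow> 'u) \<Rightarrow> bool" where
  "K_embedding K M N f \<longleftrightarrow> embedding (clang K) M N f \<and> (induced N (f ` univ M), N) \<in> le K"

type_synonym 'u tuple_in = "'u list \<times> 'u struct"

definition tuples :: "'u abstract_class \<Rightarrow> 'u tuple_in set" where
  "tuples K = {(a, M). M \<in> mem K \<and> set a \<subseteq> univ M}"

text \<open>One link \<open>I\<^sub>\<ell> \<le> J \<leftarrow> I\<^sub>\<ell>\<^sub>+\<^sub>1\<close> of a chain witnessing equality of types.\<close>

definition type_step :: "'u abstract_class \<Rightarrow> 'u tuple_in rel" where
  "type_step K = {((a, M), (b, N)). (a, M) \<in> tuples K \<and> (b, N) \<in> tuples K \<and>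
     (\<exists>J f. J \<in> mem K \<and> (M, J) \<in> le K \<and> K_embedding K N J f \<and> a = map f b)}"

definition tp :: "'u abstract_class \<Rightarrow> 'u list \<Rightarrow> 'u struct \<Rightarrow> 'u tuple_in set" where
  "tp K a M = (type_step K)\<^sup>+ `` {(a, M)}"

definition types :: "'u abstract_class \<Rightarrow> 'u tuple_in set set" where
  "types K = {tp K a M | a M. (a, M) \<in> tuples K}"

definition increasing :: "'u \<Rightarrow> 'u struct \<Rightarrow> 'u list \<Rightarrow> bool" where
  "increasing lt M a \<longleftrightarrow> sorted_wrt (\<lambda>x y. rl M lt [x, y]) a"

definition inc_types :: "'u abstract_class \<Rightarrow> 'u \<Rightarrow> 'u tuple_in set set" where
  "inc_types K lt = {tp K a M | a M. (a, M) \<in> tuples K \<and> increasing lt M a}"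

text \<open>
  \<open>p\<^sup>s\<close>: the classes \<open>tp K (nths a s) M\<close> coincide for all representatives \<open>(a, M)\<close> of \<open>p\<close>, so
  their union is this common class.  Indices start at 0.
\<close>

definition tp_restr :: "'u abstract_class \<Rightarrow> 'u tuple_in set \<Rightarrow> nat set \<Rightarrow> 'u tuple_in set" where
  "tp_restr K p s = (\<Union>(a, M)\<in>p. tp K (nths a s) M)"

definition all_structs :: "'u lang \<Rightarrow> 'u abstract_class" where
  "all_structs L = \<lparr> clang = L, mem = {M. is_struct L M},
     le = {(M, N). is_struct L M \<and> is_struct L N \<and> substruct M N} \<rparr>"


section \<open>Erd\H{o}s--Rado classes\<close>

definition ordered_class :: "'u abstract_class \<Rightarrow> 'u \<Rightarrow> bool" where
  "ordered_class K lt \<longleftrightarrow>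
     is_abstract_class K \<and> (lt, 2) \<in> rels (clang K) \<and>
     (\<forall>M\<in>mem K. strict_linear_order_on (univ M) {(x, y). rl M lt [x, y]})"

definition bigness_notion :: "'u abstract_class \<Rightarrow> ('u rel \<Rightarrow> 'u struct set) \<Rightarrow> bool" where
  "bigness_notion K big \<longleftrightarrow>
     (\<forall>\<mu>. small_card \<mu> \<longrightarrow> big \<mu> \<subseteq> mem K \<and> big \<mu> \<noteq> {}) \<and>
     (\<forall>\<mu>1 \<mu>2 M N. small_card \<mu>1 \<and> small_card \<mu>2 \<and> \<mu>1 \<le>o \<mu>2 \<and> (M, N) \<in> le K \<and> M \<in> big \<mu>2
        \<longrightarrow> N \<in> big \<mu>1) \<and>
     (\<forall>\<mu> M p. small_card \<mu> \<and> \<mu> =o natLeq \<and> M \<in> big \<mu> \<and> p \<in> types K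
        \<longrightarrow> (\<exists>a. set a \<subseteq> univ M \<and> tp K a M = p))"

definition blueprint ::
  "'u abstract_class \<Rightarrow> 'u \<Rightarrow> 'u lang \<Rightarrow> ('u tuple_in set \<Rightarrow> 'u tuple_in set) \<Rightarrow> bool" where
  "blueprint K lt L \<Phi> \<longleftrightarrow>
     (\<forall>p\<in>inc_types K lt.
        \<Phi> p \<in> types (all_structs L) \<and>
        (\<forall>(a, I)\<in>p. \<forall>(b, M)\<in>\<Phi> p. length b = length a \<and>
           (\<forall>s. s \<subseteq> {..<length a} \<longrightarrow> \<Phi> (tp_restr K p s) = tp_restr (all_structs L) (\<Phi> p) s)))"

definition erdos_rado_class ::
  "'u abstract_class \<Rightarrow> 'u \<Rightarrow> ('u rel \<Rightarrow> 'u struct set) \<Rightarrow> bool" where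
  "erdos_rado_class K lt big \<longleftrightarrow>
     ordered_class K lt \<and> bigness_notion K big \<and>
     (\<exists>f :: 'u rel \<Rightarrow> 'u rel.
        (\<forall>\<mu>. small_card \<mu> \<longrightarrow> small_card (f \<mu>)) \<and>
        (\<forall>\<mu> \<nu>. small_card \<mu> \<and> small_card \<nu> \<and> \<mu> =o \<nu> \<longrightarrow> f \<mu> =o f \<nu>) \<and>
        (\<forall>\<mu> L I M h.
           small_card \<mu> \<and> lang_card L \<le>o \<mu> \<and> I \<in> big (f \<mu>) \<and> is_struct L M \<and>
           inj_on h (univ I) \<and> h ` univ I \<subseteq> univ M \<longrightarrow>
           (\<exists>\<Phi>. blueprint K lt L \<Phi> \<and>
              (\<forall>p\<in>inc_types K lt. \<exists>a. set a \<subseteq> univ I \<and> increasing lt I a \<and> tp K a I = p \<and>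
                 tp (all_structs L) (map h a) M = \<Phi> p))))"


section \<open>Categories\<close>

record ('o, 'a) category =
  obj :: "'o set"
  hom :: "'o \<Rightarrow> 'o \<Rightarrow> 'a set"
  ide :: "'o \<Rightarrow> 'a"
  cmp :: "'o \<Rightarrow> 'o \<Rightarrow> 'o \<Rightarrow> 'a \<Rightarrow> 'a \<Rightarrow> 'a"  \<comment> \<open>\<open>cmp X Y Z g f\<close> is \<open>g \<circ> f\<close> for \<open>f : X \<rightarrow> Y\<close>, \<open>g : Y \<rightarrow> Z\<close>\<close>

definition is_category :: "('o, 'a) category \<Rightarrow> bool" where
  "is_category C \<longleftrightarrow>
     (\<forall>X\<in>obj C. ide C X \<in> hom C X X) \<and>
     (\<forall>X\<in>obj C. \<forall>Y\<in>obj C. \<forall>f\<in>hom C X Y. cmp C X X Y f (ide C X) = f \<and> cmp C X Y Y (ide C Y) f = f) \<and>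
     (\<forall>X\<in>obj C. \<forall>Y\<in>obj C. \<forall>Z\<in>obj C. \<forall>f\<in>hom C X Y. \<forall>g\<in>hom C Y Z. cmp C X Y Z g f \<in> hom C X Z) \<and>
     (\<forall>W\<in>obj C. \<forall>X\<in>obj C. \<forall>Y\<in>obj C. \<forall>Z\<in>obj C. \<forall>f\<in>hom C W X. \<forall>g\<in>hom C X Y. \<forall>h\<in>hom C Y Z.
        cmp C W X Z (cmp C X Y Z h g) f = cmp C W Y Z h (cmp C W X Y g f))"

record ('o, 'a, 'p, 'b) ftor =
  omap :: "'o \<Rightarrow> 'p"
  amap :: "'o \<Rightarrow> 'o \<Rightarrow> 'a \<Rightarrow> 'b"

definition is_functor :: "('o, 'a) category \<Rightarrow> ('p, 'b) category \<Rightarrow> ('o, 'a, 'p, 'b) ftor \<Rightarrow> bool" where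
  "is_functor C D F \<longleftrightarrow>
     (\<forall>X\<in>obj C. omap F X \<in> obj D \<and> amap F X X (ide C X) = ide D (omap F X)) \<and>
     (\<forall>X\<in>obj C. \<forall>Y\<in>obj C. \<forall>f\<in>hom C X Y. amap F X Y f \<in> hom D (omap F X) (omap F Y)) \<and>
     (\<forall>X\<in>obj C. \<forall>Y\<in>obj C. \<forall>Z\<in>obj C. \<forall>f\<in>hom C X Y. \<forall>g\<in>hom C Y Z.
        amap F X Z (cmp C X Y Z g f) =
        cmp D (omap F X) (omap F Y) (omap F Z) (amap F Y Z g) (amap F X Y f))"

definition faithful :: "('o, 'a) category \<Rightarrow> ('o, 'a, 'p, 'b) ftor \<Rightarrow> bool" where
  "faithful C F \<longleftrightarrow> (\<forall>X\<in>obj C. \<forall>Y\<in>obj C. inj_on (amap F X Y) (hom C X Y))"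

definition id_ftor :: "('o, 'a, 'o, 'a) ftor" where
  "id_ftor = \<lparr> omap = (\<lambda>X. X), amap = (\<lambda>X Y f. f) \<rparr>"

definition comp_ftor ::
  "('p, 'b, 'q, 'c) ftor \<Rightarrow> ('o, 'a, 'p, 'b) ftor \<Rightarrow> ('o, 'a, 'q, 'c) ftor" where
  "comp_ftor G F = \<lparr> omap = (\<lambda>X. omap G (omap F X)),
     amap = (\<lambda>X Y f. amap G (omap F X) (omap F Y) (amap F X Y f)) \<rparr>"

definition is_iso :: "('o, 'a) category \<Rightarrow> 'o \<Rightarrow> 'o \<Rightarrow> 'a \<Rightarrow> bool" where
  "is_iso C X Y f \<longleftrightarrow> f \<in> hom C X Y \<and>
     (\<exists>g\<in>hom C Y X. cmp C X Y X g f = ide C X \<and> cmp C Y X Y f g = ide C Y)"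

definition nat_isomorphic :: "('o, 'a) category \<Rightarrow> ('p, 'b) category \<Rightarrow>
    ('o, 'a, 'p, 'b) ftor \<Rightarrow> ('o, 'a, 'p, 'b) ftor \<Rightarrow> bool" where
  "nat_isomorphic C D F G \<longleftrightarrow>
     (\<exists>\<eta>. (\<forall>X\<in>obj C. is_iso D (omap F X) (omap G X) (\<eta> X)) \<and>
       (\<forall>X\<in>obj C. \<forall>Y\<in>obj C. \<forall>f\<in>hom C X Y.
          cmp D (omap F X) (omap F Y) (omap G Y) (\<eta> Y) (amap F X Y f) =
          cmp D (omap F X) (omap G X) (omap G Y) (amap G X Y f) (\<eta> X)))"

definition equivalent_cats :: "('o, 'a) category \<Rightarrow> ('p, 'b) category \<Rightarrow> bool" where
  "equivalent_cats C D \<longleftrightarrow>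
     (\<exists>F G. is_functor C D F \<and> is_functor D C G \<and>
        nat_isomorphic C C (comp_ftor G F) id_ftor \<and> nat_isomorphic D D (comp_ftor F G) id_ftor)"

definition small_category :: "'u itself \<Rightarrow> ('o, 'a) category \<Rightarrow> bool" where
  "small_category U C \<longleftrightarrow>
     is_category C \<and> small U (obj C) \<and> (\<forall>X\<in>obj C. \<forall>Y\<in>obj C. small U (hom C X Y))"

text \<open>Every small category is isomorphic to one whose objects and arrows are elements of \<open>'u\<close>.\<close>

definition large :: "'u itself \<Rightarrow> ('o, 'a) category \<Rightarrow> bool" where
  "large U C \<longleftrightarrow> \<not> (\<exists>S :: ('u, 'u) category. small_category U S \<and> equivalent_cats C S)"


subsection \<open>Directed colimits\<close>

definition is_cocone :: "('j, 'k) category \<Rightarrow> ('o, 'a) category \<Rightarrow> ('j, 'k, 'o, 'a) ftor \<Rightarrow>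
    'o \<Rightarrow> ('j \<Rightarrow> 'a) \<Rightarrow> bool" where
  "is_cocone J C D X \<iota> \<longleftrightarrow>
     X \<in> obj C \<and> (\<forall>i\<in>obj J. \<iota> i \<in> hom C (omap D i) X) \<and>
     (\<forall>i\<in>obj J. \<forall>j\<in>obj J. \<forall>f\<in>hom J i j. cmp C (omap D i) (omap D j) X (\<iota> j) (amap D i j f) = \<iota> i)"

definition is_colimit :: "('j, 'k) category \<Rightarrow> ('o, 'a) category \<Rightarrow> ('j, 'k, 'o, 'a) ftor \<Rightarrow>
    'o \<Rightarrow> ('j \<Rightarrow> 'a) \<Rightarrow> bool" where
  "is_colimit J C D X \<iota> \<longleftrightarrow>
     is_cocone J C D X \<iota> \<and>
     (\<forall>Y \<kappa>. is_cocone J C D Y \<kappa> \<longrightarrow>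
        (\<exists>!u. u \<in> hom C X Y \<and> (\<forall>i\<in>obj J. cmp C (omap D i) X Y u (\<iota> i) = \<kappa> i)))"

definition directed_poset :: "'i set \<Rightarrow> 'i rel \<Rightarrow> bool" where
  "directed_poset P r \<longleftrightarrow>
     P \<noteq> {} \<and> partial_order_on P r \<and> (\<forall>i\<in>P. \<forall>j\<in>P. \<exists>k\<in>P. (i, k) \<in> r \<and> (j, k) \<in> r)"

definition poset_cat :: "'i set \<Rightarrow> 'i rel \<Rightarrow> ('i, unit) category" where
  "poset_cat P r = \<lparr> obj = P, hom = (\<lambda>i j. if (i, j) \<in> r then {()} else {}),
     ide = (\<lambda>i. ()), cmp = (\<lambda>i j k g f. ()) \<rparr>"

definition is_directed_colimit :: "'u set \<Rightarrow> 'u rel \<Rightarrow> ('o, 'a) category \<Rightarrow> ('u, unit, 'o, 'a) ftor \<Rightarrow>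
    'o \<Rightarrow> ('u \<Rightarrow> 'a) \<Rightarrow> bool" where
  "is_directed_colimit P r C D X \<iota> \<longleftrightarrow>
     small TYPE('u) P \<and> directed_poset P r \<and> is_functor (poset_cat P r) C D \<and>
     is_colimit (poset_cat P r) C D X \<iota>"

definition preserves_directed_colimits ::
  "'u itself \<Rightarrow> ('o, 'a) category \<Rightarrow> ('p, 'b) category \<Rightarrow> ('o, 'a, 'p, 'b) ftor \<Rightarrow> bool" where
  "preserves_directed_colimits _ C E F \<longleftrightarrow>
     (\<forall>(P :: 'u set) r D X \<iota>. is_directed_colimit P r C D X \<iota> \<longrightarrow>
        is_directed_colimit P r E (comp_ftor F D) (omap F X) (\<lambda>i. amap F (omap D i) X (\<iota> i)))"


subsection \<open>An abstract class as a category\<close>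

text \<open>Arrows are extensional functions, so that equality of arrows is equality of maps.\<close>

definition class_cat :: "'u abstract_class \<Rightarrow> ('u struct, 'u \<Rightarrow> 'u) category" where
  "class_cat K = \<lparr> obj = mem K,
     hom = (\<lambda>M N. {f \<in> extensional (univ M). K_embedding K M N f}),
     ide = (\<lambda>M. restrict id (univ M)),
     cmp = (\<lambda>M N P g f. compose (univ M) g f) \<rparr>"

text \<open>
  An abstract class need not be closed under unions of directed systems, and a colimit in the
  category \<open>class_cat K\<close> can then be strictly larger than the union of the system.  A directed colimit
  of structures is one that is carried by the union.  The distinction matters: let \<open>K\<close> be the linear
  orders in which every increasing \<open>\<omega>\<close>-sequence has a supremum, with maps preserving these suprema.
  In \<open>K\<close> the finite ordinals have the colimit \<open>\<omega> + 1\<close>, and a functor from \<open>K\<close> to infinite sets and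
  injections that preserves this colimit identifies the points \<open>\<omega>\<close> and \<open>\<omega>\<cdot>2\<close> of \<open>\<omega>\<cdot>2 + 1\<close>, viewed as
  maps from the one-point order, hence is not faithful.
\<close>

definition is_directed_union :: "'u set \<Rightarrow> 'u rel \<Rightarrow> 'u abstract_class \<Rightarrow>
    ('u, unit, 'u struct, 'u \<Rightarrow> 'u) ftor \<Rightarrow> 'u struct \<Rightarrow> ('u \<Rightarrow> 'u \<Rightarrow> 'u) \<Rightarrow> bool" where
  "is_directed_union P r K D X \<iota> \<longleftrightarrow>
     is_directed_colimit P r (class_cat K) D X \<iota> \<and> univ X = (\<Union>i\<in>P. \<iota> i ` univ (omap D i))"

definition preserves_directed_unions :: "'u abstract_class \<Rightarrow> ('p, 'b) category \<Rightarrow>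
    ('u struct, 'u \<Rightarrow> 'u, 'p, 'b) ftor \<Rightarrow> bool" where
  "preserves_directed_unions K E F \<longleftrightarrow>
     (\<forall>P r D X \<iota>. is_directed_union P r K D X \<iota> \<longrightarrow>
        is_directed_colimit P r E (comp_ftor F D) (omap F X) (\<lambda>i. amap F (omap D i) X (\<iota> i)))"

definition directed_colimits_are_unions :: "'u abstract_class \<Rightarrow> bool" where
  "directed_colimits_are_unions K \<longleftrightarrow>
     (\<forall>P r D X \<iota>. is_directed_colimit P r (class_cat K) D X \<iota> \<longrightarrow> is_directed_union P r K D X \<iota>)"


section \<open>Infinitary logic\<close>

datatype 'u trm = Var nat | App 'u "'u trm list"

text \<open>
  \<open>Conj I g\<close> is the conjunction of the \<open>g i\<close> with \<open>i \<in> I\<close>; the values of \<open>g\<close> outside \<open>I\<close> are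
  irrelevant.  Disjunction and universal quantification are expressed through \<open>Neg\<close>.
\<close>

datatype 'u fm =
    Eq "'u trm" "'u trm"
  | Rel 'u "'u trm list"
  | Neg "'u fm"
  | And "'u fm" "'u fm"
  | Conj "'u set" "'u \<Rightarrow> 'u fm"
  | Ex nat "'u fm"

primrec tvars :: "'u trm \<Rightarrow> nat set" where
  "tvars (Var x) = {x}"
| "tvars (App c ts) = \<Union>(set (map tvars ts))"

primrec wf_trm :: "'u lang \<Rightarrow> 'u trm \<Rightarrow> bool" where
  "wf_trm L (Var x) \<longleftrightarrow> True"
| "wf_trm L (App c ts) \<longleftrightarrow> (c, length ts) \<in> funs L \<and> list_all id (map (wf_trm L) ts)"

primrec tval :: "'u struct \<Rightarrow> (nat \<Rightarrow> 'u) \<Rightarrow> 'u trm \<Rightarrow> 'u" where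
  "tval M v (Var x) = v x"
| "tval M v (App c ts) = fn M c (map (tval M v) ts)"

primrec fv :: "'u fm \<Rightarrow> nat set" where
  "fv (Eq s t) = tvars s \<union> tvars t"
| "fv (Rel c ts) = \<Union>(set (map tvars ts))"
| "fv (Neg \<phi>) = fv \<phi>"
| "fv (And \<phi> \<psi>) = fv \<phi> \<union> fv \<psi>"
| "fv (Conj I g) = (\<Union>i\<in>I. fv (g i))"
| "fv (Ex x \<phi>) = fv \<phi> - {x}"

text \<open>The formulas of \<open>L\<^sub>\<infinity>\<^sub>\<omega>\<close>: conjunctions of sets of formulas, finitely many free variables.\<close>

primrec wf_fm :: "'u lang \<Rightarrow> 'u fm \<Rightarrow> bool" where
  "wf_fm L (Eq s t) \<longleftrightarrow> wf_trm L s \<and> wf_trm L t"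
| "wf_fm L (Rel c ts) \<longleftrightarrow> (c, length ts) \<in> rels L \<and> list_all (wf_trm L) ts"
| "wf_fm L (Neg \<phi>) \<longleftrightarrow> wf_fm L \<phi>"
| "wf_fm L (And \<phi> \<psi>) \<longleftrightarrow> wf_fm L \<phi> \<and> wf_fm L \<psi>"
| "wf_fm L (Conj I g) \<longleftrightarrow>
     small TYPE('u) I \<and> finite (\<Union>i\<in>I. fv (g i)) \<and> (\<forall>i\<in>I. wf_fm L (g i))"
| "wf_fm L (Ex x \<phi>) \<longleftrightarrow> wf_fm L \<phi>"

primrec sat :: "'u struct \<Rightarrow> 'u fm \<Rightarrow> (nat \<Rightarrow> 'u) \<Rightarrow> bool" where
  "sat M (Eq s t) v \<longleftrightarrow> tval M v s = tval M v t"
| "sat M (Rel c ts) v \<longleftrightarrow> rl M c (map (tval M v) ts)"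
| "sat M (Neg \<phi>) v \<longleftrightarrow> \<not> sat M \<phi> v"
| "sat M (And \<phi> \<psi>) v \<longleftrightarrow> sat M \<phi> v \<and> sat M \<psi> v"
| "sat M (Conj I g) v \<longleftrightarrow> (\<forall>i\<in>I. sat M (g i) v)"
| "sat M (Ex x \<phi>) v \<longleftrightarrow> (\<exists>a\<in>univ M. sat M \<phi> (v(x := a)))"

text \<open>
  A fragment is a set, not a proper class, of formulas.  Closure under substitution of terms is not
  required: adding substitution instances does not change which maps are elementary.
\<close>

definition fragment :: "'u lang \<Rightarrow> 'u fm set \<Rightarrow> bool" where
  "fragment L \<F> \<longleftrightarrow>
     small TYPE('u) \<F> \<and> (\<forall>\<phi>\<in>\<F>. wf_fm L \<phi>) \<and>
     (\<forall>s t. wf_fm L (Eq s t) \<longrightarrow> Eq s t \<in> \<F>) \<and>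
     (\<forall>c ts. wf_fm L (Rel c ts) \<longrightarrow> Rel c ts \<in> \<F>) \<and>
     (\<forall>\<phi>. Neg \<phi> \<in> \<F> \<longleftrightarrow> \<phi> \<in> \<F>) \<and>
     (\<forall>\<phi> \<psi>. And \<phi> \<psi> \<in> \<F> \<longleftrightarrow> \<phi> \<in> \<F> \<and> \<psi> \<in> \<F>) \<and>
     (\<forall>x \<phi>. Ex x \<phi> \<in> \<F> \<longleftrightarrow> \<phi> \<in> \<F>) \<and>
     (\<forall>I g. Conj I g \<in> \<F> \<longrightarrow> (\<forall>i\<in>I. g i \<in> \<F>))"

definition is_theory :: "'u lang \<Rightarrow> 'u fm set \<Rightarrow> bool" where
  "is_theory L T \<longleftrightarrow> small TYPE('u) T \<and> (\<forall>\<phi>\<in>T. wf_fm L \<phi> \<and> fv \<phi> = {})"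

definition models :: "'u lang \<Rightarrow> 'u fm set \<Rightarrow> 'u struct set" where
  "models L T = {M. is_struct L M \<and> (\<forall>\<phi>\<in>T. \<forall>v. sat M \<phi> v)}"

text \<open>
  Only the free variables have to take values in \<open>M\<close>, so that sentences are also preserved when \<open>M\<close>
  is empty.
\<close>

definition elementary :: "'u fm set \<Rightarrow> 'u struct \<Rightarrow> 'u struct \<Rightarrow> ('u \<Rightarrow> 'u) \<Rightarrow> bool" where
  "elementary \<F> M N f \<longleftrightarrow>
     (\<forall>\<phi>\<in>\<F>. \<forall>v. v ` fv \<phi> \<subseteq> univ M \<longrightarrow> (sat M \<phi> v \<longleftrightarrow> sat N \<phi> (f \<circ> v)))"

definition model_cat :: "'u lang \<Rightarrow> 'u fm set \<Rightarrow> 'u fm set \<Rightarrow> ('u struct, 'u \<Rightarrow> 'u) category" where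
  "model_cat L T \<F> = \<lparr> obj = models L T,
     hom = (\<lambda>M N. {f \<in> extensional (univ M). homomorphism L M N f \<and> elementary \<F> M N f}),
     ide = (\<lambda>M. restrict id (univ M)),
     cmp = (\<lambda>M N P g f. compose (univ M) g f) \<rparr>"

definition elementary_category :: "'u itself \<Rightarrow> ('o, 'a) category \<Rightarrow> bool" where
  "elementary_category _ C \<longleftrightarrow>
     is_category C \<and>
     (\<exists>(L :: 'u lang) T \<F>. small_lang L \<and> is_theory L T \<and> fragment L \<F> \<and> T \<subseteq> \<F> \<and>
        equivalent_cats C (model_cat L T \<F>))"

text \<open>
  The class of models of a theory, ordered by elementary substructure for a fragment, so that
  \<open>class_cat K\<close> is itself an elementary category.
\<close>

definition axiomatizable :: "'u abstract_class \<Rightarrow> bool" where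
  "axiomatizable K \<longleftrightarrow>
     (\<exists>T \<F>. is_theory (clang K) T \<and> fragment (clang K) \<F> \<and> T \<subseteq> \<F> \<and>
        mem K = models (clang K) T \<and>
        le K = {(M, N). M \<in> mem K \<and> N \<in> mem K \<and> substruct M N \<and> elementary \<F> M N id})"

text \<open>The two type arguments are those of the objects and arrows of the target categories.\<close>

definition minimal_elementary :: "'o itself \<Rightarrow> 'a itself \<Rightarrow> 'u abstract_class \<Rightarrow> bool" where
  "minimal_elementary _ _ K \<longleftrightarrow>
     (\<forall>C :: ('o, 'a) category. elementary_category TYPE('u) C \<and> large TYPE('u) C \<longrightarrow>
        (\<exists>F. is_functor (class_cat K) C F \<and> faithful (class_cat K) F \<and>
             preserves_directed_colimits TYPE('u) (class_cat K) C F))"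

end

theory Submission
  imports Defs
begin

text \<open>
  The functor is the Ehrenfeucht--Mostowski construction, with the members of \<open>K\<close> in the place of linear
  orders.  Present the elementary category as the category of models of a theory \<open>T\<close> with the \<open>\<F>\<close>-elementary
  maps.  If the sizes of its models were bounded, it would be equivalent to a small category; since it is
  large, a big \<open>I\<close> in \<open>K\<close> injects into some model \<open>M\<close> (lemma \<open>large_has_large_models\<close>).

  Add to \<open>M\<close> a Skolem function and a relation for each formula of \<open>\<F>\<close>.  In the expanded structure the
  \<open>\<F>\<close>-type of a tuple is part of its quantifier-free type, and witnesses are values of terms.  The
  Erdos--Rado property, applied to an injection of \<open>I\<close>, assigns to the type of each finite subset \<open>s\<close> of each
  member \<open>J\<close> of \<open>K\<close> a family in \<open>M\<close> indexed by \<open>s\<close>.  The quantifier-free types of these families are coherent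
  under inclusions of subsets and invariant under \<open>K\<close>-embeddings (lemma \<open>erdos_rado_indiscernibles\<close>), so
  that they are a template for a structure generated by \<open>J\<close>: the Skolem terms over \<open>J\<close>, where equality and
  relations between finitely many terms are decided in \<open>M\<close> at the family of any \<open>s\<close> containing their
  generators.  A formula of \<open>\<F>\<close> holds of terms in the generated structure iff it holds of their values in \<open>M\<close>
  (lemma \<open>gen_model_sat\<close>).  Hence the generated structure is a model of \<open>T\<close>, and renaming generators along
  a \<open>K\<close>-embedding is \<open>\<F>\<close>-elementary.

  The functor is faithful because distinct generators stay distinct.  It preserves directed unions
  because a term has finitely many generators, and because in the category of models a cocone over a
  directed diagram is a colimit as soon as it covers its apex: elementary maps are injective and formulas
  have finitely many free variables (lemma \<open>covering_cocone_colimit\<close>).  Colimits survive the passage along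
  an equivalence to the given category (lemma \<open>weak_equivalence_directed_colimit\<close>).

  If \<open>K\<close> is axiomatizable, then its directed colimits are unions, by the Tarski--Vaught theorem and the
  uniqueness of factorisations through a colimit (lemma \<open>axiomatizable_colimits_are_unions\<close>), so that
  preserving unions is preserving all directed colimits.
\<close>

section \<open>Small sets\<close>

lemma small_subset: "small U A \<Longrightarrow> B \<subseteq> A \<Longrightarrow> small U B"
  unfolding small_def using card_of_mono1 ordLeq_ordLess_trans by blast

lemma small_image: "small U A \<Longrightarrow> small U (f ` A)"
  unfolding small_def using card_of_image ordLeq_ordLess_trans by blast

lemma small_inj_on: "inj_on f A \<Longrightarrow> f ` A \<subseteq> B \<Longrightarrow> small U B \<Longrightarrow> small U A"
  unfolding small_def by (rule ordLeq_ordLess_trans[OF card_of_ordLeqI]) auto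

lemma small_code:
  assumes "small TYPE('u) A"
  shows "\<exists>f :: 'a \<Rightarrow> 'u. inj_on f A"
  using assms card_of_ordLeq[of A "UNIV :: 'u set"] ordLess_imp_ordLeq unfolding small_def by blast

lemma inaccessible_infinite:
  assumes "inaccessible TYPE('u)"
  shows "infinite (UNIV :: 'u set)"
  using assms ordLess_imp_ordLeq infinite_iff_natLeq_ordLeq unfolding inaccessible_def by blast

lemma small_Un:
  assumes "inaccessible TYPE('u)" "small TYPE('u) A" "small TYPE('u) B"
  shows "small TYPE('u) (A \<union> B)"
  using assms inaccessible_infinite card_of_Un_ordLess_infinite unfolding small_def by blast

lemma small_countable:
  assumes "inaccessible TYPE('u)"
  shows "small TYPE('u) (UNIV :: nat set)"
  using assms card_of_nat ordIso_ordLess_trans unfolding small_def inaccessible_def by blast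

lemma small_finite:
  assumes "inaccessible TYPE('u)" "finite A"
  shows "small TYPE('u) A"
  using assms finite_iff_ordLess_natLeq[of A] ordLess_transitive
  unfolding small_def inaccessible_def by blast

lemma small_infinite_superset:
  fixes A :: "'u set"
  assumes "inaccessible TYPE('u)" "small TYPE('u) A"
  shows "\<exists>B. A \<subseteq> B \<and> infinite B \<and> small TYPE('u) B"
proof -
  obtain f :: "nat \<Rightarrow> 'u" where "inj f"
    using infinite_countable_subset inaccessible_infinite[OF assms(1)] by blast
  then have "infinite (range f)" "small TYPE('u) (range f)"
    using small_image[OF small_countable[OF assms(1)]] by (auto simp: finite_image_iff)
  then show ?thesis
    using small_Un[OF assms(1,2)] by (intro exI[of _ "A \<union> range f"]) auto
qed

text \<open>
  Inaccessibility speaks of subsets of \<open>'u\<close>; the closure properties of small sets of other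
  types are obtained by transporting them to \<open>'u\<close>.
\<close>

lemma small_transfer:
  assumes "small TYPE('u) A"
  obtains f B where "bij_betw f A (B :: 'u set)" "small TYPE('u) B"
  using small_code[OF assms] small_image[OF assms] inj_on_imp_bij_betw by metis

lemma small_Times:
  assumes U: "inaccessible TYPE('u)" and "small TYPE('u) A" "small TYPE('u) B"
  shows "small TYPE('u) (A \<times> B)"
proof -
  obtain f A' where f: "bij_betw f A (A' :: 'u set)" "small TYPE('u) A'" using small_transfer assms(2) .
  obtain g B' where g: "bij_betw g B (B' :: 'u set)" "small TYPE('u) B'" using small_transfer assms(3) .
  obtain X where X: "A' \<union> B' \<subseteq> X" "infinite X" "small TYPE('u) X"
    using small_infinite_superset[OF U small_Un[OF U f(2) g(2)]] by blast
  have XX: "small TYPE('u) (X \<times> X)"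
    using card_of_Times_same_infinite[OF X(2)] X(3) ordIso_ordLess_trans unfolding small_def by blast
  have "inj_on (map_prod f g) (A \<times> B)"
    using f(1) g(1) by (auto simp: inj_on_def bij_betw_def)
  moreover have "map_prod f g ` (A \<times> B) \<subseteq> X \<times> X"
    using f(1) g(1) X(1) by (auto simp: bij_betw_def)
  ultimately show ?thesis using XX by (rule small_inj_on)
qed

lemma small_Pow:
  assumes U: "inaccessible TYPE('u)" and "small TYPE('u) A"
  shows "small TYPE('u) (Pow A)"
proof -
  obtain f B where f: "bij_betw f A (B :: 'u set)" "small TYPE('u) B" using small_transfer assms(2) .
  have "inj_on (image f) (Pow A)"
    by (rule bij_betw_imp_inj_on[OF bij_betw_Pow[OF f(1)]])
  moreover have "image f ` Pow A \<subseteq> Pow B"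
    using f(1) by (auto simp: bij_betw_def)
  moreover have "small TYPE('u) (Pow B)"
    using U f(2) unfolding inaccessible_def small_def by blast
  ultimately show ?thesis by (rule small_inj_on)
qed

text \<open>
  Used for the Skolem terms over a set of generators, and also for counting: lists are terms with a
  single operation symbol.
\<close>

datatype (syms: 'c, gens: 'v) sterm = Gen 'v | Op 'c "('c, 'v) sterm list"

text \<open>
  A pairing function on an infinite set suffices to code lists, and then terms, by elements of the
  set; the coding below is the usual one, with two tags that separate the constructors.
\<close>

definition code_list :: "('b \<times> 'b \<Rightarrow> 'b) \<Rightarrow> 'b \<Rightarrow> 'b \<Rightarrow> 'b list \<Rightarrow> 'b" where
  "code_list p c d xs = foldr (\<lambda>x y. p (c, p (x, y))) xs (p (d, p (d, d)))"

primrec code_sterm :: "('b \<times> 'b \<Rightarrow> 'b) \<Rightarrow> 'b \<Rightarrow> 'b \<Rightarrow> ('b, 'b) sterm \<Rightarrow> 'b" where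
  "code_sterm p c d (Gen x) = p (d, x)"
| "code_sterm p c d (Op f ts) = p (c, p (f, code_list p c d (map (code_sterm p c d) ts)))"

context
  fixes p :: "'b \<times> 'b \<Rightarrow> 'b" and B :: "'b set" and c d :: 'b
  assumes p_in: "\<And>x y. x \<in> B \<Longrightarrow> y \<in> B \<Longrightarrow> p (x, y) \<in> B"
    and p_inj: "\<And>x y x' y'. x \<in> B \<Longrightarrow> y \<in> B \<Longrightarrow> x' \<in> B \<Longrightarrow> y' \<in> B \<Longrightarrow>
      p (x, y) = p (x', y') \<longleftrightarrow> x = x' \<and> y = y'"
    and c: "c \<in> B" and d: "d \<in> B" and c_d: "c \<noteq> d"
begin

lemma code_list_in: "set xs \<subseteq> B \<Longrightarrow> code_list p c d xs \<in> B"
proof (induction xs)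
  case Nil
  show ?case using p_in[OF d p_in[OF d d]] by (simp add: code_list_def)
next
  case (Cons x xs)
  then have "p (c, p (x, code_list p c d xs)) \<in> B" by (intro p_in c) auto
  then show ?case by (simp add: code_list_def)
qed

lemma code_list_inj:
  "set xs \<subseteq> B \<Longrightarrow> set ys \<subseteq> B \<Longrightarrow> code_list p c d xs = code_list p c d ys \<Longrightarrow> xs = ys"
proof (induction xs arbitrary: ys)
  case Nil
  show ?case
  proof (cases ys)
    case (Cons y zs)
    have "y \<in> B" "code_list p c d zs \<in> B" using Nil Cons by (auto intro: code_list_in)
    then show ?thesis using Nil Cons p_inj[OF d _ c] p_in[OF d d] p_in c_d
      by (simp add: code_list_def)
  qed simp
next
  case (Cons x xs)
  have x: "x \<in> B" "code_list p c d xs \<in> B" using Cons by (auto intro: code_list_in)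
  show ?case
  proof (cases ys)
    case Nil
    then show ?thesis using Cons.prems x p_inj[OF c _ d] p_in[OF d d] p_in c_d
      by (simp add: code_list_def)
  next
    case ys: (Cons y zs)
    have y: "y \<in> B" "code_list p c d zs \<in> B" "set zs \<subseteq> B"
      using Cons.prems ys by (auto intro: code_list_in)
    have "p (c, p (x, code_list p c d xs)) = p (c, p (y, code_list p c d zs))"
      using Cons.prems ys by (simp add: code_list_def)
    then have "x = y \<and> code_list p c d xs = code_list p c d zs"
      using p_inj[OF c _ c] p_in x y p_inj[OF x y(1,2)] by simp
    moreover have "set xs \<subseteq> B" using Cons.prems by simp
    ultimately show ?thesis using Cons.IH[of zs] y(3) ys by blast
  qed
qed

lemma code_sterm_in: "syms t \<subseteq> B \<Longrightarrow> gens t \<subseteq> B \<Longrightarrow> code_sterm p c d t \<in> B"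
proof (induction t)
  case (Op f ts)
  have "code_sterm p c d t \<in> B" if "t \<in> set ts" for t
    using Op.IH[OF that] Op.prems that by (simp add: UN_subset_iff)
  then have "set (map (code_sterm p c d) ts) \<subseteq> B" by (simp add: image_subset_iff)
  then have "code_list p c d (map (code_sterm p c d) ts) \<in> B" by (rule code_list_in)
  then show ?case using Op(2) p_in[OF c p_in] by simp
qed (simp add: p_in[OF d])

lemma code_sterms_in:
  "syms (Op f ts) \<subseteq> B \<Longrightarrow> gens (Op f ts) \<subseteq> B \<Longrightarrow> set (map (code_sterm p c d) ts) \<subseteq> B"
  by (simp add: image_subset_iff UN_subset_iff code_sterm_in)

lemma code_sterm_inj:
  "syms t \<subseteq> B \<Longrightarrow> gens t \<subseteq> B \<Longrightarrow> syms t' \<subseteq> B \<Longrightarrow> gens t' \<subseteq> B \<Longrightarrow>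
    code_sterm p c d t = code_sterm p c d t' \<Longrightarrow> t = t'"
proof (induction t arbitrary: t')
  case (Gen x)
  show ?case
  proof (cases t')
    case (Gen y)
    then show ?thesis using Gen.prems p_inj[OF d _ d] by simp
  next
    case (Op g us)
    have "set (map (code_sterm p c d) us) \<subseteq> B"
      using Gen.prems Op code_sterms_in[of g us] by blast
    then have "code_list p c d (map (code_sterm p c d) us) \<in> B" by (rule code_list_in)
    then show ?thesis using Gen.prems Op c_d p_inj[OF d _ c p_in] by simp
  qed
next
  case (Op f ts)
  have ts: "set (map (code_sterm p c d) ts) \<subseteq> B"
    using Op.prems code_sterms_in[of f ts] by blast
  then have L: "code_list p c d (map (code_sterm p c d) ts) \<in> B" by (rule code_list_in)
  show ?case
  proof (cases t')
    case (Gen x)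
    then show ?thesis using Op.prems Gen c_d p_inj[OF c p_in d] L by simp
  next
    case t': (Op g us)
    have us: "set (map (code_sterm p c d) us) \<subseteq> B"
      using Op.prems t' code_sterms_in[of g us] by blast
    then have "code_list p c d (map (code_sterm p c d) us) \<in> B" by (rule code_list_in)
    then have "f = g \<and> code_list p c d (map (code_sterm p c d) ts) = code_list p c d (map (code_sterm p c d) us)"
      using Op.prems t' L p_inj[OF c p_in c p_in] p_inj[of f _ g] by simp
    then have fg: "f = g" and eq: "map (code_sterm p c d) ts = map (code_sterm p c d) us"
      using code_list_inj[OF ts us] by simp_all
    have "ts = us"
    proof (rule nth_equalityI)
      show len: "length ts = length us" using eq map_eq_imp_length_eq by blast
      fix i assume i: "i < length ts"
      then have mem: "ts ! i \<in> set ts" "us ! i \<in> set us" using len by auto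
      have "syms (ts ! i) \<subseteq> B" "gens (ts ! i) \<subseteq> B" "syms (us ! i) \<subseteq> B" "gens (us ! i) \<subseteq> B"
        using mem Op.prems t' by (simp_all add: UN_subset_iff)
      moreover have "code_sterm p c d (ts ! i) = code_sterm p c d (us ! i)"
        using arg_cong[OF eq, of "\<lambda>l. l ! i"] i len by simp
      ultimately show "ts ! i = us ! i" using Op.IH mem by blast
    qed
    then show ?thesis using fg t' by simp
  qed
qed

end

lemma sterm_coding:
  assumes "infinite (B :: 'b set)"
  shows "\<exists>f. inj_on f {t :: ('b, 'b) sterm. syms t \<subseteq> B \<and> gens t \<subseteq> B} \<and>
             f ` {t. syms t \<subseteq> B \<and> gens t \<subseteq> B} \<subseteq> B"
proof -
  obtain p where p: "inj_on p (B \<times> B)" "p ` (B \<times> B) \<subseteq> B"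
    using card_of_Times_same_infinite[OF assms] card_of_ordLeq ordIso_imp_ordLeq by metis
  obtain c where c: "c \<in> B" using assms by (metis finite.emptyI equals0I)
  obtain d where d: "d \<in> B" "c \<noteq> d"
    using assms infinite_remove[of B c] by (metis finite.emptyI Diff_iff equals0I insertI1)
  have p': "x \<in> B \<Longrightarrow> y \<in> B \<Longrightarrow> p (x, y) \<in> B"
    "x \<in> B \<Longrightarrow> y \<in> B \<Longrightarrow> x' \<in> B \<Longrightarrow> y' \<in> B \<Longrightarrow> p (x, y) = p (x', y') \<longleftrightarrow> x = x' \<and> y = y'" for x y x' y'
    using p by (auto simp: inj_on_def)
  show ?thesis
    using code_sterm_inj[OF p' c d] code_sterm_in[OF p' c d]
    by (intro exI[of _ "code_sterm p c d"]) (auto simp: inj_on_def)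
qed

lemma small_sterms:
  fixes A B :: "'u set"
  assumes U: "inaccessible TYPE('u)" and "small TYPE('u) A" "small TYPE('u) B"
  shows "small TYPE('u) {t. syms t \<subseteq> A \<and> gens t \<subseteq> B}"
proof -
  obtain X where X: "A \<union> B \<subseteq> X" "infinite X" "small TYPE('u) X"
    using small_infinite_superset[OF U small_Un[OF assms]] by blast
  have "small TYPE('u) {t. syms t \<subseteq> X \<and> gens t \<subseteq> X}"
    using sterm_coding[OF X(2)] small_inj_on[OF _ _ X(3)] by metis
  then show ?thesis by (rule small_subset) (use X(1) in auto)
qed

lemma small_lists:
  fixes A :: "'u set"
  assumes "inaccessible TYPE('u)" and "small TYPE('u) A"
  shows "small TYPE('u) (lists A)"
proof -
  \<comment> \<open>A list is a term with one operation symbol.\<close>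
  have inj: "inj_on (\<lambda>xs. Op undefined (map Gen xs) :: ('u, 'u) sterm) (lists A)"
    by (auto simp: inj_on_def map_injective)
  have "(\<lambda>xs. Op undefined (map Gen xs)) ` lists A \<subseteq> {t. syms t \<subseteq> {undefined} \<and> gens t \<subseteq> A}"
    by auto
  moreover have "small TYPE('u) {undefined :: 'u}"
    by (rule small_finite[OF assms(1)]) simp
  ultimately show ?thesis
    by (rule small_inj_on[OF inj _ small_sterms[OF assms(1) _ assms(2)]])
qed

section \<open>Equivalences of categories\<close>

lemma cat_ide: "is_category C \<Longrightarrow> X \<in> obj C \<Longrightarrow> ide C X \<in> hom C X X"
  by (simp add: is_category_def)

lemma cat_ide_right:
  "is_category C \<Longrightarrow> X \<in> obj C \<Longrightarrow> Y \<in> obj C \<Longrightarrow> f \<in> hom C X Y \<Longrightarrow> cmp C X X Y f (ide C X) = f"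
  by (simp add: is_category_def)

lemma cat_ide_left:
  "is_category C \<Longrightarrow> X \<in> obj C \<Longrightarrow> Y \<in> obj C \<Longrightarrow> f \<in> hom C X Y \<Longrightarrow> cmp C X Y Y (ide C Y) f = f"
  by (simp add: is_category_def)

lemma cat_cmp:
  "is_category C \<Longrightarrow> X \<in> obj C \<Longrightarrow> Y \<in> obj C \<Longrightarrow> Z \<in> obj C \<Longrightarrow> f \<in> hom C X Y \<Longrightarrow> g \<in> hom C Y Z \<Longrightarrow>
    cmp C X Y Z g f \<in> hom C X Z"
  by (simp add: is_category_def)

lemma cat_assoc:
  "is_category C \<Longrightarrow> W \<in> obj C \<Longrightarrow> X \<in> obj C \<Longrightarrow> Y \<in> obj C \<Longrightarrow> Z \<in> obj C \<Longrightarrow>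
    f \<in> hom C W X \<Longrightarrow> g \<in> hom C X Y \<Longrightarrow> h \<in> hom C Y Z \<Longrightarrow>
    cmp C W X Z (cmp C X Y Z h g) f = cmp C W Y Z h (cmp C W X Y g f)"
  unfolding is_category_def by blast

lemma ftor_obj: "is_functor C D F \<Longrightarrow> X \<in> obj C \<Longrightarrow> omap F X \<in> obj D"
  by (simp add: is_functor_def)

lemma ftor_ide: "is_functor C D F \<Longrightarrow> X \<in> obj C \<Longrightarrow> amap F X X (ide C X) = ide D (omap F X)"
  by (simp add: is_functor_def)

lemma ftor_hom:
  "is_functor C D F \<Longrightarrow> X \<in> obj C \<Longrightarrow> Y \<in> obj C \<Longrightarrow> f \<in> hom C X Y \<Longrightarrow>
    amap F X Y f \<in> hom D (omap F X) (omap F Y)"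
  by (simp add: is_functor_def)

lemma ftor_cmp:
  "is_functor C D F \<Longrightarrow> X \<in> obj C \<Longrightarrow> Y \<in> obj C \<Longrightarrow> Z \<in> obj C \<Longrightarrow> f \<in> hom C X Y \<Longrightarrow> g \<in> hom C Y Z \<Longrightarrow>
    amap F X Z (cmp C X Y Z g f) =
    cmp D (omap F X) (omap F Y) (omap F Z) (amap F Y Z g) (amap F X Y f)"
  by (simp add: is_functor_def)

lemma functor_comp:
  assumes F: "is_functor C D F" and G: "is_functor D E G"
  shows "is_functor C E (comp_ftor G F)"
  unfolding is_functor_def comp_ftor_def
  by (simp add: ftor_obj[OF F] ftor_obj[OF G] ftor_ide[OF F] ftor_ide[OF G] ftor_hom[OF F]
      ftor_hom[OF G] ftor_cmp[OF F] ftor_cmp[OF G])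

text \<open>
  Fully faithful and essentially surjective.  Such functors compose and transport colimits without
  any bookkeeping of natural isomorphisms.
\<close>

definition weak_equivalence ::
  "('o, 'a) category \<Rightarrow> ('p, 'b) category \<Rightarrow> ('o, 'a, 'p, 'b) ftor \<Rightarrow> bool" where
  "weak_equivalence C D F \<longleftrightarrow>
     is_functor C D F \<and>
     (\<forall>X\<in>obj C. \<forall>Y\<in>obj C. bij_betw (amap F X Y) (hom C X Y) (hom D (omap F X) (omap F Y))) \<and>
     (\<forall>Z\<in>obj D. \<exists>X\<in>obj C. \<exists>e. is_iso D (omap F X) Z e)"

lemma functor_iso:
  assumes F: "is_functor C D F" and XY: "X \<in> obj C" "Y \<in> obj C" and f: "is_iso C X Y f"
  shows "is_iso D (omap F X) (omap F Y) (amap F X Y f)"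
proof -
  obtain g where f: "f \<in> hom C X Y" and g: "g \<in> hom C Y X" "cmp C X Y X g f = ide C X" "cmp C Y X Y f g = ide C Y"
    using f unfolding is_iso_def by blast
  have "cmp D (omap F X) (omap F Y) (omap F X) (amap F Y X g) (amap F X Y f) = ide D (omap F X)"
    using ftor_cmp[OF F XY(1,2,1) f g(1)] g ftor_ide[OF F XY(1)] by simp
  moreover have "cmp D (omap F Y) (omap F X) (omap F Y) (amap F X Y f) (amap F Y X g) = ide D (omap F Y)"
    using ftor_cmp[OF F XY(2,1,2) g(1) f] g ftor_ide[OF F XY(2)] by simp
  ultimately show ?thesis
    using ftor_hom[OF F XY f] ftor_hom[OF F XY(2,1) g(1)] unfolding is_iso_def by blast
qed

lemma iso_comp:
  assumes C: "is_category C" and obj: "X \<in> obj C" "Y \<in> obj C" "Z \<in> obj C"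
    and f: "is_iso C X Y f" and g: "is_iso C Y Z g"
  shows "is_iso C X Z (cmp C X Y Z g f)"
proof -
  obtain f' where f': "f' \<in> hom C Y X" "cmp C X Y X f' f = ide C X" "cmp C Y X Y f f' = ide C Y"
    and fh: "f \<in> hom C X Y" using f unfolding is_iso_def by blast
  obtain g' where g': "g' \<in> hom C Z Y" "cmp C Y Z Y g' g = ide C Y" "cmp C Z Y Z g g' = ide C Z"
    and gh: "g \<in> hom C Y Z" using g unfolding is_iso_def by blast
  have gf: "cmp C X Y Z g f \<in> hom C X Z" by (rule cat_cmp[OF C obj fh gh])
  have fg: "cmp C Z Y X f' g' \<in> hom C Z X" by (rule cat_cmp[OF C obj(3,2,1) g'(1) f'(1)])
  have "cmp C X Z X (cmp C Z Y X f' g') (cmp C X Y Z g f) = cmp C X Y X f' (cmp C X Z Y g' (cmp C X Y Z g f))"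
    by (rule cat_assoc[OF C obj(1,3,2,1) gf g'(1) f'(1)])
  also have "cmp C X Z Y g' (cmp C X Y Z g f) = f"
    using cat_assoc[OF C obj(1,2,3,2) fh gh g'(1)] g'(2) cat_ide_left[OF C obj(1,2) fh] by simp
  finally have 1: "cmp C X Z X (cmp C Z Y X f' g') (cmp C X Y Z g f) = ide C X" using f' by simp
  have "cmp C Z X Z (cmp C X Y Z g f) (cmp C Z Y X f' g') = cmp C Z Y Z g (cmp C Z X Y f (cmp C Z Y X f' g'))"
    by (rule cat_assoc[OF C obj(3,1,2,3) fg fh gh])
  also have "cmp C Z X Y f (cmp C Z Y X f' g') = g'"
    using cat_assoc[OF C obj(3,2,1,2) g'(1) f'(1) fh] f'(3) cat_ide_left[OF C obj(3,2) g'(1)] by simp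
  finally have 2: "cmp C Z X Z (cmp C X Y Z g f) (cmp C Z Y X f' g') = ide C Z" using g' by simp
  show ?thesis using gf fg 1 2 unfolding is_iso_def by blast
qed

lemma iso_cancel_left:
  assumes C: "is_category C" and obj: "X \<in> obj C" "Y \<in> obj C" "Z \<in> obj C"
    and e: "is_iso C Y Z e" and f: "f \<in> hom C X Y" and g: "g \<in> hom C X Y"
    and eq: "cmp C X Y Z e f = cmp C X Y Z e g"
  shows "f = g"
proof -
  obtain e' where eh: "e \<in> hom C Y Z" and e': "e' \<in> hom C Z Y" "cmp C Y Z Y e' e = ide C Y"
    using e unfolding is_iso_def by blast
  have "cmp C X Z Y e' (cmp C X Y Z e k) = k" if "k \<in> hom C X Y" for k
    using cat_assoc[OF C obj(1,2,3,2) that eh e'(1)] e'(2) cat_ide_left[OF C obj(1,2) that] by simp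
  then show ?thesis using f g eq by metis
qed

lemma iso_cancel_right:
  assumes C: "is_category C" and obj: "X \<in> obj C" "Y \<in> obj C" "Z \<in> obj C"
    and e: "is_iso C X Y e" and f: "f \<in> hom C Y Z" and g: "g \<in> hom C Y Z"
    and eq: "cmp C X Y Z f e = cmp C X Y Z g e"
  shows "f = g"
proof -
  obtain e' where eh: "e \<in> hom C X Y" and e': "e' \<in> hom C Y X" "cmp C Y X Y e e' = ide C Y"
    using e unfolding is_iso_def by blast
  have "cmp C Y X Z (cmp C X Y Z k e) e' = k" if "k \<in> hom C Y Z" for k
    using cat_assoc[OF C obj(2,1,2,3) e'(1) eh that] e'(2) cat_ide_right[OF C obj(2,3) that] by simp
  then show ?thesis using f g eq by metis
qed

lemma iso_factor:
  assumes C: "is_category C" and obj: "X \<in> obj C" "Y \<in> obj C" "Z \<in> obj C"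
    and e: "is_iso C Y Z e" and f: "f \<in> hom C X Z"
  shows "\<exists>g\<in>hom C X Y. cmp C X Y Z e g = f"
proof -
  obtain e' where eh: "e \<in> hom C Y Z" and e': "e' \<in> hom C Z Y" "cmp C Z Y Z e e' = ide C Z"
    using e unfolding is_iso_def by blast
  have "cmp C X Y Z e (cmp C X Z Y e' f) = f"
    using cat_assoc[OF C obj(1,3,2,3) f e'(1) eh] e'(2) cat_ide_left[OF C obj(1,3) f] by simp
  then show ?thesis using cat_cmp[OF C obj(1,3,2) f e'(1)] by blast
qed

lemma nat_isomorphic_id:
  assumes "nat_isomorphic C C (comp_ftor G F) id_ftor"
  shows "\<exists>\<eta>. (\<forall>X. X \<in> obj C \<longrightarrow> is_iso C (omap G (omap F X)) X (\<eta> X)) \<and>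
    (\<forall>X Y f. X \<in> obj C \<longrightarrow> Y \<in> obj C \<longrightarrow> f \<in> hom C X Y \<longrightarrow>
       cmp C (omap G (omap F X)) (omap G (omap F Y)) Y (\<eta> Y) (amap G (omap F X) (omap F Y) (amap F X Y f)) =
       cmp C (omap G (omap F X)) X Y f (\<eta> X))"
  using assms unfolding nat_isomorphic_def comp_ftor_def id_ftor_def ftor.simps Ball_def by blast

text \<open>
  The naturality square of \<open>\<eta> : G F \<cong> 1\<close> recovers \<open>f\<close> from \<open>F f\<close>, because \<open>\<eta>\<close> can be cancelled.
\<close>

lemma natural_id_faithful:
  assumes C: "is_category C" and F: "is_functor C D F" and G: "is_functor D C G"
    and iso: "nat_isomorphic C C (comp_ftor G F) id_ftor"
  shows "faithful C F"
  unfolding faithful_def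
proof (intro ballI inj_onI)
  fix X Y f g
  assume XY: "X \<in> obj C" "Y \<in> obj C" and f: "f \<in> hom C X Y" and g: "g \<in> hom C X Y"
    and eq: "amap F X Y f = amap F X Y g"
  let ?GF = "\<lambda>X. omap G (omap F X)"
  obtain \<eta> where \<eta>: "\<And>X. X \<in> obj C \<Longrightarrow> is_iso C (?GF X) X (\<eta> X)"
    "\<And>X Y f. X \<in> obj C \<Longrightarrow> Y \<in> obj C \<Longrightarrow> f \<in> hom C X Y \<Longrightarrow>
       cmp C (?GF X) (?GF Y) Y (\<eta> Y) (amap G (omap F X) (omap F Y) (amap F X Y f)) =
       cmp C (?GF X) X Y f (\<eta> X)"
    using nat_isomorphic_id[OF iso] by blast
  have "cmp C (?GF X) X Y f (\<eta> X) = cmp C (?GF X) X Y g (\<eta> X)"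
    using \<eta>(2)[OF XY f] \<eta>(2)[OF XY g] eq by simp
  then show "f = g"
    using iso_cancel_right[OF C _ XY \<eta>(1)[OF XY(1)] f g] ftor_obj[OF G ftor_obj[OF F XY(1)]] by blast
qed

text \<open>
  For fullness of \<open>F\<close>, a map \<open>h : F X \<rightarrow> F Y\<close> is the image of \<open>\<eta>\<^sub>Y \<circ> G h \<circ> \<eta>\<^sub>X\<^sup>-\<^sup>1\<close>, because both have the same
  image under the faithful functor \<open>G\<close>.
\<close>

lemma equivalence_weak:
  assumes C: "is_category C" and D: "is_category D" and F: "is_functor C D F" and G: "is_functor D C G"
    and GF: "nat_isomorphic C C (comp_ftor G F) id_ftor"
    and FG: "nat_isomorphic D D (comp_ftor F G) id_ftor"
  shows "weak_equivalence C D F"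
proof -
  let ?GF = "\<lambda>X. omap G (omap F X)"
  obtain \<eta> where \<eta>: "\<And>X. X \<in> obj C \<Longrightarrow> is_iso C (?GF X) X (\<eta> X)"
    "\<And>X Y f. X \<in> obj C \<Longrightarrow> Y \<in> obj C \<Longrightarrow> f \<in> hom C X Y \<Longrightarrow>
       cmp C (?GF X) (?GF Y) Y (\<eta> Y) (amap G (omap F X) (omap F Y) (amap F X Y f)) =
       cmp C (?GF X) X Y f (\<eta> X)"
    using nat_isomorphic_id[OF GF] by blast
  have faithF: "inj_on (amap F X Y) (hom C X Y)" if "X \<in> obj C" "Y \<in> obj C" for X Y
    using natural_id_faithful[OF C F G GF] that unfolding faithful_def by blast
  have faithG: "inj_on (amap G X Y) (hom D X Y)" if "X \<in> obj D" "Y \<in> obj D" for X Y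
    using natural_id_faithful[OF D G F FG] that unfolding faithful_def by blast
  have full: "\<exists>f\<in>hom C X Y. amap F X Y f = h"
    if XY: "X \<in> obj C" "Y \<in> obj C" and h: "h \<in> hom D (omap F X) (omap F Y)" for X Y h
  proof -
    note FX = ftor_obj[OF F XY(1)] ftor_obj[OF F XY(2)]
    note GFX = ftor_obj[OF G FX(1)] ftor_obj[OF G FX(2)]
    obtain e' where \<eta>h: "\<eta> X \<in> hom C (?GF X) X" and e': "e' \<in> hom C X (?GF X)"
      "cmp C (?GF X) X (?GF X) e' (\<eta> X) = ide C (?GF X)"
      using \<eta>(1)[OF XY(1)] unfolding is_iso_def by blast
    have \<eta>Y: "\<eta> Y \<in> hom C (?GF Y) Y" using \<eta>(1)[OF XY(2)] unfolding is_iso_def by blast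
    let ?g = "amap G (omap F X) (omap F Y) h"
    have g: "?g \<in> hom C (?GF X) (?GF Y)" by (rule ftor_hom[OF G FX h])
    let ?k = "cmp C (?GF X) (?GF Y) Y (\<eta> Y) ?g"
    have k: "?k \<in> hom C (?GF X) Y" by (rule cat_cmp[OF C GFX XY(2) g \<eta>Y])
    define f where "f = cmp C X (?GF X) Y ?k e'"
    have f: "f \<in> hom C X Y" unfolding f_def by (rule cat_cmp[OF C XY(1) GFX(1) XY(2) e'(1) k])
    have "cmp C (?GF X) X Y f (\<eta> X) = ?k"
      unfolding f_def using cat_assoc[OF C GFX(1) XY(1) GFX(1) XY(2) \<eta>h e'(1) k] e'(2)
        cat_ide_right[OF C GFX(1) XY(2) k] by simp
    then have "cmp C (?GF X) (?GF Y) Y (\<eta> Y) (amap G (omap F X) (omap F Y) (amap F X Y f)) = ?k"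
      using \<eta>(2)[OF XY f] by simp
    then have "amap G (omap F X) (omap F Y) (amap F X Y f) = ?g"
      using iso_cancel_left[OF C GFX XY(2) \<eta>(1)[OF XY(2)] _ g]
        ftor_hom[OF G FX ftor_hom[OF F XY f]] by blast
    then have "amap F X Y f = h"
      using inj_onD[OF faithG[OF FX]] ftor_hom[OF F XY f] h by blast
    then show ?thesis using f by blast
  qed
  have "bij_betw (amap F X Y) (hom C X Y) (hom D (omap F X) (omap F Y))"
    if XY: "X \<in> obj C" "Y \<in> obj C" for X Y
    unfolding bij_betw_def
  proof
    show "amap F X Y ` hom C X Y = hom D (omap F X) (omap F Y)"
      using full[OF XY] ftor_hom[OF F XY] by blast
  qed (rule faithF[OF XY])
  moreover have "\<exists>X\<in>obj C. \<exists>e. is_iso D (omap F X) Z e" if "Z \<in> obj D" for Z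
    using nat_isomorphic_id[OF FG] that ftor_obj[OF G that] by blast
  ultimately show ?thesis unfolding weak_equivalence_def using F by blast
qed

lemma equivalent_cats_sym: "equivalent_cats C D \<Longrightarrow> equivalent_cats D C"
  unfolding equivalent_cats_def by blast

lemma equivalent_cats_weak:
  assumes "is_category C" "is_category D" "equivalent_cats C D"
  shows "\<exists>F. weak_equivalence C D F"
  using assms equivalence_weak unfolding equivalent_cats_def by blast

text \<open>
  The inverse \<open>G\<close> is built from a choice of isomorphisms \<open>\<epsilon>\<^sub>Z : F (G Z) \<rightarrow> Z\<close>; its action on an arrow
  \<open>h : Z \<rightarrow> W\<close> is determined by \<open>\<epsilon>\<^sub>W \<circ> F (G h) = h \<circ> \<epsilon>\<^sub>Z\<close>, and every equation between arrows in the image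
  of \<open>G\<close> is checked after applying \<open>F\<close> and composing with \<open>\<epsilon>\<close>.
\<close>

lemma weak_equivalent_cats:
  assumes C: "is_category C" and D: "is_category D" and w: "weak_equivalence C D F"
  shows "equivalent_cats C D"
proof -
  have F: "is_functor C D F"
    and bij: "\<And>X Y. X \<in> obj C \<Longrightarrow> Y \<in> obj C \<Longrightarrow> bij_betw (amap F X Y) (hom C X Y) (hom D (omap F X) (omap F Y))"
    using w unfolding weak_equivalence_def by auto
  have "\<forall>Z. \<exists>X e. Z \<in> obj D \<longrightarrow> X \<in> obj C \<and> is_iso D (omap F X) Z e"
    using w unfolding weak_equivalence_def by blast
  then obtain g \<epsilon> where g: "\<And>Z. Z \<in> obj D \<Longrightarrow> g Z \<in> obj C"
    and \<epsilon>: "\<And>Z. Z \<in> obj D \<Longrightarrow> is_iso D (omap F (g Z)) Z (\<epsilon> Z)"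
    by metis
  have \<epsilon>h: "\<epsilon> Z \<in> hom D (omap F (g Z)) Z" if "Z \<in> obj D" for Z
    using \<epsilon>[OF that] unfolding is_iso_def by blast
  note Fg = ftor_obj[OF F g]
  have full: "\<exists>f\<in>hom C X Y. amap F X Y f = h"
    if "X \<in> obj C" "Y \<in> obj C" "h \<in> hom D (omap F X) (omap F Y)" for X Y h
    using bij[OF that(1,2)] that(3) unfolding bij_betw_def by force
  have faith: "f = f'" if "X \<in> obj C" "Y \<in> obj C" "f \<in> hom C X Y" "f' \<in> hom C X Y" "amap F X Y f = amap F X Y f'" for X Y f f'
    using bij[OF that(1,2)] that(3-5) unfolding bij_betw_def inj_on_def by blast
  have ex: "\<exists>k\<in>hom C (g Z) (g W). cmp D (omap F (g Z)) (omap F (g W)) W (\<epsilon> W) (amap F (g Z) (g W) k) =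
       cmp D (omap F (g Z)) Z W h (\<epsilon> Z)" if ZW: "Z \<in> obj D" "W \<in> obj D" and h: "h \<in> hom D Z W" for Z W h
    using iso_factor[OF D Fg[OF ZW(1)] Fg[OF ZW(2)] ZW(2) \<epsilon>[OF ZW(2)] cat_cmp[OF D Fg[OF ZW(1)] ZW \<epsilon>h[OF ZW(1)] h]]
      full[OF g[OF ZW(1)] g[OF ZW(2)]] by metis
  have uniq: "k = k'" if ZW: "X \<in> obj C" "W \<in> obj D" and k: "k \<in> hom C X (g W)" "k' \<in> hom C X (g W)"
    and eq: "cmp D (omap F X) (omap F (g W)) W (\<epsilon> W) (amap F X (g W) k) =
      cmp D (omap F X) (omap F (g W)) W (\<epsilon> W) (amap F X (g W) k')" for X W k k'
    using iso_cancel_left[OF D ftor_obj[OF F ZW(1)] Fg[OF ZW(2)] ZW(2) \<epsilon>[OF ZW(2)]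
        ftor_hom[OF F ZW(1) g[OF ZW(2)] k(1)] ftor_hom[OF F ZW(1) g[OF ZW(2)] k(2)] eq]
      faith[OF ZW(1) g[OF ZW(2)] k] by blast
  define ga where "ga Z W h = (SOME k. k \<in> hom C (g Z) (g W) \<and>
      cmp D (omap F (g Z)) (omap F (g W)) W (\<epsilon> W) (amap F (g Z) (g W) k) =
       cmp D (omap F (g Z)) Z W h (\<epsilon> Z))" for Z W h
  have ga: "ga Z W h \<in> hom C (g Z) (g W)"
    and ga_eq: "cmp D (omap F (g Z)) (omap F (g W)) W (\<epsilon> W) (amap F (g Z) (g W) (ga Z W h)) =
       cmp D (omap F (g Z)) Z W h (\<epsilon> Z)" if "Z \<in> obj D" "W \<in> obj D" "h \<in> hom D Z W" for Z W h
    using someI_ex[OF ex[OF that, unfolded Bex_def]] unfolding ga_def by blast+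
  define G where "G = \<lparr> omap = g, amap = ga \<rparr>"
  have G: "is_functor D C G"
    unfolding is_functor_def G_def ftor.simps
  proof (intro conjI ballI g ga)
    fix Z assume Z: "Z \<in> obj D"
    show "ga Z Z (ide D Z) = ide C (g Z)"
    proof (rule uniq[OF g[OF Z] Z ga[OF Z Z cat_ide[OF D Z]] cat_ide[OF C g[OF Z]]])
      show "cmp D (omap F (g Z)) (omap F (g Z)) Z (\<epsilon> Z) (amap F (g Z) (g Z) (ga Z Z (ide D Z))) =
        cmp D (omap F (g Z)) (omap F (g Z)) Z (\<epsilon> Z) (amap F (g Z) (g Z) (ide C (g Z)))"
        using ga_eq[OF Z Z cat_ide[OF D Z]] ftor_ide[OF F g[OF Z]] cat_ide_left[OF D Fg[OF Z] Z \<epsilon>h[OF Z]]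
          cat_ide_right[OF D Fg[OF Z] Z \<epsilon>h[OF Z]] by simp
    qed
  next
    fix X Y Z f h assume X: "X \<in> obj D" and Y: "Y \<in> obj D" and Z: "Z \<in> obj D"
      and f: "f \<in> hom D X Y" and h: "h \<in> hom D Y Z"
    note hf = cat_cmp[OF D X Y Z f h]
    note gg = cat_cmp[OF C g[OF X] g[OF Y] g[OF Z] ga[OF X Y f] ga[OF Y Z h]]
    have "cmp D (omap F (g X)) (omap F (g Z)) Z (\<epsilon> Z)
        (amap F (g X) (g Z) (cmp C (g X) (g Y) (g Z) (ga Y Z h) (ga X Y f))) =
      cmp D (omap F (g X)) (omap F (g Z)) Z (\<epsilon> Z)
        (cmp D (omap F (g X)) (omap F (g Y)) (omap F (g Z)) (amap F (g Y) (g Z) (ga Y Z h)) (amap F (g X) (g Y) (ga X Y f)))"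
      using ftor_cmp[OF F g[OF X] g[OF Y] g[OF Z] ga[OF X Y f] ga[OF Y Z h]] by simp
    also have "\<dots> = cmp D (omap F (g X)) (omap F (g Y)) Z
        (cmp D (omap F (g Y)) (omap F (g Z)) Z (\<epsilon> Z) (amap F (g Y) (g Z) (ga Y Z h))) (amap F (g X) (g Y) (ga X Y f))"
      using cat_assoc[OF D Fg[OF X] Fg[OF Y] Fg[OF Z] Z ftor_hom[OF F g[OF X] g[OF Y] ga[OF X Y f]]
          ftor_hom[OF F g[OF Y] g[OF Z] ga[OF Y Z h]] \<epsilon>h[OF Z]] by simp
    also have "\<dots> = cmp D (omap F (g X)) Y Z h (cmp D (omap F (g X)) (omap F (g Y)) Y (\<epsilon> Y) (amap F (g X) (g Y) (ga X Y f)))"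
      unfolding ga_eq[OF Y Z h]
      by (rule cat_assoc[OF D Fg[OF X] Fg[OF Y] Y Z ftor_hom[OF F g[OF X] g[OF Y] ga[OF X Y f]] \<epsilon>h[OF Y] h])
    also have "\<dots> = cmp D (omap F (g X)) X Z (cmp D X Y Z h f) (\<epsilon> X)"
      unfolding ga_eq[OF X Y f] using cat_assoc[OF D Fg[OF X] X Y Z \<epsilon>h[OF X] f h] by simp
    finally show "ga X Z (cmp D X Y Z h f) = cmp C (g X) (g Y) (g Z) (ga Y Z h) (ga X Y f)"
      using ga_eq[OF X Z hf] by (intro uniq[OF g[OF X] Z ga[OF X Z hf] gg]) simp
  qed
  have FG: "nat_isomorphic D D (comp_ftor F G) id_ftor"
    unfolding nat_isomorphic_def comp_ftor_def id_ftor_def G_def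
    using \<epsilon> ga_eq by (intro exI[of _ \<epsilon>]) simp
  have "\<forall>X. \<exists>u. X \<in> obj C \<longrightarrow> u \<in> hom C (g (omap F X)) X \<and> amap F (g (omap F X)) X u = \<epsilon> (omap F X)"
    using full g ftor_obj[OF F] \<epsilon>h by metis
  then obtain u where u: "\<And>X. X \<in> obj C \<Longrightarrow> u X \<in> hom C (g (omap F X)) X"
    "\<And>X. X \<in> obj C \<Longrightarrow> amap F (g (omap F X)) X (u X) = \<epsilon> (omap F X)" by metis
  have GF: "nat_isomorphic C C (comp_ftor G F) id_ftor"
    unfolding nat_isomorphic_def comp_ftor_def id_ftor_def G_def ftor.simps
  proof (intro exI[of _ u] conjI ballI)
    fix X assume X: "X \<in> obj C"
    note FX = ftor_obj[OF F X] and gX = g[OF ftor_obj[OF F X]]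
    obtain e where e: "e \<in> hom D (omap F X) (omap F (g (omap F X)))"
      "cmp D (omap F (g (omap F X))) (omap F X) (omap F (g (omap F X))) e (\<epsilon> (omap F X)) = ide D (omap F (g (omap F X)))"
      "cmp D (omap F X) (omap F (g (omap F X))) (omap F X) (\<epsilon> (omap F X)) e = ide D (omap F X)"
      using \<epsilon>[OF FX] unfolding is_iso_def by blast
    obtain v where v: "v \<in> hom C X (g (omap F X))" "amap F X (g (omap F X)) v = e"
      using full[OF X gX e(1)] by blast
    have "cmp C (g (omap F X)) X (g (omap F X)) v (u X) = ide C (g (omap F X))"
      using faith[OF gX gX cat_cmp[OF C gX X gX u(1)[OF X] v(1)] cat_ide[OF C gX]]
        ftor_cmp[OF F gX X gX u(1)[OF X] v(1)] ftor_ide[OF F gX] e v u(2)[OF X] by simp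
    moreover have "cmp C X (g (omap F X)) X (u X) v = ide C X"
      using faith[OF X X cat_cmp[OF C X gX X v(1) u(1)[OF X]] cat_ide[OF C X]]
        ftor_cmp[OF F X gX X v(1) u(1)[OF X]] ftor_ide[OF F X] e v u(2)[OF X] by simp
    ultimately show "is_iso C (g (omap F X)) X (u X)"
      unfolding is_iso_def using u(1)[OF X] v by blast
  next
    fix X Y f assume X: "X \<in> obj C" and Y: "Y \<in> obj C" and f: "f \<in> hom C X Y"
    note FX = ftor_obj[OF F X] and gX = g[OF ftor_obj[OF F X]]
    note FY = ftor_obj[OF F Y] and gY = g[OF ftor_obj[OF F Y]]
    note Ff = ftor_hom[OF F X Y f]
    show "cmp C (g (omap F X)) (g (omap F Y)) Y (u Y) (ga (omap F X) (omap F Y) (amap F X Y f)) =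
       cmp C (g (omap F X)) X Y f (u X)"
    proof (rule faith[OF gX Y cat_cmp[OF C gX gY Y ga[OF FX FY Ff] u(1)[OF Y]] cat_cmp[OF C gX X Y u(1)[OF X] f]])
      show "amap F (g (omap F X)) Y (cmp C (g (omap F X)) (g (omap F Y)) Y (u Y) (ga (omap F X) (omap F Y) (amap F X Y f))) =
        amap F (g (omap F X)) Y (cmp C (g (omap F X)) X Y f (u X))"
        using ftor_cmp[OF F gX gY Y ga[OF FX FY Ff] u(1)[OF Y]] ftor_cmp[OF F gX X Y u(1)[OF X] f]
          ga_eq[OF FX FY Ff] u(2)[OF X] u(2)[OF Y] by simp
    qed
  qed
  show ?thesis unfolding equivalent_cats_def using F G FG GF by blast
qed

text \<open>
  Index representatives of the isomorphism classes by elements of \<open>'u\<close>, and code the arrows between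
  them one hom set at a time.  The resulting small category maps to \<open>C\<close> by a fully faithful functor by
  construction, and by an essentially surjective one because of the choice of representatives.
\<close>

lemma essentially_small:
  fixes C :: "('o, 'a) category" and e :: "'u \<Rightarrow> 'o"
  assumes C: "is_category C" and Ob: "small TYPE('u) Ob" and e: "e ` Ob \<subseteq> obj C"
    and homs: "\<And>x y. x \<in> Ob \<Longrightarrow> y \<in> Ob \<Longrightarrow> small TYPE('u) (hom C (e x) (e y))"
    and iso: "\<And>Z. Z \<in> obj C \<Longrightarrow> \<exists>x\<in>Ob. \<exists>f. is_iso C (e x) Z f"
  shows "\<not> large TYPE('u) C"
proof -
  have "\<forall>x y. \<exists>a :: 'a \<Rightarrow> 'u. x \<in> Ob \<and> y \<in> Ob \<longrightarrow> inj_on a (hom C (e x) (e y))"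
    using small_code[OF homs] by blast
  then obtain \<alpha> :: "'u \<Rightarrow> 'u \<Rightarrow> 'a \<Rightarrow> 'u" where \<alpha>: "\<And>x y. x \<in> Ob \<Longrightarrow> y \<in> Ob \<Longrightarrow> inj_on (\<alpha> x y) (hom C (e x) (e y))"
    by metis
  define \<beta> where "\<beta> x y = inv_into (hom C (e x) (e y)) (\<alpha> x y)" for x y
  have \<beta>: "\<beta> x y (\<alpha> x y f) = f" if "x \<in> Ob" "y \<in> Ob" "f \<in> hom C (e x) (e y)" for x y f
    unfolding \<beta>_def using \<alpha> that by simp
  define S :: "('u, 'u) category" where "S = \<lparr> obj = Ob, hom = (\<lambda>x y. \<alpha> x y ` hom C (e x) (e y)),
    ide = (\<lambda>x. \<alpha> x x (ide C (e x))),
    cmp = (\<lambda>x y z g f. \<alpha> x z (cmp C (e x) (e y) (e z) (\<beta> y z g) (\<beta> x y f))) \<rparr>"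
  have eO: "e x \<in> obj C" if "x \<in> Ob" for x using e that by blast
  have S: "is_category S"
    unfolding is_category_def S_def
    by (auto simp: \<beta> eO cat_ide[OF C] cat_cmp[OF C] cat_ide_left[OF C] cat_ide_right[OF C] cat_assoc[OF C])
  have sm: "small_category TYPE('u) S"
    unfolding small_category_def using S Ob homs by (auto simp: S_def intro: small_image)
  define F where "F = \<lparr> omap = e, amap = \<beta> \<rparr>"
  have F: "is_functor S C F"
    unfolding is_functor_def S_def F_def
    by (auto simp: \<beta> eO cat_ide[OF C] cat_cmp[OF C])
  have "weak_equivalence S C F"
    unfolding weak_equivalence_def
  proof (intro conjI ballI F)
    fix x y assume "x \<in> obj S" "y \<in> obj S"
    then show "bij_betw (amap F x y) (hom S x y) (hom C (omap F x) (omap F y))"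
      unfolding F_def S_def \<beta>_def using \<alpha>[of x y]
      by (simp add: bij_betw_inv_into inj_on_imp_bij_betw)
  next
    fix Z assume "Z \<in> obj C"
    then show "\<exists>X\<in>obj S. \<exists>f. is_iso C (omap F X) Z f" using iso unfolding S_def F_def by auto
  qed
  then have "equivalent_cats C S" using weak_equivalent_cats[OF S C] equivalent_cats_sym by blast
  then show ?thesis using sm unfolding large_def by blast
qed

lemma functor_cocone:
  assumes G: "is_functor A C G" and D: "is_functor J A D" and cocone: "is_cocone J A D X \<iota>"
  shows "is_cocone J C (comp_ftor G D) (omap G X) (\<lambda>i. amap G (omap D i) X (\<iota> i))"
proof -
  have X: "X \<in> obj A" and \<iota>: "\<And>i. i \<in> obj J \<Longrightarrow> \<iota> i \<in> hom A (omap D i) X"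
    and \<iota>_cmp: "\<And>i j f. i \<in> obj J \<Longrightarrow> j \<in> obj J \<Longrightarrow> f \<in> hom J i j \<Longrightarrow>
      cmp A (omap D i) (omap D j) X (\<iota> j) (amap D i j f) = \<iota> i"
    using cocone unfolding is_cocone_def by auto
  note Di = ftor_obj[OF D]
  show ?thesis
    unfolding is_cocone_def comp_ftor_def ftor.simps
  proof (intro conjI ballI)
    show "omap G X \<in> obj C" by (rule ftor_obj[OF G X])
    fix i assume i: "i \<in> obj J"
    show "amap G (omap D i) X (\<iota> i) \<in> hom C (omap G (omap D i)) (omap G X)"
      by (rule ftor_hom[OF G Di[OF i] X \<iota>[OF i]])
    fix j f assume j: "j \<in> obj J" and f: "f \<in> hom J i j"
    show "cmp C (omap G (omap D i)) (omap G (omap D j)) (omap G X) (amap G (omap D j) X (\<iota> j))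
        (amap G (omap D i) (omap D j) (amap D i j f)) = amap G (omap D i) X (\<iota> i)"
      using ftor_cmp[OF G Di[OF i] Di[OF j] X ftor_hom[OF D i j f] \<iota>[OF j]] \<iota>_cmp[OF i j f] by simp
  qed
qed

text \<open>
  A cocone over the image of a diagram under a fully faithful functor \<open>G\<close> may, up to an isomorphism
  \<open>e : G B \<rightarrow> Y\<close> of its apex, be pulled back along \<open>G\<close>.
\<close>

lemma weak_equivalence_colimit:
  assumes A: "is_category A" and C: "is_category C" and w: "weak_equivalence A C G"
    and D: "is_functor J A D" and colim: "is_colimit J A D X \<iota>"
  shows "is_colimit J C (comp_ftor G D) (omap G X) (\<lambda>i. amap G (omap D i) X (\<iota> i))"
proof -
  have G: "is_functor A C G"
    and bij: "\<And>X Y. X \<in> obj A \<Longrightarrow> Y \<in> obj A \<Longrightarrow> bij_betw (amap G X Y) (hom A X Y) (hom C (omap G X) (omap G Y))"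
    using w unfolding weak_equivalence_def by auto
  have full: "\<exists>f\<in>hom A X Y. amap G X Y f = h"
    if "X \<in> obj A" "Y \<in> obj A" "h \<in> hom C (omap G X) (omap G Y)" for X Y h
    using bij[OF that(1,2)] that(3) unfolding bij_betw_def by force
  have faith: "f = f'" if "X \<in> obj A" "Y \<in> obj A" "f \<in> hom A X Y" "f' \<in> hom A X Y" "amap G X Y f = amap G X Y f'" for X Y f f'
    using bij[OF that(1,2)] that(3-5) unfolding bij_betw_def inj_on_def by blast
  have cocone: "is_cocone J A D X \<iota>"
    and univ: "\<And>Y \<kappa>. is_cocone J A D Y \<kappa> \<Longrightarrow>
      \<exists>!u. u \<in> hom A X Y \<and> (\<forall>i\<in>obj J. cmp A (omap D i) X Y u (\<iota> i) = \<kappa> i)"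
    using colim unfolding is_colimit_def by auto
  have X: "X \<in> obj A" and \<iota>: "\<And>i. i \<in> obj J \<Longrightarrow> \<iota> i \<in> hom A (omap D i) X"
    and \<iota>_cmp: "\<And>i j f. i \<in> obj J \<Longrightarrow> j \<in> obj J \<Longrightarrow> f \<in> hom J i j \<Longrightarrow>
      cmp A (omap D i) (omap D j) X (\<iota> j) (amap D i j f) = \<iota> i"
    using cocone unfolding is_cocone_def by auto
  note Di = ftor_obj[OF D]
  note GX = ftor_obj[OF G X] and GDi = ftor_obj[OF G Di]
  have cocone': "is_cocone J C (comp_ftor G D) (omap G X) (\<lambda>i. amap G (omap D i) X (\<iota> i))"
    by (rule functor_cocone[OF G D cocone])
  have "\<exists>!u. u \<in> hom C (omap G X) Y \<and>
      (\<forall>i\<in>obj J. cmp C (omap G (omap D i)) (omap G X) Y u (amap G (omap D i) X (\<iota> i)) = \<kappa> i)"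
    if cY: "is_cocone J C (comp_ftor G D) Y \<kappa>" for Y \<kappa>
  proof -
    have Y: "Y \<in> obj C" and \<kappa>: "\<And>i. i \<in> obj J \<Longrightarrow> \<kappa> i \<in> hom C (omap G (omap D i)) Y"
      and \<kappa>_cmp: "\<And>i j f. i \<in> obj J \<Longrightarrow> j \<in> obj J \<Longrightarrow> f \<in> hom J i j \<Longrightarrow>
        cmp C (omap G (omap D i)) (omap G (omap D j)) Y (\<kappa> j) (amap G (omap D i) (omap D j) (amap D i j f)) = \<kappa> i"
      using cY unfolding is_cocone_def comp_ftor_def by auto
    obtain B e where B: "B \<in> obj A" and e: "is_iso C (omap G B) Y e"
      using w Y unfolding weak_equivalence_def by blast
    note GB = ftor_obj[OF G B]
    have eh: "e \<in> hom C (omap G B) Y" using e unfolding is_iso_def by blast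
    have "\<forall>i. \<exists>k. i \<in> obj J \<longrightarrow> k \<in> hom A (omap D i) B \<and>
        cmp C (omap G (omap D i)) (omap G B) Y e (amap G (omap D i) B k) = \<kappa> i"
      using iso_factor[OF C GDi GB Y e \<kappa>] full[OF Di B] by metis
    then obtain k where k: "\<And>i. i \<in> obj J \<Longrightarrow> k i \<in> hom A (omap D i) B"
      and k_eq: "\<And>i. i \<in> obj J \<Longrightarrow> cmp C (omap G (omap D i)) (omap G B) Y e (amap G (omap D i) B (k i)) = \<kappa> i"
      by metis
    have "is_cocone J A D B k"
      unfolding is_cocone_def
    proof (intro conjI ballI B k)
      fix i j f assume i: "i \<in> obj J" and j: "j \<in> obj J" and f: "f \<in> hom J i j"
      note Df = ftor_hom[OF D i j f]
      note kD = cat_cmp[OF A Di[OF i] Di[OF j] B Df k[OF j]]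
      note GDf = ftor_hom[OF G Di[OF i] Di[OF j] Df]
      have "cmp C (omap G (omap D i)) (omap G B) Y e
          (amap G (omap D i) B (cmp A (omap D i) (omap D j) B (k j) (amap D i j f))) =
        cmp C (omap G (omap D i)) (omap G (omap D j)) Y
          (cmp C (omap G (omap D j)) (omap G B) Y e (amap G (omap D j) B (k j)))
          (amap G (omap D i) (omap D j) (amap D i j f))"
        using ftor_cmp[OF G Di[OF i] Di[OF j] B Df k[OF j]]
          cat_assoc[OF C GDi[OF i] GDi[OF j] GB Y GDf ftor_hom[OF G Di[OF j] B k[OF j]] eh] by simp
      also have "\<dots> = cmp C (omap G (omap D i)) (omap G B) Y e (amap G (omap D i) B (k i))"
        using k_eq[OF i] k_eq[OF j] \<kappa>_cmp[OF i j f] by simp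
      finally have "amap G (omap D i) B (cmp A (omap D i) (omap D j) B (k j) (amap D i j f)) = amap G (omap D i) B (k i)"
        using iso_cancel_left[OF C GDi[OF i] GB Y e] ftor_hom[OF G Di[OF i] B] kD k[OF i] by blast
      then show "cmp A (omap D i) (omap D j) B (k j) (amap D i j f) = k i"
        using faith[OF Di[OF i] B kD k[OF i]] by blast
    qed
    then obtain u where u: "u \<in> hom A X B" "\<And>i. i \<in> obj J \<Longrightarrow> cmp A (omap D i) X B u (\<iota> i) = k i"
      and u_uniq: "\<And>v. v \<in> hom A X B \<Longrightarrow> (\<forall>i\<in>obj J. cmp A (omap D i) X B v (\<iota> i) = k i) \<Longrightarrow> v = u"
      using univ[of B k] by blast
    have Gcmp: "cmp C (omap G (omap D i)) (omap G X) Y (cmp C (omap G X) (omap G B) Y e (amap G X B v))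
        (amap G (omap D i) X (\<iota> i)) =
        cmp C (omap G (omap D i)) (omap G B) Y e (amap G (omap D i) B (cmp A (omap D i) X B v (\<iota> i)))"
      if i: "i \<in> obj J" and v: "v \<in> hom A X B" for i v
      using ftor_cmp[OF G Di[OF i] X B \<iota>[OF i] v]
        cat_assoc[OF C GDi[OF i] GX GB Y ftor_hom[OF G Di[OF i] X \<iota>[OF i]] ftor_hom[OF G X B v] eh] by simp
    show ?thesis
    proof (rule ex1I[of _ "cmp C (omap G X) (omap G B) Y e (amap G X B u)"])
      show "cmp C (omap G X) (omap G B) Y e (amap G X B u) \<in> hom C (omap G X) Y \<and>
        (\<forall>i\<in>obj J. cmp C (omap G (omap D i)) (omap G X) Y (cmp C (omap G X) (omap G B) Y e (amap G X B u))
           (amap G (omap D i) X (\<iota> i)) = \<kappa> i)"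
        using cat_cmp[OF C GX GB Y ftor_hom[OF G X B u(1)] eh] Gcmp[OF _ u(1)] u(2) k_eq by simp
    next
      fix v assume v: "v \<in> hom C (omap G X) Y \<and>
        (\<forall>i\<in>obj J. cmp C (omap G (omap D i)) (omap G X) Y v (amap G (omap D i) X (\<iota> i)) = \<kappa> i)"
      obtain w where w: "w \<in> hom A X B" "cmp C (omap G X) (omap G B) Y e (amap G X B w) = v"
        using iso_factor[OF C GX GB Y e] full[OF X B] v by metis
      have "cmp A (omap D i) X B w (\<iota> i) = k i" if i: "i \<in> obj J" for i
      proof -
        note wi = cat_cmp[OF A Di[OF i] X B \<iota>[OF i] w(1)]
        have "cmp C (omap G (omap D i)) (omap G B) Y e (amap G (omap D i) B (cmp A (omap D i) X B w (\<iota> i))) =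
          cmp C (omap G (omap D i)) (omap G B) Y e (amap G (omap D i) B (k i))"
          using Gcmp[OF i w(1)] w(2) v i k_eq[OF i] by simp
        then have "amap G (omap D i) B (cmp A (omap D i) X B w (\<iota> i)) = amap G (omap D i) B (k i)"
          using iso_cancel_left[OF C GDi[OF i] GB Y e] ftor_hom[OF G Di[OF i] B] wi k[OF i] by blast
        then show ?thesis using faith[OF Di[OF i] B wi k[OF i]] by blast
      qed
      then have "w = u" using u_uniq w(1) by blast
      then show "v = cmp C (omap G X) (omap G B) Y e (amap G X B u)" using w(2) by simp
    qed
  qed
  then show ?thesis unfolding is_colimit_def using cocone' by (simp add: comp_ftor_def)
qed

lemma weak_equivalence_directed_colimit:
  assumes "is_category A" "is_category C" "weak_equivalence A C G" "is_directed_colimit P r A D X \<iota>"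
  shows "is_directed_colimit P r C (comp_ftor G D) (omap G X) (\<lambda>i. amap G (omap D i) X (\<iota> i))"
proof -
  have D: "is_functor (poset_cat P r) A D" and G: "is_functor A C G"
    using assms(3,4) unfolding is_directed_colimit_def weak_equivalence_def by simp_all
  have "is_colimit (poset_cat P r) C (comp_ftor G D) (omap G X) (\<lambda>i. amap G (omap D i) X (\<iota> i))"
    by (rule weak_equivalence_colimit[OF assms(1-3) D])
      (use assms(4) in \<open>simp add: is_directed_colimit_def\<close>)
  then show ?thesis
    using assms(4) functor_comp[OF D G] unfolding is_directed_colimit_def by simp
qed

section \<open>Satisfaction and elementary maps\<close>

lemma finite_tvars: "finite (tvars t)"
  by (induction t) auto

lemma finite_fv: "wf_fm L \<phi> \<Longrightarrow> finite (fv \<phi>)"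
  by (induction \<phi>) (auto simp: finite_tvars)

lemma tval_cong: "(\<And>x. x \<in> tvars t \<Longrightarrow> v x = w x) \<Longrightarrow> tval M v t = tval M w t"
proof (induction t)
  case (App c ts)
  have "map (tval M v) ts = map (tval M w) ts"
    by (rule map_cong[OF refl], rule App.IH) (use App.prems in auto)
  then show ?case by (simp del: map_eq_conv)
qed simp

lemma sat_cong: "(\<And>x. x \<in> fv \<phi> \<Longrightarrow> v x = w x) \<Longrightarrow> sat M \<phi> v \<longleftrightarrow> sat M \<phi> w"
proof (induction \<phi> arbitrary: v w)
  case (Eq s t)
  then show ?case using tval_cong[of s v w M] tval_cong[of t v w M] by auto
next
  case (Rel c ts)
  have "map (tval M v) ts = map (tval M w) ts"
    by (rule map_cong[OF refl], rule tval_cong) (use Rel in auto)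
  then show ?case by (simp del: map_eq_conv)
next
  case (Neg \<phi>)
  have "sat M \<phi> v \<longleftrightarrow> sat M \<phi> w" by (rule Neg.IH) (use Neg.prems in simp)
  then show ?case by simp
next
  case (And \<phi> \<psi>)
  have "sat M \<phi> v \<longleftrightarrow> sat M \<phi> w" by (rule And.IH(1)) (use And.prems in simp)
  moreover have "sat M \<psi> v \<longleftrightarrow> sat M \<psi> w" by (rule And.IH(2)) (use And.prems in simp)
  ultimately show ?case by simp
next
  case (Conj I g)
  have "sat M (g i) v \<longleftrightarrow> sat M (g i) w" if "i \<in> I" for i
    by (rule Conj.IH) (use Conj.prems that in auto)
  then show ?case by simp
next
  case (Ex x \<phi>)
  have "sat M \<phi> (v(x := a)) \<longleftrightarrow> sat M \<phi> (w(x := a))" for a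
    by (rule Ex.IH) (use Ex.prems in auto)
  then show ?case by simp
qed

lemma struct_fn_closed:
  "is_struct L M \<Longrightarrow> (c, length xs) \<in> funs L \<Longrightarrow> set xs \<subseteq> univ M \<Longrightarrow> fn M c xs \<in> univ M"
  unfolding is_struct_def by metis

lemma struct_fn_undefined:
  "is_struct L M \<Longrightarrow> \<not> ((c, length xs) \<in> funs L \<and> set xs \<subseteq> univ M) \<Longrightarrow> fn M c xs = undefined"
  unfolding is_struct_def by metis

lemma struct_rl: "is_struct L M \<Longrightarrow> rl M c xs \<Longrightarrow> (c, length xs) \<in> rels L \<and> set xs \<subseteq> univ M"
  unfolding is_struct_def by metis

lemma struct_small: "is_struct L M \<Longrightarrow> small TYPE('u) (univ (M :: 'u struct))"
  by (simp add: is_struct_def)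

lemma tval_hom:
  assumes M: "is_struct L M" and f: "homomorphism L M N f"
  shows "wf_trm L t \<Longrightarrow> v ` tvars t \<subseteq> univ M \<Longrightarrow> tval M v t \<in> univ M \<and> f (tval M v t) = tval N (f \<circ> v) t"
proof (induction t)
  case (App c ts)
  have ts: "tval M v t \<in> univ M \<and> f (tval M v t) = tval N (f \<circ> v) t" if "t \<in> set ts" for t
    by (rule App.IH[OF that]) (use App.prems that in \<open>auto simp: list_all_iff\<close>)
  let ?xs = "map (tval M v) ts"
  have c: "(c, length ?xs) \<in> funs L" and xs: "set ?xs \<subseteq> univ M" using App.prems ts by auto
  have eq: "map f ?xs = map (tval N (f \<circ> v)) ts" using ts by simp
  have "f (fn M c ?xs) = fn N c (map f ?xs)"
    using f c xs unfolding homomorphism_def by blast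
  then have "f (tval M v (App c ts)) = tval N (f \<circ> v) (App c ts)"
    unfolding eq tval.simps .
  then show ?case using struct_fn_closed[OF M c xs] unfolding tval.simps by blast
qed simp

lemma comp_fun_upd: "f \<circ> v(x := a) = (f \<circ> v)(x := f a)"
  by auto

text \<open>
  Only the free variables are required to take values in \<open>M\<close>, as in the definition of elementary maps,
  so that the statement also covers sentences over an empty carrier.
\<close>

lemma sat_iso:
  assumes M: "is_struct L M" and f: "struct_iso L M N f"
  shows "wf_fm L \<phi> \<Longrightarrow> v ` fv \<phi> \<subseteq> univ M \<Longrightarrow> sat M \<phi> v \<longleftrightarrow> sat N \<phi> (f \<circ> v)"
proof (induction \<phi> arbitrary: v)
  have hom: "homomorphism L M N f" and inj: "inj_on f (univ M)" and im: "f ` univ M = univ N"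
    and refl: "\<And>c xs. (c, length xs) \<in> rels L \<Longrightarrow> set xs \<subseteq> univ M \<Longrightarrow> rl N c (map f xs) \<Longrightarrow> rl M c xs"
    and pres: "\<And>c xs. (c, length xs) \<in> rels L \<Longrightarrow> set xs \<subseteq> univ M \<Longrightarrow> rl M c xs \<Longrightarrow> rl N c (map f xs)"
    using f unfolding struct_iso_def embedding_def homomorphism_def by blast+
  {
    case (Eq s t)
    then have "tval M v s \<in> univ M \<and> f (tval M v s) = tval N (f \<circ> v) s"
      "tval M v t \<in> univ M \<and> f (tval M v t) = tval N (f \<circ> v) t"
      by (auto intro!: tval_hom[OF M hom] simp: image_subset_iff)
    then show ?case using inj by (metis inj_onD sat.simps(1))
  next
    case (Rel c ts)
    have ts: "tval M v t \<in> univ M \<and> f (tval M v t) = tval N (f \<circ> v) t" if "t \<in> set ts" for t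
      using Rel that by (intro tval_hom[OF M hom]) (auto simp: list_all_iff)
    then have eq: "map f (map (tval M v) ts) = map (tval N (f \<circ> v)) ts"
      and xs: "set (map (tval M v) ts) \<subseteq> univ M"
      by auto
    have c: "(c, length (map (tval M v) ts)) \<in> rels L" using Rel.prems(1) by simp
    show ?case using refl[OF c xs] pres[OF c xs] unfolding eq sat.simps by blast
  next
    case (Neg \<phi>)
    then show ?case by simp
  next
    case (And \<phi> \<psi>)
    have "v ` fv \<phi> \<subseteq> univ M" "v ` fv \<psi> \<subseteq> univ M" using And.prems by auto
    then show ?case using And.IH And.prems(1) by simp
  next
    case (Conj I g)
    have "sat M (g i) v \<longleftrightarrow> sat N (g i) (f \<circ> v)" if "i \<in> I" for i
      by (rule Conj.IH) (use Conj.prems that in auto)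
    then show ?case unfolding sat.simps by blast
  next
    case (Ex x \<phi>)
    have "sat M \<phi> (v(x := a)) \<longleftrightarrow> sat N \<phi> ((f \<circ> v)(x := f a))" if "a \<in> univ M" for a
      unfolding comp_fun_upd[symmetric] by (rule Ex.IH) (use Ex.prems that in auto)
    then show ?case unfolding sat.simps im[symmetric] by blast
  }
qed

lemma hom_fn:
  "homomorphism L M N f \<Longrightarrow> (c, length xs) \<in> funs L \<Longrightarrow> set xs \<subseteq> univ M \<Longrightarrow> f (fn M c xs) = fn N c (map f xs)"
  unfolding homomorphism_def by blast

lemma map_inv_into_map:
  "inj_on f A \<Longrightarrow> set xs \<subseteq> A \<Longrightarrow> map (inv_into A f) (map f xs) = xs"
  by (auto intro!: map_idI simp: subset_iff)

lemma map_map_inv_into: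
  "set ys \<subseteq> f ` A \<Longrightarrow> map f (map (inv_into A f) ys) = ys"
  by (auto intro!: map_idI simp: subset_iff f_inv_into_f)

lemma set_map_inv_into:
  "set ys \<subseteq> f ` A \<Longrightarrow> set (map (inv_into A f) ys) \<subseteq> A"
  by (auto simp: subset_iff inv_into_into)

lemma struct_iso_inv:
  assumes M: "is_struct L M" and f: "struct_iso L M N f"
  shows "struct_iso L N M (inv_into (univ M) f)"
proof -
  let ?g = "inv_into (univ M) f"
  have hom: "homomorphism L M N f" and inj: "inj_on f (univ M)" and im: "f ` univ M = univ N"
    and refl: "\<And>c xs. (c, length xs) \<in> rels L \<Longrightarrow> set xs \<subseteq> univ M \<Longrightarrow> rl N c (map f xs) \<Longrightarrow> rl M c xs"
    and pres: "\<And>c xs. (c, length xs) \<in> rels L \<Longrightarrow> set xs \<subseteq> univ M \<Longrightarrow> rl M c xs \<Longrightarrow> rl N c (map f xs)"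
    using f unfolding struct_iso_def embedding_def homomorphism_def by blast+
  have bij: "bij_betw ?g (univ N) (univ M)"
    using inj im by (metis bij_betw_imageI bij_betw_inv_into)
  have ys: "map f (map ?g ys) = ys" "set (map ?g ys) \<subseteq> univ M" if "set ys \<subseteq> univ N" for ys
    using that map_map_inv_into[of ys f "univ M"] set_map_inv_into[of ys f "univ M"] im by auto
  have "?g (fn N c ys) = fn M c (map ?g ys)" if c: "(c, length ys) \<in> funs L" "set ys \<subseteq> univ N" for c ys
  proof -
    have "f (fn M c (map ?g ys)) = fn N c ys"
      using hom_fn[OF hom, of c "map ?g ys"] ys[OF c(2)] c(1) by simp
    moreover have "fn M c (map ?g ys) \<in> univ M"
      using struct_fn_closed[OF M, of c "map ?g ys"] ys[OF c(2)] c(1) by simp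
    ultimately show ?thesis using inv_into_f_f[OF inj] by metis
  qed
  moreover have "rl N c ys \<longleftrightarrow> rl M c (map ?g ys)" if c: "(c, length ys) \<in> rels L" "set ys \<subseteq> univ N" for c ys
    using refl[of c "map ?g ys"] pres[of c "map ?g ys"] ys[OF c(2)] c(1) by auto
  ultimately show ?thesis
    using bij unfolding struct_iso_def embedding_def homomorphism_def bij_betw_def by blast
qed

text \<open>
  The copy of \<open>M\<close> on the set \<open>g M\<close>, with the interpretations set to their default values elsewhere.
\<close>

definition transport :: "'u lang \<Rightarrow> 'u struct \<Rightarrow> ('u \<Rightarrow> 'u) \<Rightarrow> 'u struct" where
  "transport L M g = \<lparr> univ = g ` univ M,
     fn = (\<lambda>c xs. if (c, length xs) \<in> funs L \<and> set xs \<subseteq> g ` univ M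
       then g (fn M c (map (inv_into (univ M) g) xs)) else undefined),
     rl = (\<lambda>c xs. set xs \<subseteq> g ` univ M \<and> rl M c (map (inv_into (univ M) g) xs)) \<rparr>"

lemma transport_struct:
  assumes M: "is_struct L M" and g: "inj_on g (univ M)"
  shows "is_struct L (transport L M g)" and "struct_iso L M (transport L M g) g"
proof -
  have "fn M c (map (inv_into (univ M) g) xs) \<in> univ M" if "(c, length xs) \<in> funs L" "set xs \<subseteq> g ` univ M" for c xs
    using that struct_fn_closed[OF M, of c "map (inv_into (univ M) g) xs"] set_map_inv_into[OF that(2)] by simp
  moreover have "(c, length xs) \<in> rels L" if "rl M c (map (inv_into (univ M) g) xs)" for c xs
    using struct_rl[OF M that] by simp
  ultimately show "is_struct L (transport L M g)"
    using small_image[OF struct_small[OF M]] unfolding is_struct_def transport_def by simp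
  show "struct_iso L M (transport L M g) g"
    unfolding struct_iso_def embedding_def homomorphism_def transport_def
    using g map_inv_into_map[OF g] by (auto simp del: map_map)
qed

lemma fragment_wf: "fragment L \<F> \<Longrightarrow> \<phi> \<in> \<F> \<Longrightarrow> wf_fm L \<phi>"
  by (simp add: fragment_def)

lemma fragment_finite_fv: "fragment L \<F> \<Longrightarrow> \<phi> \<in> \<F> \<Longrightarrow> finite (fv \<phi>)"
  using fragment_wf finite_fv by blast

lemma fragment_Eq: "fragment L \<F> \<Longrightarrow> wf_trm L s \<Longrightarrow> wf_trm L t \<Longrightarrow> Eq s t \<in> \<F>"
  by (simp add: fragment_def)

lemma fragment_Rel: "fragment L \<F> \<Longrightarrow> (c, length ts) \<in> rels L \<Longrightarrow> list_all (wf_trm L) ts \<Longrightarrow> Rel c ts \<in> \<F>"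
  by (simp add: fragment_def)

lemma fragment_sub:
  assumes "fragment L \<F>"
  shows "Neg \<phi> \<in> \<F> \<longleftrightarrow> \<phi> \<in> \<F>" "And \<phi> \<psi> \<in> \<F> \<longleftrightarrow> \<phi> \<in> \<F> \<and> \<psi> \<in> \<F>" "Ex x \<phi> \<in> \<F> \<longleftrightarrow> \<phi> \<in> \<F>"
    "Conj I g \<in> \<F> \<Longrightarrow> i \<in> I \<Longrightarrow> g i \<in> \<F>"
  using assms unfolding fragment_def by blast+

lemma elementaryD:
  "elementary \<F> M N f \<Longrightarrow> \<phi> \<in> \<F> \<Longrightarrow> v ` fv \<phi> \<subseteq> univ M \<Longrightarrow> sat M \<phi> v \<longleftrightarrow> sat N \<phi> (f \<circ> v)"
  by (simp add: elementary_def)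

text \<open>
  Apply elementarity to the atomic formula whose \<open>n\<close> argument places are the variables \<open>0, \<dots>, n-1\<close>.
\<close>

lemma elementary_rl:
  assumes F: "fragment L \<F>" and f: "elementary \<F> M N f" and c: "(c, length xs) \<in> rels L"
    and xs: "set xs \<subseteq> univ M"
  shows "rl M c xs \<longleftrightarrow> rl N c (map f xs)"
proof -
  let ?\<phi> = "Rel c (map Var [0..<length xs])"
  have fv: "fv ?\<phi> = {..<length xs}" by auto
  have val: "map (tval N (g \<circ> (!) xs)) (map Var [0..<length xs]) = map g xs" for N g
    by (rule nth_equalityI) auto
  have "?\<phi> \<in> \<F>" by (rule fragment_Rel[OF F]) (use c in \<open>auto simp: list_all_iff\<close>)
  moreover have "(!) xs ` fv ?\<phi> \<subseteq> univ M" unfolding fv using xs by (auto simp: subset_iff)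
  ultimately have "sat M ?\<phi> ((!) xs) \<longleftrightarrow> sat N ?\<phi> (f \<circ> (!) xs)" by (rule elementaryD[OF f])
  then show ?thesis using val[of M id] val[of N f] by (simp del: map_map)
qed

text \<open>The graph of an operation, as a formula: the argument places are \<open>0, \<dots>, n-1\<close>, the value is \<open>n\<close>.\<close>

definition graph_fm :: "'u \<Rightarrow> nat \<Rightarrow> 'u fm" where
  "graph_fm c n = Eq (App c (map Var [0..<n])) (Var n)"

lemma fv_graph_fm: "fv (graph_fm c n) = {..n}"
  unfolding graph_fm_def by (auto simp: atMost_def)

lemma graph_fm_in: "fragment L \<F> \<Longrightarrow> (c, n) \<in> funs L \<Longrightarrow> graph_fm c n \<in> \<F>"
  unfolding graph_fm_def by (rule fragment_Eq) (auto simp: list_all_iff)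

lemma sat_graph_fm: "sat M (graph_fm c n) v \<longleftrightarrow> fn M c (map v [0..<n]) = v n"
  unfolding graph_fm_def by (simp add: comp_def)

lemma elementary_inj:
  assumes F: "fragment L \<F>" and f: "elementary \<F> M N f"
  shows "inj_on f (univ M)"
proof (rule inj_onI)
  fix x y assume xy: "x \<in> univ M" "y \<in> univ M" "f x = f y"
  have "Eq (Var 0) (Var 1) \<in> \<F>" by (rule fragment_Eq[OF F]) simp_all
  from elementaryD[OF f this, of "\<lambda>k. if k = 0 then x else y"] show "x = y" using xy by simp
qed

lemma elementary_homomorphism:
  assumes F: "fragment L \<F>" and M: "is_struct L M" and f: "elementary \<F> M N f" and im: "f ` univ M \<subseteq> univ N"
  shows "homomorphism L M N f"
proof -
  have "f (fn M c xs) = fn N c (map f xs)" if c: "(c, length xs) \<in> funs L" and xs: "set xs \<subseteq> univ M" for c xs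
  proof -
    let ?n = "length xs"
    let ?v = "\<lambda>k. if k < ?n then xs ! k else fn M c xs"
    have v: "map ?v [0..<?n] = xs" by (rule nth_equalityI) auto
    have fv: "map (f \<circ> ?v) [0..<?n] = map f xs" by (rule nth_equalityI) auto
    have "?v ` fv (graph_fm c ?n) \<subseteq> univ M"
      using struct_fn_closed[OF M c xs] xs by (auto simp: fv_graph_fm subset_iff)
    then have "sat M (graph_fm c ?n) ?v \<longleftrightarrow> sat N (graph_fm c ?n) (f \<circ> ?v)"
      by (rule elementaryD[OF f graph_fm_in[OF F c]])
    then show ?thesis unfolding sat_graph_fm v fv by simp
  qed
  then show ?thesis unfolding homomorphism_def using im elementary_rl[OF F f] by blast
qed

lemma elementary_cong:
  assumes "\<And>x. x \<in> univ M \<Longrightarrow> f x = g x"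
  shows "elementary \<F> M N f \<longleftrightarrow> elementary \<F> M N g"
proof -
  have "sat N \<phi> (f \<circ> v) \<longleftrightarrow> sat N \<phi> (g \<circ> v)" if "v ` fv \<phi> \<subseteq> univ M" for \<phi> v
    by (rule sat_cong) (use that assms in auto)
  then show ?thesis unfolding elementary_def by blast
qed

lemma elementary_comp:
  assumes f: "elementary \<F> M N f" and g: "elementary \<F> N P g" and im: "f ` univ M \<subseteq> univ N"
  shows "elementary \<F> M P (g \<circ> f)"
  unfolding elementary_def
proof (intro ballI allI impI)
  fix \<phi> v assume \<phi>: "\<phi> \<in> \<F>" and v: "v ` fv \<phi> \<subseteq> univ M"
  have "(f \<circ> v) ` fv \<phi> \<subseteq> univ N" using v im by auto
  then show "sat M \<phi> v \<longleftrightarrow> sat P \<phi> (g \<circ> f \<circ> v)"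
    using elementaryD[OF f \<phi> v] elementaryD[OF g \<phi>, of "f \<circ> v"] by (simp add: comp_assoc)
qed

lemma models_struct: "M \<in> models L T \<Longrightarrow> is_struct L M"
  by (simp add: models_def)

text \<open>
  Every atomic formula belongs to the fragment, so that elementary maps are homomorphisms.
\<close>

lemma model_hom:
  assumes "fragment L \<F>" "M \<in> models L T"
  shows "f \<in> hom (model_cat L T \<F>) M N \<longleftrightarrow>
    f \<in> extensional (univ M) \<and> f ` univ M \<subseteq> univ N \<and> elementary \<F> M N f"
  using elementary_homomorphism[OF assms(1) models_struct[OF assms(2)], of N f]
  by (auto simp: model_cat_def homomorphism_def)

lemma model_cat_simps:
  "obj (model_cat L T \<F>) = models L T"
  "ide (model_cat L T \<F>) M = restrict id (univ M)"
  "cmp (model_cat L T \<F>) M N P g f = compose (univ M) g f"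
  by (simp_all add: model_cat_def)

lemma elementary_restrict: "elementary \<F> M N (restrict f (univ M)) \<longleftrightarrow> elementary \<F> M N f"
  by (rule elementary_cong) simp

lemma elementary_compose:
  assumes "elementary \<F> M N f" "elementary \<F> N P g" "f ` univ M \<subseteq> univ N"
  shows "elementary \<F> M P (compose (univ M) g f)"
  using elementary_cong[of M "compose (univ M) g f" "g \<circ> f"] elementary_comp[OF assms]
  by (simp add: compose_def)

lemma elementary_id: "elementary \<F> M M id"
  by (simp add: elementary_def)

lemma model_cat_category:
  assumes F: "fragment L \<F>"
  shows "is_category (model_cat L T \<F>)"
  unfolding is_category_def model_cat_simps
proof (intro conjI ballI)
  fix M assume M: "M \<in> models L T"
  show "restrict id (univ M) \<in> hom (model_cat L T \<F>) M M"
    by (simp add: model_hom[OF F M] elementary_restrict elementary_id)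
  fix N f assume N: "N \<in> models L T" and f: "f \<in> hom (model_cat L T \<F>) M N"
  show "compose (univ M) f (restrict id (univ M)) = f"
    using f unfolding model_hom[OF F M] compose_def by (auto simp: extensional_def)
  show "compose (univ M) (restrict id (univ N)) f = f"
    using f unfolding model_hom[OF F M] compose_def
    by (auto simp: extensional_def fun_eq_iff image_subset_iff)
next
  fix M N P f g assume M: "M \<in> models L T" and N: "N \<in> models L T" and P: "P \<in> models L T"
    and f: "f \<in> hom (model_cat L T \<F>) M N" and g: "g \<in> hom (model_cat L T \<F>) N P"
  show "compose (univ M) g f \<in> hom (model_cat L T \<F>) M P"
    using f g elementary_compose[of \<F> M N f P g] unfolding model_hom[OF F M] model_hom[OF F N]
    by (auto simp: compose_def image_subset_iff)
next
  fix M N P Q f g h assume M: "M \<in> models L T" and N: "N \<in> models L T" and P: "P \<in> models L T" and Q: "Q \<in> models L T"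
    and f: "f \<in> hom (model_cat L T \<F>) M N" and g: "g \<in> hom (model_cat L T \<F>) N P" and h: "h \<in> hom (model_cat L T \<F>) P Q"
  show "compose (univ M) (compose (univ N) h g) f = compose (univ M) h (compose (univ M) g f)"
    using f unfolding model_hom[OF F M] compose_def by (auto simp: fun_eq_iff)
qed

section \<open>Directed colimits of models\<close>

text \<open>
  The finiteness of supports (of a term, or of the free variables of a formula) enters all arguments
  about directed unions through this fact.
\<close>

lemma directed_finite_subset:
  assumes dir: "directed_poset P r" and mono: "\<And>i j. (i, j) \<in> r \<Longrightarrow> A i \<subseteq> A j"
  shows "finite S \<Longrightarrow> S \<subseteq> (\<Union>i\<in>P. A i) \<Longrightarrow> \<exists>i\<in>P. S \<subseteq> A i"
proof (induction S rule: finite_induct)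
  case empty
  then show ?case using dir unfolding directed_poset_def by auto
next
  case (insert x S)
  then obtain i j where ij: "i \<in> P" "x \<in> A i" "j \<in> P" "S \<subseteq> A j" by auto
  then obtain k where "k \<in> P" "(i, k) \<in> r" "(j, k) \<in> r"
    using dir unfolding directed_poset_def by blast
  then show ?case using mono ij by blast
qed

lemma poset_cat_simps:
  "obj (poset_cat P r) = P"
  "ide (poset_cat P r) i = ()"
  "cmp (poset_cat P r) i j k g f = ()"
  "f \<in> hom (poset_cat P r) i j \<longleftrightarrow> (i, j) \<in> r"
  by (simp_all add: poset_cat_def)

lemma directed_poset_field: "directed_poset P r \<Longrightarrow> (i, j) \<in> r \<Longrightarrow> i \<in> P \<and> j \<in> P"
  unfolding directed_poset_def partial_order_on_def preorder_on_def by blast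

text \<open>
  Because the maps are injective, a point of a covering cocone determines where any other cocone
  sends it; and a formula has finitely many free variables, whose values lie in the image of a
  single member of the diagram.
\<close>

lemma covering_cocone_colimit:
  assumes F: "fragment L \<F>" and dir: "directed_poset P r"
    and D: "is_functor (poset_cat P r) (model_cat L T \<F>) D"
    and cocone: "is_cocone (poset_cat P r) (model_cat L T \<F>) D X \<iota>"
    and cover: "univ X \<subseteq> (\<Union>i\<in>P. \<iota> i ` univ (omap D i))"
  shows "is_colimit (poset_cat P r) (model_cat L T \<F>) D X \<iota>"
proof -
  let ?C = "model_cat L T \<F>" and ?J = "poset_cat P r"
  let ?A = "\<lambda>i. univ (omap D i)"
  have Di: "omap D i \<in> models L T" if "i \<in> P" for i
    using ftor_obj[OF D] that by (simp add: poset_cat_simps model_cat_simps)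
  have Dij: "amap D i j () ` ?A i \<subseteq> ?A j" if "(i, j) \<in> r" for i j
    using ftor_hom[OF D, of i j "()"] that directed_poset_field[OF dir that] model_hom[OF F Di]
    by (auto simp: poset_cat_simps)
  have X: "X \<in> models L T" using cocone by (simp add: is_cocone_def model_cat_simps)
  have cc: "Y \<in> models L T \<and> (\<forall>i\<in>P. \<kappa> i \<in> hom ?C (omap D i) Y) \<and>
      (\<forall>i j. (i, j) \<in> r \<longrightarrow> (\<forall>a\<in>?A i. \<kappa> j (amap D i j () a) = \<kappa> i a))"
    if "is_cocone ?J ?C D Y \<kappa>" for Y \<kappa>
  proof -
    have "compose (?A i) (\<kappa> j) (amap D i j ()) = \<kappa> i" if "(i, j) \<in> r" for i j
      using \<open>is_cocone ?J ?C D Y \<kappa>\<close> directed_poset_field[OF dir that] that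
      unfolding is_cocone_def by (auto simp: poset_cat_simps model_cat_simps)
    then have "\<kappa> j (amap D i j () a) = \<kappa> i a" if "(i, j) \<in> r" "a \<in> ?A i" for i j a
      using that compose_eq[of a "?A i" "\<kappa> j" "amap D i j ()"] by simp
    then show ?thesis using that unfolding is_cocone_def by (auto simp: poset_cat_simps model_cat_simps)
  qed
  have X_hom: "\<And>i. i \<in> P \<Longrightarrow> \<iota> i \<in> hom ?C (omap D i) X"
    and X_cmp: "\<And>i j a. (i, j) \<in> r \<Longrightarrow> a \<in> ?A i \<Longrightarrow> \<iota> j (amap D i j () a) = \<iota> i a"
    using cc[OF cocone] by blast+
  have \<iota>: "\<iota> i ` ?A i \<subseteq> univ X" "elementary \<F> (omap D i) X (\<iota> i)" if "i \<in> P" for i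
    using X_hom[OF that] model_hom[OF F Di[OF that]] by auto
  have \<iota>_inj: "inj_on (\<iota> i) (?A i)" if "i \<in> P" for i
    using elementary_inj[OF F \<iota>(2)[OF that]] .
  have mono: "\<iota> i ` ?A i \<subseteq> \<iota> j ` ?A j" if "(i, j) \<in> r" for i j
  proof (rule image_subsetI)
    fix a assume "a \<in> ?A i"
    then show "\<iota> i a \<in> \<iota> j ` ?A j" using X_cmp[OF that] Dij[OF that] by (intro image_eqI[of _ _ "amap D i j () a"]) auto
  qed
  show ?thesis
    unfolding is_colimit_def
  proof (intro conjI cocone allI impI)
    fix Y \<kappa> assume Y: "is_cocone ?J ?C D Y \<kappa>"
    have Y_hom: "\<And>i. i \<in> P \<Longrightarrow> \<kappa> i \<in> hom ?C (omap D i) Y"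
      and Y_cmp: "\<And>i j a. (i, j) \<in> r \<Longrightarrow> a \<in> ?A i \<Longrightarrow> \<kappa> j (amap D i j () a) = \<kappa> i a"
      using cc[OF Y] by blast+
    have \<kappa>: "\<kappa> i ` ?A i \<subseteq> univ Y" "elementary \<F> (omap D i) Y (\<kappa> i)" "\<kappa> i \<in> extensional (?A i)" if "i \<in> P" for i
      using Y_hom[OF that] model_hom[OF F Di[OF that]] by auto
    have wd: "\<kappa> i a = \<kappa> j b" if ij: "i \<in> P" "j \<in> P" "a \<in> ?A i" "b \<in> ?A j" "\<iota> i a = \<iota> j b" for i j a b
    proof -
      obtain k where k: "k \<in> P" "(i, k) \<in> r" "(j, k) \<in> r"
        using dir ij(1,2) unfolding directed_poset_def by blast
      have "\<iota> k (amap D i k () a) = \<iota> k (amap D j k () b)" using X_cmp[OF k(2)] X_cmp[OF k(3)] ij by simp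
      then have "amap D i k () a = amap D j k () b"
        using inj_onD[OF \<iota>_inj[OF k(1)]] Dij[OF k(2)] Dij[OF k(3)] ij by blast
      then show ?thesis using Y_cmp[OF k(2) ij(3)] Y_cmp[OF k(3) ij(4)] by simp
    qed
    define u where "u = (\<lambda>x\<in>univ X. SOME y. \<exists>i\<in>P. \<exists>a\<in>?A i. x = \<iota> i a \<and> y = \<kappa> i a)"
    have u: "u (\<iota> i a) = \<kappa> i a" if "i \<in> P" "a \<in> ?A i" for i a
    proof -
      have "\<exists>j\<in>P. \<exists>b\<in>?A j. \<iota> i a = \<iota> j b \<and> u (\<iota> i a) = \<kappa> j b"
        using someI_ex[of "\<lambda>y. \<exists>j\<in>P. \<exists>b\<in>?A j. \<iota> i a = \<iota> j b \<and> y = \<kappa> j b"] that \<iota>(1)[OF that(1)]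
        unfolding u_def by auto
      then show ?thesis using wd[OF that(1) _ that(2)] by auto
    qed
    have u_im: "u ` univ X \<subseteq> univ Y"
    proof (rule image_subsetI)
      fix x assume "x \<in> univ X"
      then obtain i a where "i \<in> P" "a \<in> ?A i" "x = \<iota> i a" using cover by blast
      then show "u x \<in> univ Y" using u \<kappa>(1) by (simp add: image_subset_iff)
    qed
    have u_el: "elementary \<F> X Y u"
      unfolding elementary_def
    proof (intro ballI allI impI)
      fix \<phi> v assume \<phi>: "\<phi> \<in> \<F>" and v: "v ` fv \<phi> \<subseteq> univ X"
      obtain i where i: "i \<in> P" "v ` fv \<phi> \<subseteq> \<iota> i ` ?A i"
        using directed_finite_subset[where S = "v ` fv \<phi>" and A = "\<lambda>i. \<iota> i ` ?A i", OF dir mono]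
          fragment_finite_fv[OF F \<phi>] subset_trans[OF v cover] by blast
      define w where "w = inv_into (?A i) (\<iota> i) \<circ> v"
      have w: "w ` fv \<phi> \<subseteq> ?A i" "\<And>x. x \<in> fv \<phi> \<Longrightarrow> (\<iota> i \<circ> w) x = v x"
        using i(2) unfolding w_def by (auto simp: f_inv_into_f inv_into_into image_subset_iff)
      have "(\<kappa> i \<circ> w) x = (u \<circ> v) x" if "x \<in> fv \<phi>" for x
        using w(1) w(2)[OF that] u[OF i(1), of "w x"] that by auto
      then have "sat X \<phi> v \<longleftrightarrow> sat X \<phi> (\<iota> i \<circ> w)" "sat Y \<phi> (\<kappa> i \<circ> w) \<longleftrightarrow> sat Y \<phi> (u \<circ> v)"
        using w(2) by (intro sat_cong; simp)+
      then show "sat X \<phi> v \<longleftrightarrow> sat Y \<phi> (u \<circ> v)"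
        using elementaryD[OF \<iota>(2)[OF i(1)] \<phi> w(1)] elementaryD[OF \<kappa>(2)[OF i(1)] \<phi> w(1)] by simp
    qed
    have u_hom: "u \<in> hom ?C X Y"
      unfolding model_hom[OF F X] using u_im u_el by (simp add: u_def)
    have u_cmp: "compose (?A i) u (\<iota> i) = \<kappa> i" if "i \<in> P" for i
      using u[OF that] \<kappa>(3)[OF that] by (auto simp: compose_def extensional_def)
    show "\<exists>!u. u \<in> hom ?C X Y \<and> (\<forall>i\<in>obj ?J. cmp ?C (omap D i) X Y u (\<iota> i) = \<kappa> i)"
      unfolding model_cat_simps poset_cat_simps
    proof (rule ex1I[of _ u])
      show "u \<in> hom ?C X Y \<and> (\<forall>i\<in>P. compose (?A i) u (\<iota> i) = \<kappa> i)" using u_hom u_cmp by blast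
      fix w assume w: "w \<in> hom ?C X Y \<and> (\<forall>i\<in>P. compose (?A i) w (\<iota> i) = \<kappa> i)"
      show "w = u"
      proof (rule extensionalityI[of _ "univ X"])
        show "w \<in> extensional (univ X)" "u \<in> extensional (univ X)"
          using w u_hom unfolding model_hom[OF F X] by auto
        fix x assume "x \<in> univ X"
        then obtain i a where ia: "i \<in> P" "a \<in> ?A i" "x = \<iota> i a" using cover by blast
        have "compose (?A i) w (\<iota> i) a = \<kappa> i a" using w ia(1) by simp
        then show "w x = u x" using u[OF ia(1,2)] ia by (simp add: compose_eq)
      qed
    qed
  qed
qed

section \<open>Large models\<close>

text \<open>
  A structure is determined by its carrier, the graphs of its operations and its relations, because
  the interpretations are normalised; these are subsets of fixed small sets.
\<close>

lemma small_bounded_structs: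
  fixes A :: "'u set" and L :: "'u lang"
  assumes U: "inaccessible TYPE('u)" and L: "small_lang L" and A: "small TYPE('u) A"
  shows "small TYPE('u) {M. is_struct L M \<and> univ M \<subseteq> A}"
proof -
  let ?N = "fst ` (funs L \<union> rels L)"
  have sum: "small TYPE('u) (funs L <+> rels L)" using L unfolding small_lang_def lang_card_def small_def .
  have "small TYPE('u) (funs L)" by (rule small_inj_on[OF _ _ sum, of Inl]) auto
  moreover have "small TYPE('u) (rels L)" by (rule small_inj_on[OF _ _ sum, of Inr]) auto
  ultimately have N: "small TYPE('u) ?N" by (intro small_image small_Un[OF U])
  let ?f = "\<lambda>M. (univ M, {(c, xs, fn M c xs) | c xs. (c, length xs) \<in> funs L \<and> set xs \<subseteq> univ M},
    {(c, xs). rl M c xs})"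
  have "inj_on ?f {M. is_struct L M \<and> univ M \<subseteq> A}"
  proof (rule inj_onI; clarify)
    fix M M' :: "'u struct"
    assume M: "is_struct L M" and M': "is_struct L M'" and univ: "univ M = univ M'"
      and fn: "{(c, xs, fn M c xs) |c xs. (c, length xs) \<in> funs L \<and> set xs \<subseteq> univ M} =
        {(c, xs, fn M' c xs) |c xs. (c, length xs) \<in> funs L \<and> set xs \<subseteq> univ M'}"
      and rl: "{(c, xs). rl M c xs} = {(c, xs). rl M' c xs}"
    have "fn M c xs = fn M' c xs" for c xs
    proof (cases "(c, length xs) \<in> funs L \<and> set xs \<subseteq> univ M")
      case True
      then have "(c, xs, fn M c xs) \<in> {(c, xs, fn M' c xs) |c xs. (c, length xs) \<in> funs L \<and> set xs \<subseteq> univ M'}"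
        unfolding fn[symmetric] by blast
      then show ?thesis by simp
    next
      case False
      then show ?thesis using struct_fn_undefined[OF M] struct_fn_undefined[OF M'] univ by metis
    qed
    moreover have "rl M c xs = rl M' c xs" for c xs using rl by (auto simp: set_eq_iff)
    ultimately have "fn M = fn M'" "rl M = rl M'" by blast+
    then show "M = M'" using univ by simp
  qed
  moreover have "?f ` {M. is_struct L M \<and> univ M \<subseteq> A} \<subseteq>
    Pow A \<times> Pow (?N \<times> lists A \<times> A) \<times> Pow (?N \<times> lists A)"
  proof (rule image_subsetI)
    fix M assume "M \<in> {M. is_struct L M \<and> univ M \<subseteq> A}"
    then have M: "is_struct L M" and MA: "univ M \<subseteq> A" by auto
    have "(c, xs, fn M c xs) \<in> ?N \<times> lists A \<times> A" if "(c, length xs) \<in> funs L" "set xs \<subseteq> univ M" for c xs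
      using struct_fn_closed[OF M that] that MA by (auto simp: image_iff) force
    moreover have "(c, xs) \<in> ?N \<times> lists A" if "rl M c xs" for c xs
      using struct_rl[OF M that] MA by (auto simp: image_iff) force
    ultimately show "?f M \<in> Pow A \<times> Pow (?N \<times> lists A \<times> A) \<times> Pow (?N \<times> lists A)"
      using MA by blast
  qed
  moreover have "small TYPE('u) (Pow A \<times> Pow (?N \<times> lists A \<times> A) \<times> Pow (?N \<times> lists A))"
    by (intro small_Times small_Pow small_lists U A N)
  ultimately show ?thesis by (rule small_inj_on)
qed

lemma small_functions:
  fixes A B :: "'u set"
  assumes U: "inaccessible TYPE('u)" and A: "small TYPE('u) A" and B: "small TYPE('u) B"
  shows "small TYPE('u) {f \<in> extensional A. f ` A \<subseteq> B}"
proof (rule small_inj_on)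
  let ?g = "\<lambda>f. (\<lambda>x. (x, f x)) ` A"
  show "inj_on ?g {f \<in> extensional A. f ` A \<subseteq> B}"
  proof (rule inj_onI; clarify)
    fix f f' assume f: "f \<in> extensional A" "f' \<in> extensional A" and eq: "?g f = ?g f'"
    show "f = f'"
    proof (rule extensionalityI[OF f])
      fix x assume "x \<in> A"
      then have "(x, f x) \<in> ?g f'" unfolding eq[symmetric] by blast
      then show "f x = f' x" by auto
    qed
  qed
  show "?g ` {f \<in> extensional A. f ` A \<subseteq> B} \<subseteq> Pow (A \<times> B)" by auto
  show "small TYPE('u) (Pow (A \<times> B))" by (intro small_Pow small_Times U A B)
qed

lemma models_iso:
  assumes T: "is_theory L T" and M: "M \<in> models L T" and N: "is_struct L N" and f: "struct_iso L M N f"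
  shows "N \<in> models L T"
proof -
  have "sat N \<phi> v" if "\<phi> \<in> T" for \<phi> v
  proof -
    have \<phi>: "wf_fm L \<phi>" "fv \<phi> = {}" using T that unfolding is_theory_def by auto
    have "sat M \<phi> v" using M that by (simp add: models_def)
    then have "sat N \<phi> (f \<circ> v)" using sat_iso[OF models_struct[OF M] f \<phi>(1), of v] \<phi>(2) by simp
    then show ?thesis using sat_cong[of \<phi> "f \<circ> v" v] \<phi>(2) by simp
  qed
  then show ?thesis using N unfolding models_def by blast
qed

lemma struct_iso_elementary:
  assumes F: "fragment L \<F>" and M: "is_struct L M" and f: "struct_iso L M N f"
  shows "elementary \<F> M N f"
  unfolding elementary_def using sat_iso[OF M f fragment_wf[OF F]] by blast

lemma struct_iso_model_cat:
  assumes F: "fragment L \<F>" and M: "M \<in> models L T" and N: "N \<in> models L T" and f: "struct_iso L M N f"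
  shows "is_iso (model_cat L T \<F>) M N (restrict f (univ M))"
proof -
  let ?g = "inv_into (univ M) f"
  have g: "struct_iso L N M ?g" by (rule struct_iso_inv[OF models_struct[OF M] f])
  have im: "f ` univ M = univ N" "?g ` univ N = univ M" and inj: "inj_on f (univ M)"
    using f g unfolding struct_iso_def embedding_def by auto
  have 1: "restrict f (univ M) \<in> hom (model_cat L T \<F>) M N"
    using struct_iso_elementary[OF F models_struct[OF M] f] im
    by (simp add: model_hom[OF F M] elementary_restrict)
  have 2: "restrict ?g (univ N) \<in> hom (model_cat L T \<F>) N M"
    using struct_iso_elementary[OF F models_struct[OF N] g] im
    by (simp add: model_hom[OF F N] elementary_restrict)
  have "compose (univ M) (restrict ?g (univ N)) (restrict f (univ M)) = restrict id (univ M)"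
    using im inj by (auto simp: compose_def restrict_def fun_eq_iff)
  moreover have "compose (univ N) (restrict f (univ M)) (restrict ?g (univ N)) = restrict id (univ N)"
  proof
    fix y
    show "compose (univ N) (restrict f (univ M)) (restrict ?g (univ N)) y = restrict id (univ N) y"
      using im f_inv_into_f[of y f "univ M"] inv_into_into[of y f "univ M"] by (auto simp: compose_def)
  qed
  ultimately show ?thesis using 1 2 unfolding is_iso_def model_cat_simps by blast
qed

text \<open>
  If the models were bounded in size by \<open>A\<close>, then every model would be isomorphic to one of the few
  with carrier inside \<open>A\<close>, and the category would be essentially small.
\<close>

lemma large_has_large_models:
  fixes C :: "('o, 'a) category" and A :: "'u set" and L :: "'u lang"
  assumes U: "inaccessible TYPE('u)" and C: "is_category C" and large: "large TYPE('u) C"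
    and L: "small_lang L" and T: "is_theory L T" and F: "fragment L \<F>"
    and equiv: "equivalent_cats C (model_cat L T \<F>)" and A: "small TYPE('u) A"
  shows "\<exists>M\<in>models L T. |A| \<le>o |univ M|"
proof (rule ccontr)
  assume "\<not> (\<exists>M\<in>models L T. |A| \<le>o |univ M| )"
  then have bounded: "\<exists>g. inj_on g (univ M) \<and> g ` univ M \<subseteq> A" if "M \<in> models L T" for M
    using that card_of_ordLeq ordLeq_total[OF card_of_Well_order card_of_Well_order] by metis
  let ?B = "{M \<in> models L T. univ M \<subseteq> A}"
  let ?D = "model_cat L T \<F>"
  have D: "is_category ?D" by (rule model_cat_category[OF F])
  obtain G where w: "weak_equivalence ?D C G"
    using equivalent_cats_weak[OF D C equivalent_cats_sym[OF equiv]] by blast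
  then have G: "is_functor ?D C G" unfolding weak_equivalence_def by blast
  have B: "small TYPE('u) ?B"
    by (rule small_subset[OF small_bounded_structs[OF U L A]]) (auto simp: models_struct)
  obtain e where e: "inj_on (e :: 'u struct \<Rightarrow> 'u) ?B" using small_code[OF B] by blast
  define d where "d = inv_into ?B e"
  have d: "d (e M) = M" if "M \<in> ?B" for M unfolding d_def using e that by (rule inv_into_f_f)
  have "\<not> large TYPE('u) C"
  proof (rule essentially_small[of C "e ` ?B" "\<lambda>x. omap G (d x)"])
    show "is_category C" by (rule C)
    show "small TYPE('u) (e ` ?B)" by (rule small_image[OF B])
    show "(\<lambda>x. omap G (d x)) ` e ` ?B \<subseteq> obj C"
      using ftor_obj[OF G] d by (auto simp: model_cat_simps)
  next
    fix x y assume "x \<in> e ` ?B" "y \<in> e ` ?B"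
    then obtain M N where MN: "M \<in> ?B" "N \<in> ?B" "x = e M" "y = e N" by blast
    then have M: "M \<in> models L T" and N: "N \<in> models L T" by auto
    have "hom ?D M N \<subseteq> {f \<in> extensional (univ M). f ` univ M \<subseteq> univ N}"
      using model_hom[OF F M] by auto
    then have "small TYPE('u) (hom ?D M N)"
      using small_subset[OF small_functions[OF U struct_small[OF models_struct[OF M]] struct_small[OF models_struct[OF N]]]]
      by blast
    moreover have "hom C (omap G M) (omap G N) = amap G M N ` hom ?D M N"
      using w M N unfolding weak_equivalence_def bij_betw_def by (auto simp: model_cat_simps)
    ultimately show "small TYPE('u) (hom C (omap G (d x)) (omap G (d y)))"
      using MN d by (simp add: small_image)
  next
    fix Z assume Z: "Z \<in> obj C"
    obtain M f where M: "M \<in> models L T" and f: "is_iso C (omap G M) Z f"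
      using w Z unfolding weak_equivalence_def by (auto simp: model_cat_simps)
    obtain g where g: "inj_on g (univ M)" "g ` univ M \<subseteq> A" using bounded[OF M] by blast
    let ?N = "transport L M g"
    note st = transport_struct[OF models_struct[OF M] g(1)]
    have N: "?N \<in> models L T" by (rule models_iso[OF T M st])
    have NB: "?N \<in> ?B" using N g(2) by (simp add: transport_def)
    note GM = ftor_obj[OF G, unfolded model_cat_simps, OF M]
    note GN = ftor_obj[OF G, unfolded model_cat_simps, OF N]
    have "is_iso ?D ?N M (restrict (inv_into (univ M) g) (univ ?N))"
      by (rule struct_iso_model_cat[OF F N M struct_iso_inv[OF models_struct[OF M] st(2)]])
    then have "is_iso C (omap G ?N) (omap G M) (amap G ?N M (restrict (inv_into (univ M) g) (univ ?N)))"
      using functor_iso[OF G] N M by (simp add: model_cat_simps)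
    from iso_comp[OF C GN GM Z this f] show "\<exists>x\<in>e ` ?B. \<exists>f. is_iso C (omap G (d x)) Z f"
      using NB d[OF NB] by (metis (no_types, lifting) image_eqI)
  qed
  then show False using large by blast
qed

section \<open>Types in an abstract class\<close>

lemma induced_simps:
  "univ (induced N A) = A"
  "fn (induced N A) c xs = (if set xs \<subseteq> A then fn N c xs else undefined)"
  "rl (induced N A) c xs \<longleftrightarrow> set xs \<subseteq> A \<and> rl N c xs"
  by (simp_all add: induced_def)

lemma induced_univ:
  assumes "is_struct L N"
  shows "induced N (univ N) = N"
proof -
  have "fn (induced N (univ N)) c xs = fn N c xs" for c xs
    using struct_fn_undefined[OF assms, of c xs] by (auto simp: induced_simps)
  moreover have "rl (induced N (univ N)) c xs = rl N c xs" for c xs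
    using struct_rl[OF assms, of c xs] by (auto simp: induced_simps)
  ultimately have "fn (induced N (univ N)) = fn N" "rl (induced N (univ N)) = rl N" by blast+
  then show ?thesis by (simp add: induced_simps)
qed

lemma substruct_fn: "substruct M N \<Longrightarrow> set xs \<subseteq> univ M \<Longrightarrow> fn M c xs = fn N c xs"
  unfolding substruct_def by (metis induced_simps(2))

lemma substruct_rl: "substruct M N \<Longrightarrow> set xs \<subseteq> univ M \<Longrightarrow> rl M c xs \<longleftrightarrow> rl N c xs"
  unfolding substruct_def by (metis induced_simps(3))

lemma substruct_subset: "substruct M N \<Longrightarrow> univ M \<subseteq> univ N"
  by (simp add: substruct_def)

lemma substruct_induced: "substruct M N \<Longrightarrow> induced N (univ M) = M"
  unfolding substruct_def by (elim conjE) (rule sym)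

lemma substruct_embedding: "substruct M N \<Longrightarrow> embedding L M N id"
  unfolding embedding_def homomorphism_def
  using substruct_fn[of M N] substruct_rl[of M N] substruct_subset[of M N] by auto

lemma class_facts:
  assumes "is_abstract_class K"
  shows "\<forall>M\<in>mem K. is_struct (clang K) M" "partial_order_on (mem K) (le K)" "\<forall>(M, N)\<in>le K. substruct M N"
proof -
  note * = conjunct2[OF assms[unfolded is_abstract_class_def]]
  show "\<forall>M\<in>mem K. is_struct (clang K) M" by (rule conjunct1[OF *])
  show "partial_order_on (mem K) (le K)" by (rule conjunct1[OF conjunct2[OF *]])
  show "\<forall>(M, N)\<in>le K. substruct M N" by (rule conjunct1[OF conjunct2[OF conjunct2[OF *]]])
qed

lemma class_order:
  assumes "is_abstract_class K"
  shows "refl_on (mem K) (le K)" "le K \<subseteq> mem K \<times> mem K"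
  using class_facts(2)[OF assms] by (simp_all add: partial_order_on_def preorder_on_def)

lemma class_struct: "is_abstract_class K \<Longrightarrow> M \<in> mem K \<Longrightarrow> is_struct (clang K) M"
  using class_facts(1) by (rule bspec)

lemma class_le_refl: "is_abstract_class K \<Longrightarrow> M \<in> mem K \<Longrightarrow> (M, M) \<in> le K"
  using class_order(1) by (rule refl_onD)

lemma class_le_mem: "is_abstract_class K \<Longrightarrow> (M, N) \<in> le K \<Longrightarrow> M \<in> mem K \<and> N \<in> mem K"
  using class_order(2) by fast

lemma class_le_substruct: "is_abstract_class K \<Longrightarrow> (M, N) \<in> le K \<Longrightarrow> substruct M N"
  using class_facts(3) by fast

lemma K_embedding_into: "K_embedding K M N f \<Longrightarrow> f ` univ M \<subseteq> univ N"
  by (simp add: K_embedding_def embedding_def homomorphism_def)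

lemma K_embedding_inclusion:
  assumes K: "is_abstract_class K" and le: "(M, N) \<in> le K"
  shows "K_embedding K M N id"
proof -
  have sub: "substruct M N" by (rule class_le_substruct[OF K le])
  then have "induced N (id ` univ M) = M" using substruct_induced by simp
  then show ?thesis using substruct_embedding[OF sub] le unfolding K_embedding_def by simp
qed

text \<open>
  A \<open>K\<close>-embedding is an isomorphism onto its image, which is a member of \<open>K\<close> below the codomain; its inverse
  is therefore a \<open>K\<close>-embedding too.
\<close>

lemma K_embedding_image:
  assumes K: "is_abstract_class K" and N: "N \<in> mem K" and f: "K_embedding K N J f"
  shows "struct_iso (clang K) N (induced J (f ` univ N)) f"
    and "K_embedding K (induced J (f ` univ N)) N (inv_into (univ N) f)"
proof -
  let ?N = "induced J (f ` univ N)"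
  note S = class_struct[OF K N]
  have emb: "embedding (clang K) N J f" using f by (simp add: K_embedding_def)
  show iso: "struct_iso (clang K) N ?N f"
    using emb unfolding struct_iso_def embedding_def homomorphism_def induced_simps
    by (auto simp: image_subset_iff subset_iff)
  then have inv: "struct_iso (clang K) ?N N (inv_into (univ N) f)" by (rule struct_iso_inv[OF S])
  then have "induced N (inv_into (univ N) f ` univ ?N) = N"
    using induced_univ[OF S] by (simp add: struct_iso_def)
  then show "K_embedding K ?N N (inv_into (univ N) f)"
    using inv class_le_refl[OF K N] by (simp add: K_embedding_def struct_iso_def)
qed

lemma tuplesI: "M \<in> mem K \<Longrightarrow> set a \<subseteq> univ M \<Longrightarrow> (a, M) \<in> tuples K"
  by (simp add: tuples_def)

lemma type_stepI:
  "(map f b, M) \<in> tuples K \<Longrightarrow> (b, N) \<in> tuples K \<Longrightarrow> J \<in> mem K \<Longrightarrow> (M, J) \<in> le K \<Longrightarrow>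
    K_embedding K N J f \<Longrightarrow> ((map f b, M), (b, N)) \<in> type_step K"
  unfolding type_step_def by blast

lemma type_step_embedding:
  assumes K: "is_abstract_class K" and N: "N \<in> mem K" and J: "J \<in> mem K"
    and f: "K_embedding K N J f" and b: "set b \<subseteq> univ N"
  shows "((map f b, J), (b, N)) \<in> type_step K"
proof (rule type_stepI[OF _ tuplesI[OF N b] J class_le_refl[OF K J] f])
  have "f ` univ N \<subseteq> univ J" by (rule K_embedding_into[OF f])
  then show "(map f b, J) \<in> tuples K" using b by (intro tuplesI J) (simp, blast)
qed

text \<open>
  A link can be walked backwards: for \<open>I \<le> J \<leftarrow> I'\<close> pass from \<open>I'\<close> to its image in \<open>J\<close>, from there to
  \<open>J\<close>, and from \<open>J\<close> to its substructure \<open>I\<close>.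
\<close>

lemma type_step_sym:
  assumes K: "is_abstract_class K" and step: "((a, M), (b, N)) \<in> type_step K"
  shows "((b, N), (a, M)) \<in> (type_step K)\<^sup>+"
proof -
  obtain J f where aM: "(a, M) \<in> tuples K" and bN: "(b, N) \<in> tuples K" and J: "J \<in> mem K"
    and le: "(M, J) \<in> le K" and f: "K_embedding K N J f" and a: "a = map f b"
    using step unfolding type_step_def by blast
  have N: "N \<in> mem K" "set b \<subseteq> univ N" and M: "M \<in> mem K" "set a \<subseteq> univ M"
    using aM bN by (auto simp: tuples_def)
  let ?N = "induced J (f ` univ N)"
  have N'J: "(?N, J) \<in> le K" using f by (simp add: K_embedding_def)
  have N': "?N \<in> mem K" using class_le_mem[OF K N'J] by blast
  have fb: "set (map f b) \<subseteq> univ ?N" using N(2) by (auto simp: induced_simps)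
  have inj: "inj_on f (univ N)" using f by (simp add: K_embedding_def embedding_def)
  have "((b, N), (map f b, ?N)) \<in> type_step K"
    using type_step_embedding[OF K N' N(1) K_embedding_image(2)[OF K N(1) f] fb] map_inv_into_map[OF inj N(2)]
    by simp
  moreover have "((map f b, ?N), (map f b, J)) \<in> type_step K"
  proof -
    have "set (map f b) \<subseteq> univ J"
      using fb class_le_substruct[OF K N'J] unfolding substruct_def by blast
    then have "((map id (map f b), ?N), (map f b, J)) \<in> type_step K"
      using tuplesI[OF N' fb] tuplesI[OF J] N'J J K_embedding_inclusion[OF K class_le_refl[OF K J]]
      by (intro type_stepI) auto
    then show ?thesis by simp
  qed
  moreover have "((map f b, J), (a, M)) \<in> type_step K"
    using type_step_embedding[OF K M(1) J K_embedding_inclusion[OF K le] M(2)] a by simp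
  ultimately show ?thesis by (meson trancl.r_into_trancl trancl.trancl_into_trancl)
qed

lemma type_steps_sym:
  assumes K: "is_abstract_class K" and steps: "(x, y) \<in> (type_step K)\<^sup>+"
  shows "(y, x) \<in> (type_step K)\<^sup>+"
  using steps
proof (induction rule: trancl_induct)
  case (base y)
  then show ?case using type_step_sym[OF K] by (cases x, cases y) simp
next
  case (step y z)
  have "(z, y) \<in> (type_step K)\<^sup>+" using type_step_sym[OF K] step.hyps(2) by (cases y, cases z) simp
  then show ?case using step.IH by (rule trancl_trans)
qed

lemma type_step_refl:
  assumes K: "is_abstract_class K" and a: "(a, M) \<in> tuples K"
  shows "((a, M), (a, M)) \<in> type_step K"
proof -
  have M: "M \<in> mem K" "set a \<subseteq> univ M" using a by (simp_all add: tuples_def)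
  have "((map id a, M), (a, M)) \<in> type_step K"
    by (rule type_step_embedding[OF K M(1) M(1) K_embedding_inclusion[OF K class_le_refl[OF K M(1)]] M(2)])
  then show ?thesis by simp
qed

lemma tp_iff: "x \<in> tp K a M \<longleftrightarrow> ((a, M), x) \<in> (type_step K)\<^sup>+"
  by (simp add: tp_def)

lemma tp_self: "is_abstract_class K \<Longrightarrow> (a, M) \<in> tuples K \<Longrightarrow> (a, M) \<in> tp K a M"
  by (simp add: tp_def type_step_refl trancl.r_into_trancl)

lemma tp_eqI:
  assumes K: "is_abstract_class K" and "((a, M), (b, N)) \<in> (type_step K)\<^sup>+"
  shows "tp K a M = tp K b N"
proof -
  have sym: "((b, N), (a, M)) \<in> (type_step K)\<^sup>+" by (rule type_steps_sym[OF assms])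
  show ?thesis
  proof (rule set_eqI)
    fix x
    show "x \<in> tp K a M \<longleftrightarrow> x \<in> tp K b N"
      unfolding tp_iff by (rule iffI) (rule trancl_trans[OF sym], assumption, rule trancl_trans[OF assms(2)])
  qed
qed

lemma tp_embedding:
  assumes "is_abstract_class K" "N \<in> mem K" "J \<in> mem K" "K_embedding K N J f" "set b \<subseteq> univ N"
  shows "tp K (map f b) J = tp K b N"
  by (rule tp_eqI[OF assms(1) trancl.r_into_trancl[OF type_step_embedding[OF assms]]])

lemma type_step_nths:
  assumes "((a, M), (b, N)) \<in> type_step K"
  shows "length a = length b \<and> ((nths a s, M), (nths b s, N)) \<in> type_step K"
proof -
  obtain J f where *: "(a, M) \<in> tuples K" "(b, N) \<in> tuples K" "J \<in> mem K"
    "(M, J) \<in> le K" "K_embedding K N J f" and a: "a = map f b"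
    using assms unfolding type_step_def by blast
  have "(nths a s, M) \<in> tuples K" "(nths b s, N) \<in> tuples K"
    using * set_nths_subset[of a s] set_nths_subset[of b s] unfolding tuples_def by auto
  then show ?thesis using * type_stepI[of f "nths b s" M K N J] by (simp add: a nths_map)
qed

lemma type_steps_nths:
  assumes "(x, y) \<in> (type_step K)\<^sup>+"
  shows "length (fst x) = length (fst y) \<and>
    ((nths (fst x) s, snd x), (nths (fst y) s, snd y)) \<in> (type_step K)\<^sup>+"
  using assms
proof (induction rule: trancl_induct)
  case (base y)
  then show ?case using type_step_nths[of "fst x" "snd x" "fst y" "snd y"] by auto
next
  case (step y z)
  then show ?case using type_step_nths[of "fst y" "snd y" "fst z" "snd z"]
    by (auto intro: trancl.trancl_into_trancl)
qed

lemma tp_mem_length: "(b, N) \<in> tp K a M \<Longrightarrow> length b = length a"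
  using type_steps_nths[of "(a, M)" "(b, N)"] by (simp add: tp_def)

text \<open>
  A chain of links between two tuples restricts to one between their subtuples, so that all members of
  the union in the definition of \<open>p\<^sup>s\<close> coincide.
\<close>

lemma tp_restr_tp:
  assumes K: "is_abstract_class K" and a: "(a, M) \<in> tuples K"
  shows "tp_restr K (tp K a M) s = tp K (nths a s) M"
proof -
  have "tp K (nths b s) N = tp K (nths a s) M" if "(b, N) \<in> tp K a M" for b N
    using type_steps_nths[of "(a, M)" "(b, N)" K s] that
    by (intro tp_eqI[OF K, symmetric]) (simp add: tp_iff)
  then have "(\<Union>(b, N)\<in>tp K a M. tp K (nths b s) N) = (\<Union>x\<in>tp K a M. tp K (nths a s) M)"
    by (intro SUP_cong) auto
  then show ?thesis using tp_self[OF K a] unfolding tp_restr_def by auto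
qed

lemma class_cat_simps:
  "obj (class_cat K) = mem K"
  "f \<in> hom (class_cat K) J J' \<longleftrightarrow> f \<in> extensional (univ J) \<and> K_embedding K J J' f"
  "ide (class_cat K) J = restrict id (univ J)"
  "cmp (class_cat K) J J' J'' g f = compose (univ J) g f"
  by (simp_all add: class_cat_def)

lemma class_cocone:
  assumes dir: "directed_poset P r" and D: "is_functor (poset_cat P r) (class_cat K) D"
    and cocone: "is_cocone (poset_cat P r) (class_cat K) D X \<iota>"
  shows "X \<in> mem K"
    and "i \<in> P \<Longrightarrow> omap D i \<in> mem K"
    and "i \<in> P \<Longrightarrow> \<iota> i \<in> extensional (univ (omap D i))"
    and "i \<in> P \<Longrightarrow> K_embedding K (omap D i) X (\<iota> i)"
    and "(i, j) \<in> r \<Longrightarrow> compose (univ (omap D i)) (\<iota> j) (amap D i j ()) = \<iota> i"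
    and "(i, j) \<in> r \<Longrightarrow> \<iota> i ` univ (omap D i) \<subseteq> \<iota> j ` univ (omap D j)"
proof -
  show "X \<in> mem K" "i \<in> P \<Longrightarrow> \<iota> i \<in> extensional (univ (omap D i))"
    "i \<in> P \<Longrightarrow> K_embedding K (omap D i) X (\<iota> i)"
    using cocone unfolding is_cocone_def poset_cat_simps class_cat_simps by auto
  show "i \<in> P \<Longrightarrow> omap D i \<in> mem K"
    using ftor_obj[OF D] by (simp add: poset_cat_simps class_cat_simps)
  show cmp: "compose (univ (omap D i)) (\<iota> j) (amap D i j ()) = \<iota> i" if ij: "(i, j) \<in> r"
  proof -
    have "() \<in> hom (poset_cat P r) i j" using ij by (simp add: poset_cat_simps)
    then show ?thesis using cocone directed_poset_field[OF dir ij]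
      unfolding is_cocone_def poset_cat_simps(1) class_cat_simps by blast
  qed
  show "\<iota> i ` univ (omap D i) \<subseteq> \<iota> j ` univ (omap D j)" if ij: "(i, j) \<in> r"
  proof (rule image_subsetI)
    fix a assume a: "a \<in> univ (omap D i)"
    have "amap D i j () \<in> hom (class_cat K) (omap D i) (omap D j)"
      using ftor_hom[OF D, of i j "()"] directed_poset_field[OF dir ij] ij by (simp add: poset_cat_simps)
    then have "K_embedding K (omap D i) (omap D j) (amap D i j ())" by (simp add: class_cat_simps)
    from K_embedding_into[OF this] have "amap D i j () a \<in> univ (omap D j)" using a by blast
    moreover have "\<iota> i a = \<iota> j (amap D i j () a)"
      using fun_cong[OF cmp[OF ij], of a] a by (simp add: compose_eq)
    ultimately show "\<iota> i a \<in> \<iota> j ` univ (omap D j)" by simp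
  qed
qed

section \<open>Quantifier-free types\<close>

primrec sval :: "'u struct \<Rightarrow> ('v \<Rightarrow> 'u) \<Rightarrow> ('u, 'v) sterm \<Rightarrow> 'u" where
  "sval M v (Gen x) = v x"
| "sval M v (Op c ts) = fn M c (map (sval M v) ts)"

primrec wf_sterm :: "'u lang \<Rightarrow> ('u, 'v) sterm \<Rightarrow> bool" where
  "wf_sterm L (Gen x) \<longleftrightarrow> True"
| "wf_sterm L (Op c ts) \<longleftrightarrow> (c, length ts) \<in> funs L \<and> list_all id (map (wf_sterm L) ts)"

lemma sval_cong: "(\<And>x. x \<in> gens t \<Longrightarrow> v x = w x) \<Longrightarrow> sval M v t = sval M w t"
proof (induction t)
  case (Op c ts)
  have "map (sval M v) ts = map (sval M w) ts"
    by (rule map_cong[OF refl], rule Op.IH) (use Op.prems in auto)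
  then show ?case by (simp del: map_eq_conv)
qed simp

lemma sval_map: "sval M v (map_sterm id f t) = sval M (v \<circ> f) t"
proof (induction t)
  case (Op c ts)
  have "(sval M v \<circ> map_sterm id f) t = sval M (v \<circ> f) t" if "t \<in> set ts" for t
    using Op.IH[OF that] by (subst o_apply)
  then have "map (sval M v \<circ> map_sterm id f) ts = map (sval M (v \<circ> f)) ts"
    by (rule map_cong[OF refl])
  then show ?case by (simp only: sterm.map sval.simps map_map) (simp only: id_apply)
qed simp

lemma wf_sterm_map: "wf_sterm L (map_sterm id f t) \<longleftrightarrow> wf_sterm L t"
  by (induction t) (auto simp: list_all_iff)

lemma wf_sterm_syms: "wf_sterm L t \<Longrightarrow> syms t \<subseteq> fst ` funs L"
proof (induction t)
  case (Op c ts)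
  have "syms t \<subseteq> fst ` funs L" if "t \<in> set ts" for t
    using Op.IH[OF that] Op.prems that by (simp add: list_all_iff)
  moreover have "c \<in> fst ` funs L" using Op.prems by (auto intro: image_eqI[of _ fst "(c, length ts)"])
  ultimately show ?case by (simp add: UN_subset_iff)
qed simp

lemma finite_gens: "finite (gens t)"
  by (induction t) auto

lemma sval_in:
  assumes M: "is_struct L M"
  shows "wf_sterm L t \<Longrightarrow> v ` gens t \<subseteq> univ M \<Longrightarrow> sval M v t \<in> univ M"
proof (induction t)
  case (Op c ts)
  have ts: "sval M v t \<in> univ M" if "t \<in> set ts" for t
    by (rule Op.IH[OF that]) (use Op.prems that in \<open>auto simp: list_all_iff\<close>)
  then show ?case using struct_fn_closed[OF M, of c "map (sval M v) ts"] Op.prems by auto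
qed simp

lemma sval_hom:
  assumes M: "is_struct L M" and f: "homomorphism L M N f"
  shows "wf_sterm L t \<Longrightarrow> v ` gens t \<subseteq> univ M \<Longrightarrow> f (sval M v t) = sval N (f \<circ> v) t"
proof (induction t)
  case (Op c ts)
  have ts: "f (sval M v t) = sval N (f \<circ> v) t" "sval M v t \<in> univ M" if "t \<in> set ts" for t
    using Op.prems that by (auto simp: list_all_iff intro!: Op.IH[OF that] sval_in[OF M])
  let ?xs = "map (sval M v) ts"
  have c: "(c, length ?xs) \<in> funs L" and xs: "set ?xs \<subseteq> univ M" using Op.prems ts by auto
  have eq: "map f ?xs = map (sval N (f \<circ> v)) ts" using ts by simp
  show ?case using hom_fn[OF f c xs] unfolding eq sval.simps .
qed simp

text \<open>
  Equality of quantifier-free types, for families indexed by an arbitrary set \<open>S\<close> rather than tuples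
  indexed by positions: the generators of a term will be elements of a member of \<open>K\<close>.
\<close>

definition same_qf_type ::
  "'u lang \<Rightarrow> 'u struct \<Rightarrow> ('v \<Rightarrow> 'u) \<Rightarrow> 'u struct \<Rightarrow> ('v \<Rightarrow> 'u) \<Rightarrow> 'v set \<Rightarrow> bool" where
  "same_qf_type L M v N w S \<longleftrightarrow>
     (\<forall>t t'. wf_sterm L t \<and> wf_sterm L t' \<and> gens t \<subseteq> S \<and> gens t' \<subseteq> S \<longrightarrow>
        (sval M v t = sval M v t' \<longleftrightarrow> sval N w t = sval N w t')) \<and>
     (\<forall>c ts. (c, length ts) \<in> rels L \<and> (\<forall>t\<in>set ts. wf_sterm L t \<and> gens t \<subseteq> S) \<longrightarrow>
        (rl M c (map (sval M v) ts) \<longleftrightarrow> rl N c (map (sval N w) ts)))"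

lemma same_qf_type_sym: "same_qf_type L M v N w S \<Longrightarrow> same_qf_type L N w M v S"
  unfolding same_qf_type_def by metis

lemma same_qf_type_trans:
  "same_qf_type L M v N w S \<Longrightarrow> same_qf_type L N w P u S \<Longrightarrow> same_qf_type L M v P u S"
  unfolding same_qf_type_def by metis

lemma same_qf_type_cong:
  assumes "same_qf_type L M v N w S" "\<And>x. x \<in> S \<Longrightarrow> v x = v' x" "\<And>x. x \<in> S \<Longrightarrow> w x = w' x"
  shows "same_qf_type L M v' N w' S"
proof -
  have eq: "sval M v' t = sval M v t" "sval N w' t = sval N w t" if "gens t \<subseteq> S" for t
    using that assms(2,3) by (auto intro!: sval_cong)
  have eqs: "map (sval M v') ts = map (sval M v) ts" "map (sval N w') ts = map (sval N w) ts"
    if "\<forall>t\<in>set ts. wf_sterm L t \<and> gens t \<subseteq> S" for ts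
    using eq that by auto
  show ?thesis unfolding same_qf_type_def
  proof (intro conjI allI impI; elim conjE)
    fix t t' assume "wf_sterm L t" "wf_sterm L t'" "gens t \<subseteq> S" "gens t' \<subseteq> S"
    then show "(sval M v' t = sval M v' t') = (sval N w' t = sval N w' t')"
      using assms(1) eq unfolding same_qf_type_def by simp
  next
    fix c ts assume *: "(c, length ts) \<in> rels L" "\<forall>t\<in>set ts. wf_sterm L t \<and> gens t \<subseteq> S"
    show "rl M c (map (sval M v') ts) = rl N c (map (sval N w') ts)"
      using assms(1) * unfolding same_qf_type_def eqs[OF *(2)] by blast
  qed
qed

lemma same_qf_type_embedding:
  assumes M: "is_struct L M" and f: "embedding L M N f" and v: "v ` S \<subseteq> univ M"
  shows "same_qf_type L M v N (f \<circ> v) S"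
proof -
  have hom: "homomorphism L M N f" and inj: "inj_on f (univ M)"
    using f by (auto simp: embedding_def)
  have t: "sval M v t \<in> univ M" "f (sval M v t) = sval N (f \<circ> v) t" if "wf_sterm L t" "gens t \<subseteq> S" for t
    using sval_in[OF M that(1)] sval_hom[OF M hom that(1)] that(2) v by (metis image_mono subset_trans)+
  show ?thesis unfolding same_qf_type_def
  proof (intro conjI allI impI; elim conjE)
    fix t t' assume *: "wf_sterm L t" "wf_sterm L t'" "gens t \<subseteq> S" "gens t' \<subseteq> S"
    show "(sval M v t = sval M v t') = (sval N (f \<circ> v) t = sval N (f \<circ> v) t')"
      using t[OF *(1,3)] t[OF *(2,4)] inj by (metis inj_onD)
  next
    fix c ts assume c: "(c, length ts) \<in> rels L" and ts: "\<forall>t\<in>set ts. wf_sterm L t \<and> gens t \<subseteq> S"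
    let ?xs = "map (sval M v) ts"
    have xs: "set ?xs \<subseteq> univ M" and eq: "map f ?xs = map (sval N (f \<circ> v)) ts" using ts t by auto
    have "rl M c ?xs \<longleftrightarrow> rl N c (map f ?xs)"
      using f c xs unfolding embedding_def homomorphism_def by (metis length_map)
    then show "rl M c ?xs = rl N c (map (sval N (f \<circ> v)) ts)" unfolding eq .
  qed
qed

text \<open>
  Rename the generators of a term to their positions in \<open>xs\<close>.
\<close>

lemma same_qf_type_reindex:
  assumes "same_qf_type L M ((!) (map v xs)) N ((!) (map w xs)) {..<length xs}"
  shows "same_qf_type L M v N w (set xs)"
proof -
  have "\<forall>x. \<exists>i. x \<in> set xs \<longrightarrow> i < length xs \<and> xs ! i = x" by (auto simp: in_set_conv_nth)
  then obtain pos where pos: "\<And>x. x \<in> set xs \<Longrightarrow> pos x < length xs \<and> xs ! pos x = x" by metis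
  let ?r = "map_sterm id pos"
  have r: "gens (?r t) \<subseteq> {..<length xs}" "sval M ((!) (map v xs)) (?r t) = sval M v t"
    "sval N ((!) (map w xs)) (?r t) = sval N w t" if "gens t \<subseteq> set xs" for t
  proof -
    show "gens (?r t) \<subseteq> {..<length xs}" using pos that by (auto simp: sterm.set_map)
    show "sval M ((!) (map v xs)) (?r t) = sval M v t"
      unfolding sval_map by (rule sval_cong) (use pos that in auto)
    show "sval N ((!) (map w xs)) (?r t) = sval N w t"
      unfolding sval_map by (rule sval_cong) (use pos that in auto)
  qed
  show ?thesis unfolding same_qf_type_def
  proof (intro conjI allI impI; elim conjE)
    fix t t' assume *: "wf_sterm L t" "wf_sterm L t'" "gens t \<subseteq> set xs" "gens t' \<subseteq> set xs"
    then have "wf_sterm L (?r t)" "wf_sterm L (?r t')" by (simp_all add: wf_sterm_map)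
    then show "(sval M v t = sval M v t') = (sval N w t = sval N w t')"
      using assms r[OF *(3)] r[OF *(4)] unfolding same_qf_type_def by metis
  next
    fix c ts assume c: "(c, length ts) \<in> rels L" and ts: "\<forall>t\<in>set ts. wf_sterm L t \<and> gens t \<subseteq> set xs"
    have "\<forall>t\<in>set (map ?r ts). wf_sterm L t \<and> gens t \<subseteq> {..<length xs}"
      using ts r(1) by (auto simp: wf_sterm_map)
    then have "rl M c (map (sval M ((!) (map v xs))) (map ?r ts)) \<longleftrightarrow> rl N c (map (sval N ((!) (map w xs))) (map ?r ts))"
      using assms c unfolding same_qf_type_def by (metis length_map)
    moreover have "map (sval M ((!) (map v xs))) (map ?r ts) = map (sval M v) ts"
      "map (sval N ((!) (map w xs))) (map ?r ts) = map (sval N w) ts"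
      using ts r by auto
    ultimately show "rl M c (map (sval M v) ts) = rl N c (map (sval N w) ts)" by (simp only:)
  qed
qed

lemma type_step_same_qf_type:
  assumes "((a, M), (b, N)) \<in> type_step (all_structs L)"
  shows "same_qf_type L M ((!) a) N ((!) b) {..<length a}"
proof -
  obtain J f where M: "is_struct L M" "set a \<subseteq> univ M" and N: "is_struct L N" "set b \<subseteq> univ N"
    and J: "substruct M J" and f: "K_embedding (all_structs L) N J f" and a: "a = map f b"
    using assms unfolding type_step_def tuples_def all_structs_def by auto
  have emb: "embedding L N J f" using f by (simp add: K_embedding_def all_structs_def)
  have "same_qf_type L M ((!) a) J (id \<circ> (!) a) {..<length a}"
    using M by (intro same_qf_type_embedding[OF M(1) substruct_embedding[OF J]]) (auto simp: subset_iff)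
  then have 1: "same_qf_type L M ((!) a) J ((!) a) {..<length a}" by simp
  have "same_qf_type L N ((!) b) J (f \<circ> (!) b) {..<length a}"
    using N a by (intro same_qf_type_embedding[OF N(1) emb]) (auto simp: subset_iff)
  then have "same_qf_type L N ((!) b) J ((!) a) {..<length a}"
    by (rule same_qf_type_cong) (simp_all add: a)
  from same_qf_type_trans[OF 1 same_qf_type_sym[OF this]] show ?thesis .
qed

text \<open>
  Each link of a chain consists of a substructure and an embedding, and both preserve and reflect
  atomic formulas.
\<close>

lemma tp_same_qf_type:
  assumes "(b, N) \<in> tp (all_structs L) a M"
  shows "same_qf_type L M ((!) a) N ((!) b) {..<length a}"
proof -
  have "((a, M), (b, N)) \<in> (type_step (all_structs L))\<^sup>+" using assms by (simp add: tp_def)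
  then have "same_qf_type L M ((!) a) (snd (b, N)) ((!) (fst (b, N))) {..<length a} \<and> length (fst (b, N)) = length a"
  proof (induction rule: trancl_induct)
    case (base y)
    then show ?case
      using type_step_same_qf_type[of a M "fst y" "snd y"] type_step_nths[of a M "fst y" "snd y"] by auto
  next
    case (step y z)
    then show ?case
      using type_step_same_qf_type[of "fst y" "snd y" "fst z" "snd z"]
        type_step_nths[of "fst y" "snd y" "fst z" "snd z"] same_qf_type_trans by fastforce
  qed
  then show ?thesis by simp
qed

section \<open>Indiscernibles from an Erdos--Rado class\<close>

text \<open>
  By insertion: split the enumeration of \<open>S\<close> into the elements below and above the new one.
\<close>

lemma sorted_enumeration_exists:
  assumes r: "strict_linear_order_on A r" and "finite S" "S \<subseteq> A"
  shows "\<exists>xs. set xs = S \<and> sorted_wrt (\<lambda>x y. (x, y) \<in> r) xs"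
  using assms(2,3)
proof (induction S rule: finite_induct)
  case (insert x S)
  then obtain xs where xs: "set xs = S" "sorted_wrt (\<lambda>x y. (x, y) \<in> r) xs" by auto
  let ?l = "filter (\<lambda>y. (y, x) \<in> r) xs" and ?u = "filter (\<lambda>y. (x, y) \<in> r) xs"
  have tr: "trans r" and tot: "total_on A r" using r by (auto simp: strict_linear_order_on_def)
  have "set (?l @ x # ?u) = insert x S"
    using xs(1) tot insert by (auto simp: total_on_def)
  moreover have "sorted_wrt (\<lambda>x y. (x, y) \<in> r) (?l @ x # ?u)"
    using xs(2) tr by (auto simp: sorted_wrt_append intro: sorted_wrt_filter transD[OF tr])
  ultimately show ?case by blast
qed simp

lemma sorted_enumeration_unique:
  assumes tr: "trans r" and ir: "irrefl r"
  shows "sorted_wrt (\<lambda>x y. (x, y) \<in> r) xs \<Longrightarrow> sorted_wrt (\<lambda>x y. (x, y) \<in> r) ys \<Longrightarrow> set xs = set ys \<Longrightarrow> xs = ys"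
proof (induction xs arbitrary: ys)
  case (Cons x xs)
  then obtain y zs where ys: "ys = y # zs" by (cases ys) auto
  have "x = y"
  proof (rule ccontr)
    assume "x \<noteq> y"
    then have "(x, y) \<in> r" "(y, x) \<in> r" using Cons.prems ys by auto
    then show False using tr ir by (meson irrefl_def transD)
  qed
  moreover have "x \<notin> set xs" "y \<notin> set zs" using Cons.prems ys ir by (auto simp: irrefl_def)
  ultimately have "set xs = set zs" using Cons.prems(3) ys by auto
  then show ?case using Cons \<open>x = y\<close> ys by simp
qed simp

lemma sorted_distinct: "irrefl r \<Longrightarrow> sorted_wrt (\<lambda>x y. (x, y) \<in> r) xs \<Longrightarrow> distinct xs"
  by (induction xs) (auto simp: irrefl_def)

text \<open>
  A system of maps \<open>\<sigma> J s\<close> from the finite subsets \<open>s\<close> of the members \<open>J\<close> of \<open>K\<close> to a structure \<open>M\<close>, whose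
  quantifier-free types are coherent in \<open>s\<close>, and which is invariant under \<open>K\<close>-embeddings: the
  template from which a structure generated by \<open>J\<close> is built, for all \<open>J\<close> at once.
\<close>

definition indiscernible_system ::
  "'u abstract_class \<Rightarrow> 'u lang \<Rightarrow> 'u struct \<Rightarrow> ('u struct \<Rightarrow> 'u set \<Rightarrow> 'u \<Rightarrow> 'u) \<Rightarrow> bool" where
  "indiscernible_system K L M \<sigma> \<longleftrightarrow>
     (\<forall>J\<in>mem K. \<forall>s. finite s \<and> s \<subseteq> univ J \<longrightarrow> \<sigma> J s ` s \<subseteq> univ M \<and> inj_on (\<sigma> J s) s) \<and>
     (\<forall>J\<in>mem K. \<forall>J'\<in>mem K. \<forall>f s x. K_embedding K J J' f \<and> finite s \<and> s \<subseteq> univ J \<and> x \<in> s \<longrightarrow>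
        \<sigma> J' (f ` s) (f x) = \<sigma> J s x) \<and>
     (\<forall>J\<in>mem K. \<forall>s s'. finite s' \<and> s \<subseteq> s' \<and> s' \<subseteq> univ J \<longrightarrow> same_qf_type L M (\<sigma> J s) M (\<sigma> J s') s)"

lemma tp_all_structs_self:
  assumes M: "is_struct L M" and a: "set a \<subseteq> univ M"
  shows "(a, M) \<in> tp (all_structs L) a M"
proof -
  have sub: "substruct M M" using induced_univ[OF M] by (simp add: substruct_def)
  have "K_embedding (all_structs L) M M id"
    using substruct_embedding[OF sub] induced_univ[OF M] M sub
    by (simp add: K_embedding_def all_structs_def)
  then have "((map id a, M), (a, M)) \<in> type_step (all_structs L)"
    using M a sub by (intro type_stepI) (auto simp: tuples_def all_structs_def)
  then show ?thesis by (simp add: tp_def trancl.r_into_trancl)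
qed

lemma blueprint_restr:
  assumes "blueprint K lt L \<Phi>" "p \<in> inc_types K lt" "(a, I) \<in> p" "(b, M) \<in> \<Phi> p" "s \<subseteq> {..<length a}"
  shows "\<Phi> (tp_restr K p s) = tp_restr (all_structs L) (\<Phi> p) s"
proof -
  note * = conjunct2[OF bspec[OF assms(1)[unfolded blueprint_def] assms(2)]]
  have "\<forall>(b, M)\<in>\<Phi> p. length b = length a \<and>
      (\<forall>s. s \<subseteq> {..<length a} \<longrightarrow> \<Phi> (tp_restr K p s) = tp_restr (all_structs L) (\<Phi> p) s)"
    using bspec[OF * assms(3)] by (simp only: prod.case)
  from bspec[OF this assms(4)] assms(5) show ?thesis by (simp only: prod.case)
qed

text \<open>
  Enumerate \<open>s\<close> increasingly, realise its type by a tuple \<open>a\<close> in a big \<open>I\<close> as the Erdos--Rado property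
  provides, and send the enumeration to \<open>h a\<close>.  The type of \<open>h a\<close> is then the value of the blueprint at
  the type of \<open>s\<close>, and coherence is the compatibility of the blueprint with restriction.
\<close>

lemma erdos_rado_indiscernibles:
  fixes K :: "'u abstract_class"
  assumes K: "ordered_class K lt" and I: "I \<in> mem K" and M: "is_struct L M"
    and h: "inj_on h (univ I)" "h ` univ I \<subseteq> univ M"
    and \<Phi>: "blueprint K lt L \<Phi>"
    and real: "\<forall>p\<in>inc_types K lt. \<exists>a. set a \<subseteq> univ I \<and> increasing lt I a \<and> tp K a I = p \<and>
                 tp (all_structs L) (map h a) M = \<Phi> p"
  shows "\<exists>\<sigma>. indiscernible_system K L M \<sigma>"
proof -
  have abs: "is_abstract_class K" and lt: "(lt, 2) \<in> rels (clang K)"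
    and order: "\<And>J. J \<in> mem K \<Longrightarrow> strict_linear_order_on (univ J) {(x, y). rl J lt [x, y]}"
    using K by (auto simp: ordered_class_def)
  have inc: "increasing lt J xs \<longleftrightarrow> sorted_wrt (\<lambda>x y. (x, y) \<in> {(x, y). rl J lt [x, y]}) xs" for J xs
    by (simp add: increasing_def)
  have tr: "trans {(x, y). rl J lt [x, y]}" and ir: "irrefl {(x, y). rl J lt [x, y]}" if "J \<in> mem K" for J
    using order[OF that] by (auto simp: strict_linear_order_on_def)
  have inc_unique: "xs = ys" if "J \<in> mem K" "increasing lt J xs" "increasing lt J ys" "set xs = set ys" for J xs ys
    using sorted_enumeration_unique[OF tr[OF that(1)] ir[OF that(1)]] that(2-4) unfolding inc by blast
  have inc_distinct: "distinct xs" if "J \<in> mem K" "increasing lt J xs" for J xs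
    using sorted_distinct[OF ir[OF that(1)]] that(2) unfolding inc by blast
  define enum where "enum J s = (SOME xs. set xs = s \<and> increasing lt J xs)" for J s
  have enum: "set (enum J s) = s" "increasing lt J (enum J s)" if "J \<in> mem K" "finite s" "s \<subseteq> univ J" for J s
  proof -
    have "\<exists>xs. set xs = s \<and> increasing lt J xs"
      using sorted_enumeration_exists[OF order[OF that(1)] that(2,3)] unfolding inc .
    from someI_ex[OF this] show "set (enum J s) = s" "increasing lt J (enum J s)"
      unfolding enum_def by blast+
  qed
  have enum_eq: "enum J s = xs" if "J \<in> mem K" "increasing lt J xs" "set xs = s" "s \<subseteq> univ J" for J s xs
    using inc_unique[OF that(1) enum(2)[OF that(1) _ that(4)] that(2)] enum(1)[OF that(1) _ that(4)] that(3) by auto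
  obtain a where a_all: "\<forall>p\<in>inc_types K lt. set (a p) \<subseteq> univ I \<and> increasing lt I (a p) \<and>
      tp K (a p) I = p \<and> tp (all_structs L) (map h (a p)) M = \<Phi> p"
    using bchoice[OF real] by (rule exE)
  note a = bspec[OF a_all]
  define p where "p J s = tp K (enum J s) J" for J s
  have p_inc: "p J s \<in> inc_types K lt" and enum_tuple: "(enum J s, J) \<in> tuples K"
    if "J \<in> mem K" "finite s" "s \<subseteq> univ J" for J s
  proof -
    show "(enum J s, J) \<in> tuples K" using enum(1)[OF that] that by (auto intro: tuplesI)
    then show "p J s \<in> inc_types K lt" using enum(2)[OF that] unfolding inc_types_def p_def by blast
  qed
  have a_len: "length (a (p J s)) = length (enum J s)" if "J \<in> mem K" "finite s" "s \<subseteq> univ J" for J s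
  proof -
    have "(a (p J s), I) \<in> tp K (a (p J s)) I"
      using tp_self[OF abs tuplesI[OF I]] a[OF p_inc[OF that]] by blast
    then show ?thesis using a[OF p_inc[OF that]] tp_mem_length unfolding p_def by metis
  qed
  define \<sigma> where "\<sigma> J s x = the (map_of (zip (enum J s) (map h (a (p J s)))) x)" for J s x
  have \<sigma>: "map (\<sigma> J s) (enum J s) = map h (a (p J s))" if "J \<in> mem K" "finite s" "s \<subseteq> univ J" for J s
  proof (rule nth_equalityI)
    fix i assume "i < length (map (\<sigma> J s) (enum J s))"
    then show "map (\<sigma> J s) (enum J s) ! i = map h (a (p J s)) ! i"
      using map_of_zip_nth[of "enum J s" "map h (a (p J s))" i] a_len[OF that]
        inc_distinct[OF that(1) enum(2)[OF that]] by (simp add: \<sigma>_def)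
  qed (simp add: a_len[OF that])
  have ind1: "\<sigma> J s ` s \<subseteq> univ M \<and> inj_on (\<sigma> J s) s" if "J \<in> mem K" "finite s" "s \<subseteq> univ J" for J s
  proof
    note ap = a[OF p_inc[OF that]]
    have "\<sigma> J s ` s = set (map (\<sigma> J s) (enum J s))" using enum(1)[OF that] by simp
    then show "\<sigma> J s ` s \<subseteq> univ M" using ap h(2) unfolding \<sigma>[OF that] by auto
    have "distinct (map h (a (p J s)))"
      using inc_distinct[OF I] ap h(1) by (auto simp: distinct_map intro: inj_on_subset)
    then show "inj_on (\<sigma> J s) s" unfolding \<sigma>[OF that, symmetric] using enum(1)[OF that] by (simp add: distinct_map)
  qed
  have ind2: "\<sigma> J' (f ` s) (f x) = \<sigma> J s x"
    if J: "J \<in> mem K" "J' \<in> mem K" and f: "K_embedding K J J' f" and s: "finite s" "s \<subseteq> univ J" and x: "x \<in> s"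
    for J J' f s x
  proof -
    have hom: "homomorphism (clang K) J J' f" using f by (simp add: K_embedding_def embedding_def)
    have rl: "rl J' lt [f u, f v]" if "rl J lt [u, v]" for u v
    proof -
      have "set [u, v] \<subseteq> univ J" using struct_rl[OF class_struct[OF abs J(1)] that] by blast
      moreover have "(lt, length [u, v]) \<in> rels (clang K)" using lt by (simp add: numeral_2_eq_2)
      ultimately have "rl J' lt (map f [u, v])" using hom that unfolding homomorphism_def by blast
      then show ?thesis by simp
    qed
    have "increasing lt J' (map f (enum J s))"
      using enum(2)[OF J(1) s] rl unfolding increasing_def by (auto simp: sorted_wrt_map intro: sorted_wrt_mono_rel[rotated])
    moreover have "f ` s \<subseteq> univ J'" using K_embedding_into[OF f] s by blast
    ultimately have enum': "enum J' (f ` s) = map f (enum J s)"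
      using enum_eq[OF J(2)] enum(1)[OF J(1) s] by simp
    then have p': "p J' (f ` s) = p J s"
      unfolding p_def using tp_embedding[OF abs J f] enum(1)[OF J(1) s] s by simp
    have fs: "f ` s \<subseteq> univ J'" using K_embedding_into[OF f] s by blast
    have "map (\<lambda>x. \<sigma> J' (f ` s) (f x)) (enum J s) = map (\<sigma> J s) (enum J s)"
      using \<sigma>[OF J(2) finite_imageI[OF s(1)] fs] unfolding enum' p' \<sigma>[OF J(1) s] by (simp add: comp_def)
    then show ?thesis using x enum(1)[OF J(1) s] by (simp add: map_eq_conv)
  qed
  have ind3: "same_qf_type L M (\<sigma> J s) M (\<sigma> J s') s"
    if J: "J \<in> mem K" and s': "finite s'" "s' \<subseteq> univ J" and ss': "s \<subseteq> s'" for J s s'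
  proof -
    have s: "finite s" "s \<subseteq> univ J" using s' ss' finite_subset by auto
    note ap = a[OF p_inc[OF J s]] and ap' = a[OF p_inc[OF J s']]
    let ?e = "enum J s'"
    define X where "X = {i. i < length ?e \<and> ?e ! i \<in> s}"
    have fil: "nths ?e X = filter (\<lambda>x. x \<in> s) ?e" unfolding X_def by (rule filter_eq_nths[symmetric])
    have "enum J s = nths ?e X"
      unfolding fil
      by (rule enum_eq[OF J])
        (use enum[OF J s'] s ss' in \<open>auto simp: increasing_def intro: sorted_wrt_filter\<close>)
    then have e: "nths ?e X = enum J s" by simp
    have "\<Phi> (tp_restr K (p J s') X) = tp_restr (all_structs L) (\<Phi> (p J s')) X"
    proof -
      have 1: "(?e, J) \<in> p J s'" unfolding p_def by (rule tp_self[OF abs enum_tuple[OF J s']])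
      have 2: "(map h (a (p J s')), M) \<in> \<Phi> (p J s')"
        using tp_all_structs_self[OF M, of "map h (a (p J s'))"] ap' h(2) by auto
      have "X \<subseteq> {..<length ?e}" unfolding X_def by auto
      then show ?thesis by (rule blueprint_restr[OF \<Phi> p_inc[OF J s'] 1 2])
    qed
    moreover have "tp_restr K (p J s') X = p J s"
      using tp_restr_tp[OF abs enum_tuple[OF J s'], of X] e unfolding p_def by simp
    ultimately have \<Phi>_eq: "tp (all_structs L) (map h (a (p J s))) M = tp_restr (all_structs L) (\<Phi> (p J s')) X"
      using ap by simp
    have "(map h (a (p J s')), M) \<in> \<Phi> (p J s')"
      using tp_all_structs_self[OF M, of "map h (a (p J s'))"] ap' h(2) by auto
    moreover have "set (nths (map h (a (p J s'))) X) \<subseteq> univ M"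
      using set_nths_subset[of "map h (a (p J s'))" X] ap' h(2) by auto
    then have "(nths (map h (a (p J s'))) X, M) \<in> tp (all_structs L) (nths (map h (a (p J s'))) X) M"
      by (rule tp_all_structs_self[OF M])
    ultimately have "(nths (map h (a (p J s'))) X, M) \<in> tp (all_structs L) (map h (a (p J s))) M"
      unfolding \<Phi>_eq tp_restr_def by blast
    then have "same_qf_type L M ((!) (map h (a (p J s)))) M ((!) (nths (map h (a (p J s'))) X)) {..<length (map h (a (p J s)))}"
      by (rule tp_same_qf_type)
    moreover have "nths (map h (a (p J s'))) X = map (\<sigma> J s') (enum J s)"
      unfolding \<sigma>[OF J s', symmetric] nths_map e ..
    ultimately have "same_qf_type L M ((!) (map (\<sigma> J s) (enum J s))) M ((!) (map (\<sigma> J s') (enum J s))) {..<length (enum J s)}"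
      using a_len[OF J s] by (simp add: \<sigma>[OF J s])
    from same_qf_type_reindex[OF this] show ?thesis using enum(1)[OF J s] by simp
  qed
  have "indiscernible_system K L M \<sigma>"
    unfolding indiscernible_system_def
    by (intro conjI; intro ballI allI impI; elim conjE; rule ind1 ind2 ind3; assumption)
  then show ?thesis by blast
qed

section \<open>Skolemization\<close>

text \<open>
  The free variables of a formula in increasing order.  They are the argument places of the Skolem
  function and of the relation attached to the formula.
\<close>

definition args :: "'u fm \<Rightarrow> nat list" where
  "args \<phi> = sorted_list_of_set (fv \<phi>)"

text \<open>
  The valuation that gives the argument places of \<open>\<phi>\<close> the values \<open>xs\<close>; other variables get an unspecified value.
\<close>

definition assign :: "'u fm \<Rightarrow> 'u list \<Rightarrow> nat \<Rightarrow> 'u" where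
  "assign \<phi> xs k = the (map_of (zip (args \<phi>) xs) k)"

text \<open>
  An arbitrary element is chosen where no witness is required, so that every formula of the fragment
  may serve as the name of an operation.
\<close>

definition witness :: "'u struct \<Rightarrow> 'u fm \<Rightarrow> 'u list \<Rightarrow> 'u" where
  "witness M \<phi> xs = (SOME a. a \<in> univ M \<and>
     (\<forall>x \<psi>. \<phi> = Ex x \<psi> \<longrightarrow> sat M \<phi> (assign \<phi> xs) \<longrightarrow> sat M \<psi> ((assign \<phi> xs)(x := a))))"

text \<open>
  Each formula of the fragment names an operation and a relation.  The arity is the exact number of
  free variables; in particular the Skolem function of a sentence is a constant, so that the structure
  generated by the empty set has the elements that true existential sentences demand.
\<close>

definition sk_lang :: "('u fm \<Rightarrow> 'u) \<Rightarrow> 'u fm set \<Rightarrow> 'u lang" where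
  "sk_lang code \<F> = \<lparr> funs = (\<lambda>\<phi>. (code \<phi>, card (fv \<phi>))) ` \<F>, rels = (\<lambda>\<phi>. (code \<phi>, card (fv \<phi>))) ` \<F> \<rparr>"

definition sk_struct :: "('u fm \<Rightarrow> 'u) \<Rightarrow> 'u fm set \<Rightarrow> 'u struct \<Rightarrow> 'u struct" where
  "sk_struct code \<F> M = \<lparr> univ = univ M,
     fn = (\<lambda>c xs. if (c, length xs) \<in> funs (sk_lang code \<F>) \<and> set xs \<subseteq> univ M
       then witness M (inv_into \<F> code c) xs else undefined),
     rl = (\<lambda>c xs. (c, length xs) \<in> rels (sk_lang code \<F>) \<and> set xs \<subseteq> univ M \<and>
       sat M (inv_into \<F> code c) (assign (inv_into \<F> code c) xs)) \<rparr>"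

lemma set_args: "finite (fv \<phi>) \<Longrightarrow> set (args \<phi>) = fv \<phi>"
  by (simp add: args_def)

lemma length_args: "finite (fv \<phi>) \<Longrightarrow> length (args \<phi>) = card (fv \<phi>)"
  by (simp add: args_def)

lemma assign_args: "finite (fv \<phi>) \<Longrightarrow> k \<in> fv \<phi> \<Longrightarrow> assign \<phi> (map v (args \<phi>)) k = v k"
  by (simp add: assign_def map_of_zip_map set_args)

lemma witness:
  assumes "univ M \<noteq> {}"
  shows "witness M \<phi> xs \<in> univ M"
    and "\<phi> = Ex x \<psi> \<Longrightarrow> sat M \<phi> (assign \<phi> xs) \<Longrightarrow> sat M \<psi> ((assign \<phi> xs)(x := witness M \<phi> xs))"
proof -
  have "\<exists>a. a \<in> univ M \<and>
     (\<forall>x \<psi>. \<phi> = Ex x \<psi> \<longrightarrow> sat M \<phi> (assign \<phi> xs) \<longrightarrow> sat M \<psi> ((assign \<phi> xs)(x := a)))"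
  proof (cases "(\<exists>x \<psi>. \<phi> = Ex x \<psi>) \<and> sat M \<phi> (assign \<phi> xs)")
    case True
    then obtain x \<psi> where \<phi>: "\<phi> = Ex x \<psi>" and "sat M \<phi> (assign \<phi> xs)" by blast
    then obtain a where "a \<in> univ M" "sat M \<psi> ((assign \<phi> xs)(x := a))" by auto
    then show ?thesis using \<phi> by auto
  next
    case False
    then show ?thesis using assms by blast
  qed
  from someI_ex[OF this] show "witness M \<phi> xs \<in> univ M"
    "\<phi> = Ex x \<psi> \<Longrightarrow> sat M \<phi> (assign \<phi> xs) \<Longrightarrow> sat M \<psi> ((assign \<phi> xs)(x := witness M \<phi> xs))"
    unfolding witness_def by blast+
qed

lemma sk_struct_univ: "univ (sk_struct code \<F> M) = univ M"
  by (simp add: sk_struct_def)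

lemma sk_struct_is_struct:
  assumes "is_struct L M" "univ M \<noteq> {}"
  shows "is_struct (sk_lang code \<F>) (sk_struct code \<F> M)"
  using struct_small[OF assms(1)] witness(1)[OF assms(2)] unfolding is_struct_def
  by (simp add: sk_struct_def)

lemma sk_struct_rl:
  assumes F: "fragment L \<F>" and code: "inj_on code \<F>" and \<phi>: "\<phi> \<in> \<F>" and v: "v ` fv \<phi> \<subseteq> univ M"
  shows "rl (sk_struct code \<F> M) (code \<phi>) (map v (args \<phi>)) \<longleftrightarrow> sat M \<phi> v"
proof -
  note fin = fragment_finite_fv[OF F \<phi>]
  have "(code \<phi>, length (map v (args \<phi>))) \<in> rels (sk_lang code \<F>)"
    using \<phi> by (simp add: sk_lang_def length_args[OF fin])
  moreover have "set (map v (args \<phi>)) \<subseteq> univ M" using v by (simp add: set_args[OF fin])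
  moreover have "sat M \<phi> (assign \<phi> (map v (args \<phi>))) \<longleftrightarrow> sat M \<phi> v"
    by (rule sat_cong) (rule assign_args[OF fin])
  ultimately show ?thesis using code \<phi> by (simp add: sk_struct_def)
qed

text \<open>
  The defining property of Skolem functions, for a valuation in place of a list of arguments.
\<close>

lemma sk_struct_fn:
  assumes F: "fragment L \<F>" and code: "inj_on code \<F>" and \<phi>: "Ex x \<psi> \<in> \<F>"
    and v: "v ` fv (Ex x \<psi>) \<subseteq> univ M" and ne: "univ M \<noteq> {}" and sat: "sat M (Ex x \<psi>) v"
  shows "sat M \<psi> (v(x := fn (sk_struct code \<F> M) (code (Ex x \<psi>)) (map v (args (Ex x \<psi>)))))"
proof -
  let ?\<phi> = "Ex x \<psi>"
  let ?xs = "map v (args ?\<phi>)"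
  note fin = fragment_finite_fv[OF F \<phi>]
  have "(code ?\<phi>, card (fv ?\<phi>)) \<in> funs (sk_lang code \<F>)" unfolding sk_lang_def using \<phi> by auto
  then have "(code ?\<phi>, length ?xs) \<in> funs (sk_lang code \<F>)"
    by (simp only: length_map length_args[OF fin])
  moreover have "set ?xs \<subseteq> univ M" using v by (simp only: set_map set_args[OF fin])
  ultimately have fn: "fn (sk_struct code \<F> M) (code ?\<phi>) ?xs = witness M ?\<phi> ?xs"
    using code \<phi> by (simp add: sk_struct_def)
  have "sat M ?\<phi> (assign ?\<phi> ?xs)"
    using sat sat_cong[of ?\<phi> "assign ?\<phi> ?xs" v M] assign_args[OF fin, of _ v] by blast
  from witness(2)[OF ne refl this]
  have "sat M \<psi> ((assign ?\<phi> ?xs)(x := witness M ?\<phi> ?xs))" .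
  moreover have "((assign ?\<phi> ?xs)(x := witness M ?\<phi> ?xs)) k = (v(x := witness M ?\<phi> ?xs)) k" if "k \<in> fv \<psi>" for k
    using assign_args[OF fin, of k v] that by simp
  ultimately show ?thesis unfolding fn using sat_cong by blast
qed

text \<open>
  An operation of the original language is the Skolem function of the formula that says that it has a
  value, and is thus present in the Skolemized language.
\<close>

definition sk_op :: "('u fm \<Rightarrow> 'u) \<Rightarrow> 'u \<Rightarrow> nat \<Rightarrow> 'u" where
  "sk_op code c n = code (Ex n (graph_fm c n))"

lemma fv_Ex_graph: "fv (Ex n (graph_fm c n)) = {..<n}"
  unfolding fv.simps fv_graph_fm by auto

lemma sk_op_in:
  assumes F: "fragment L \<F>" and c: "(c, n) \<in> funs L"
  shows "(sk_op code c n, n) \<in> funs (sk_lang code \<F>)"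
proof -
  have "Ex n (graph_fm c n) \<in> \<F>" using graph_fm_in[OF F c] fragment_sub(3)[OF F] by blast
  moreover have "card (fv (Ex n (graph_fm c n))) = n" unfolding fv_Ex_graph by simp
  ultimately show ?thesis unfolding sk_lang_def sk_op_def by force
qed

lemma sk_op_fn:
  assumes F: "fragment L \<F>" and code: "inj_on code \<F>" and M: "is_struct L M" and ne: "univ M \<noteq> {}"
    and c: "(c, length xs) \<in> funs L" and xs: "set xs \<subseteq> univ M"
  shows "fn (sk_struct code \<F> M) (sk_op code c (length xs)) xs = fn M c xs"
proof -
  let ?n = "length xs"
  let ?\<phi> = "Ex ?n (graph_fm c ?n)"
  have \<phi>: "?\<phi> \<in> \<F>" using graph_fm_in[OF F c] fragment_sub(3)[OF F] by blast
  have args: "args ?\<phi> = [0..<?n]" unfolding args_def fv_Ex_graph by (simp add: lessThan_atLeast0)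
  have map_upd: "map (((!) xs)(?n := a)) [0..<?n] = xs" for a
    by (rule nth_equalityI) auto
  have "sat M ?\<phi> ((!) xs)"
    using struct_fn_closed[OF M c xs] unfolding sat.simps sat_graph_fm map_upd by auto
  moreover have "(!) xs ` fv ?\<phi> \<subseteq> univ M" unfolding fv_Ex_graph using xs by (auto simp: subset_iff)
  ultimately have "sat M (graph_fm c ?n)
      (((!) xs)(?n := fn (sk_struct code \<F> M) (code ?\<phi>) (map ((!) xs) (args ?\<phi>))))"
    using sk_struct_fn[OF F code \<phi> _ ne] by blast
  then show ?thesis unfolding sat_graph_fm map_upd args map_nth sk_op_def by simp
qed

lemma small_sk_lang:
  assumes U: "inaccessible TYPE('u)" and F: "fragment L (\<F> :: 'u fm set)"
  shows "small_lang (sk_lang code \<F>)"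
proof -
  have "small TYPE('u) \<F>" using F by (simp add: fragment_def)
  then have "small TYPE('u) (Inl ` funs (sk_lang code \<F>) \<union> Inr ` rels (sk_lang code \<F>))"
    by (intro small_Un[OF U] small_image) (simp_all add: sk_lang_def small_image)
  then show ?thesis by (simp add: small_lang_def lang_card_def small_def Plus_def)
qed

section \<open>Models generated by indiscernibles\<close>

locale generated_models =
  fixes K :: "'u abstract_class" and L :: "'u lang" and \<F> :: "'u fm set" and M :: "'u struct"
    and code :: "'u fm \<Rightarrow> 'u" and \<sigma> :: "'u struct \<Rightarrow> 'u set \<Rightarrow> 'u \<Rightarrow> 'u" and enc :: "('u, 'u) sterm \<Rightarrow> 'u"
  assumes U: "inaccessible TYPE('u)" and K: "is_abstract_class K" and F: "fragment L \<F>"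
    and M: "is_struct L M" and M_nonempty: "univ M \<noteq> {}" and code: "inj_on code \<F>"
    and \<sigma>: "indiscernible_system K (sk_lang code \<F>) (sk_struct code \<F> M) \<sigma>"
    and enc: "inj enc"
begin

abbreviation Ls where "Ls \<equiv> sk_lang code \<F>"
abbreviation Ms where "Ms \<equiv> sk_struct code \<F> M"

definition Terms :: "'u struct \<Rightarrow> ('u, 'u) sterm set" where
  "Terms J = {t. wf_sterm Ls t \<and> gens t \<subseteq> univ J}"

definition ev :: "'u struct \<Rightarrow> 'u set \<Rightarrow> ('u, 'u) sterm \<Rightarrow> 'u" where
  "ev J s t = sval Ms (\<sigma> J s) t"

lemma Ms: "is_struct Ls Ms"
  by (rule sk_struct_is_struct[OF M M_nonempty])

lemma \<sigma>_in: "J \<in> mem K \<Longrightarrow> finite s \<Longrightarrow> s \<subseteq> univ J \<Longrightarrow> \<sigma> J s ` s \<subseteq> univ M"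
  and \<sigma>_inj: "J \<in> mem K \<Longrightarrow> finite s \<Longrightarrow> s \<subseteq> univ J \<Longrightarrow> inj_on (\<sigma> J s) s"
  using \<sigma> by (simp_all add: indiscernible_system_def sk_struct_univ)

lemma \<sigma>_natural:
  "J \<in> mem K \<Longrightarrow> J' \<in> mem K \<Longrightarrow> K_embedding K J J' f \<Longrightarrow> finite s \<Longrightarrow> s \<subseteq> univ J \<Longrightarrow> x \<in> s \<Longrightarrow>
    \<sigma> J' (f ` s) (f x) = \<sigma> J s x"
  using \<sigma> by (simp add: indiscernible_system_def)

lemma \<sigma>_coherent:
  "J \<in> mem K \<Longrightarrow> finite s' \<Longrightarrow> s \<subseteq> s' \<Longrightarrow> s' \<subseteq> univ J \<Longrightarrow> same_qf_type Ls Ms (\<sigma> J s) Ms (\<sigma> J s') s"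
  using \<sigma> by (simp add: indiscernible_system_def)

lemma ev_in:
  assumes "J \<in> mem K" "finite s" "s \<subseteq> univ J" "t \<in> Terms J" "gens t \<subseteq> s"
  shows "ev J s t \<in> univ M"
  using sval_in[OF Ms, of t "\<sigma> J s"] \<sigma>_in[OF assms(1-3)] assms(4,5) image_mono[OF assms(5), of "\<sigma> J s"]
  unfolding ev_def Terms_def sk_struct_univ by blast

lemma ev_eq_coherent:
  assumes "J \<in> mem K" "finite s'" "s' \<subseteq> univ J" "s \<subseteq> s'"
    and "t \<in> Terms J" "t' \<in> Terms J" "gens t \<subseteq> s" "gens t' \<subseteq> s"
  shows "ev J s t = ev J s t' \<longleftrightarrow> ev J s' t = ev J s' t'"
  using \<sigma>_coherent[OF assms(1,2,4,3)] assms(5-8) unfolding same_qf_type_def ev_def Terms_def by simp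

text \<open>
  Since every formula of the fragment is an atomic formula of the Skolemized language, coherence of
  quantifier-free types is coherence of \<open>\<F>\<close>-types.
\<close>

lemma sat_coherent:
  assumes J: "J \<in> mem K" and s: "finite s'" "s' \<subseteq> univ J" "s \<subseteq> s'" and \<phi>: "\<phi> \<in> \<F>"
    and v: "\<And>k. k \<in> fv \<phi> \<Longrightarrow> v k \<in> Terms J \<and> gens (v k) \<subseteq> s"
  shows "sat M \<phi> (ev J s \<circ> v) \<longleftrightarrow> sat M \<phi> (ev J s' \<circ> v)"
proof -
  note fin = fragment_finite_fv[OF F \<phi>]
  let ?ts = "map v (args \<phi>)"
  have s0: "finite s" "s \<subseteq> univ J" using s finite_subset by auto
  have ts: "\<forall>t\<in>set ?ts. wf_sterm Ls t \<and> gens t \<subseteq> s"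
    using v by (auto simp: set_args[OF fin] Terms_def)
  have "(code \<phi>, length ?ts) \<in> rels Ls" using \<phi> by (simp add: sk_lang_def length_args[OF fin])
  then have "rl Ms (code \<phi>) (map (sval Ms (\<sigma> J s)) ?ts) \<longleftrightarrow> rl Ms (code \<phi>) (map (sval Ms (\<sigma> J s')) ?ts)"
    using \<sigma>_coherent[OF J s(1,3,2)] ts unfolding same_qf_type_def by blast
  then have "rl Ms (code \<phi>) (map (ev J s \<circ> v) (args \<phi>)) \<longleftrightarrow> rl Ms (code \<phi>) (map (ev J s' \<circ> v) (args \<phi>))"
    unfolding map_map ev_def[abs_def] .
  moreover have "(ev J s \<circ> v) ` fv \<phi> \<subseteq> univ M" "(ev J s' \<circ> v) ` fv \<phi> \<subseteq> univ M"
  proof -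
    show "(ev J s \<circ> v) ` fv \<phi> \<subseteq> univ M"
      using v ev_in[OF J s0] by (simp add: image_subset_iff)
    show "(ev J s' \<circ> v) ` fv \<phi> \<subseteq> univ M"
      using v ev_in[OF J s(1,2)] s(3) by (simp add: image_subset_iff subset_trans[OF _ s(3)])
  qed
  ultimately show ?thesis using sk_struct_rl[OF F code \<phi>] by simp
qed

text \<open>
  The relations of the original language are atomic formulas of the fragment.
\<close>

lemma rl_coherent:
  assumes J: "J \<in> mem K" and s: "finite s'" "s' \<subseteq> univ J" "s \<subseteq> s'" and c: "(c, length ts) \<in> rels L"
    and ts: "\<And>t. t \<in> set ts \<Longrightarrow> t \<in> Terms J \<and> gens t \<subseteq> s"
  shows "rl M c (map (ev J s) ts) \<longleftrightarrow> rl M c (map (ev J s') ts)"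
proof -
  let ?\<phi> = "Rel c (map Var [0..<length ts])"
  have fv: "fv ?\<phi> = {..<length ts}" by auto
  have val: "map (tval M (ev J r \<circ> (!) ts)) (map Var [0..<length ts]) = map (ev J r) ts" for r
    by (rule nth_equalityI) auto
  have "?\<phi> \<in> \<F>" by (rule fragment_Rel[OF F]) (use c in \<open>auto simp: list_all_iff\<close>)
  moreover have "ts ! k \<in> Terms J \<and> gens (ts ! k) \<subseteq> s" if "k \<in> fv ?\<phi>" for k
    using that ts[of "ts ! k"] unfolding fv by simp
  ultimately have "sat M ?\<phi> (ev J s \<circ> (!) ts) \<longleftrightarrow> sat M ?\<phi> (ev J s' \<circ> (!) ts)"
    by (rule sat_coherent[OF J s])
  then show ?thesis unfolding sat.simps val .
qed

lemma ev_natural: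
  assumes "J \<in> mem K" "J' \<in> mem K" "K_embedding K J J' f" "finite s" "s \<subseteq> univ J" "gens t \<subseteq> s"
  shows "ev J' (f ` s) (map_sterm id f t) = ev J s t"
  unfolding ev_def sval_map
  by (rule sval_cong) (use \<sigma>_natural[OF assms(1-5)] assms(6) in auto)

definition equal_in :: "'u struct \<Rightarrow> ('u, 'u) sterm \<Rightarrow> ('u, 'u) sterm \<Rightarrow> bool" where
  "equal_in J t t' \<longleftrightarrow> ev J (gens t \<union> gens t') t = ev J (gens t \<union> gens t') t'"

lemma equal_in_iff:
  assumes "J \<in> mem K" "finite s" "s \<subseteq> univ J" "t \<in> Terms J" "t' \<in> Terms J" "gens t \<subseteq> s" "gens t' \<subseteq> s"
  shows "equal_in J t t' \<longleftrightarrow> ev J s t = ev J s t'"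
  unfolding equal_in_def by (rule ev_eq_coherent) (use assms in auto)

text \<open>
  The elements of the generated model are the terms up to equality under the template.  Each class
  is represented by a chosen term, coded as an element of \<open>'u\<close>.
\<close>

definition rep :: "'u struct \<Rightarrow> ('u, 'u) sterm \<Rightarrow> ('u, 'u) sterm" where
  "rep J t = (SOME t'. t' \<in> Terms J \<and> equal_in J t t')"

definition cls :: "'u struct \<Rightarrow> ('u, 'u) sterm \<Rightarrow> 'u" where
  "cls J t = enc (rep J t)"

definition dec :: "'u \<Rightarrow> ('u, 'u) sterm" where
  "dec = inv enc"

lemma rep:
  assumes "t \<in> Terms J"
  shows "rep J t \<in> Terms J" "equal_in J t (rep J t)"
proof -
  have "\<exists>t'. t' \<in> Terms J \<and> equal_in J t t'" using assms by (auto simp: equal_in_def)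
  from someI_ex[OF this] show "rep J t \<in> Terms J" "equal_in J t (rep J t)"
    unfolding rep_def by blast+
qed

lemma Terms_gens: "t \<in> Terms J \<Longrightarrow> gens t \<subseteq> univ J"
  by (simp add: Terms_def)

lemma equal_in_trans:
  assumes J: "J \<in> mem K" and t: "t1 \<in> Terms J" "t2 \<in> Terms J" "t3 \<in> Terms J"
    and "equal_in J t1 t2" "equal_in J t2 t3"
  shows "equal_in J t1 t3"
proof -
  let ?s = "gens t1 \<union> gens t2 \<union> gens t3"
  have s: "finite ?s" "?s \<subseteq> univ J" using t Terms_gens by (auto simp: finite_gens)
  show ?thesis
    using assms(5,6) equal_in_iff[OF J s t(1,2)] equal_in_iff[OF J s t(2,3)] equal_in_iff[OF J s t(1,3)] by auto
qed

lemma equal_in_sym: "equal_in J t t' \<Longrightarrow> equal_in J t' t"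
  by (simp add: equal_in_def Un_commute)

lemma rep_eq_iff:
  assumes J: "J \<in> mem K" and t: "t \<in> Terms J" "t' \<in> Terms J"
  shows "rep J t = rep J t' \<longleftrightarrow> equal_in J t t'"
proof
  assume "rep J t = rep J t'"
  then show "equal_in J t t'"
    using equal_in_trans[OF J t(1) rep(1)[OF t(1)] t(2) rep(2)[OF t(1)]] equal_in_sym[OF rep(2)[OF t(2)]] by simp
next
  assume eq: "equal_in J t t'"
  have "(u \<in> Terms J \<and> equal_in J t u) = (u \<in> Terms J \<and> equal_in J t' u)" for u
    using equal_in_trans[OF J t(1,2), of u] equal_in_trans[OF J t(2,1), of u] eq equal_in_sym[OF eq] by blast
  then show "rep J t = rep J t'" unfolding rep_def by simp
qed

lemma cls_eq_iff:
  assumes "J \<in> mem K" "finite s" "s \<subseteq> univ J" "t \<in> Terms J" "t' \<in> Terms J" "gens t \<subseteq> s" "gens t' \<subseteq> s"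
  shows "cls J t = cls J t' \<longleftrightarrow> ev J s t = ev J s t'"
  unfolding cls_def using enc rep_eq_iff[OF assms(1,4,5)] equal_in_iff[OF assms] by (simp add: inj_eq)

lemma dec_cls: "dec (cls J t) = rep J t"
  unfolding dec_def cls_def using enc by simp

lemma cls_rep: "J \<in> mem K \<Longrightarrow> t \<in> Terms J \<Longrightarrow> cls J (rep J t) = cls J t"
  unfolding cls_def using rep_eq_iff[of J "rep J t" t] rep[of t J] equal_in_sym by simp

definition gen_model :: "'u struct \<Rightarrow> 'u struct" where
  "gen_model J = \<lparr> univ = cls J ` Terms J,
     fn = (\<lambda>c xs. if (c, length xs) \<in> funs L \<and> set xs \<subseteq> cls J ` Terms J
       then cls J (Op (sk_op code c (length xs)) (map dec xs)) else undefined),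
     rl = (\<lambda>c xs. (c, length xs) \<in> rels L \<and> set xs \<subseteq> cls J ` Terms J \<and>
       rl M c (map (ev J (\<Union>x\<in>set xs. gens (dec x))) (map dec xs))) \<rparr>"

lemma dec_Terms: "x \<in> univ (gen_model J) \<Longrightarrow> dec x \<in> Terms J"
  by (auto simp: gen_model_def dec_cls rep)

lemma cls_dec: "J \<in> mem K \<Longrightarrow> x \<in> univ (gen_model J) \<Longrightarrow> cls J (dec x) = x"
  by (auto simp: gen_model_def dec_cls cls_rep)

lemma Op_Terms: "(c, length ts) \<in> funs Ls \<Longrightarrow> set ts \<subseteq> Terms J \<Longrightarrow> Op c ts \<in> Terms J"
  by (auto simp: Terms_def list_all_iff)

text \<open>
  Equality under the template is a congruence for the operations.
\<close>

lemma cls_Op_rep: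
  assumes J: "J \<in> mem K" and c: "(c, length ts) \<in> funs Ls" and ts: "set ts \<subseteq> Terms J"
  shows "cls J (Op c (map (rep J) ts)) = cls J (Op c ts)"
proof -
  let ?t = "Op c ts" and ?t' = "Op c (map (rep J) ts)"
  have t: "?t \<in> Terms J" by (rule Op_Terms[OF c ts])
  have t': "?t' \<in> Terms J" by (rule Op_Terms) (use c ts rep in auto)
  let ?s = "gens ?t \<union> gens ?t'"
  have s: "finite ?s" "?s \<subseteq> univ J" using Terms_gens[OF t] Terms_gens[OF t'] finite_gens[of ?t] finite_gens[of ?t']
    by auto
  have "ev J ?s (rep J u) = ev J ?s u" if u: "u \<in> set ts" for u
  proof -
    have uT: "u \<in> Terms J" using u ts by blast
    have "gens u \<subseteq> ?s" "gens (rep J u) \<subseteq> ?s" using u by auto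
    then show ?thesis using equal_in_iff[OF J s uT rep(1)[OF uT]] rep(2)[OF uT] by simp
  qed
  then have "map (ev J ?s) (map (rep J) ts) = map (ev J ?s) ts" by simp
  then have "ev J ?s ?t' = ev J ?s ?t" unfolding ev_def[abs_def] sval.simps by (rule arg_cong)
  then show ?thesis using cls_eq_iff[OF J s t' t] by blast
qed

lemma gen_model_fn:
  assumes J: "J \<in> mem K" and c: "(c, length ts) \<in> funs L" and ts: "set ts \<subseteq> Terms J"
  shows "fn (gen_model J) c (map (cls J) ts) = cls J (Op (sk_op code c (length ts)) ts)"
proof -
  have "fn (gen_model J) c (map (cls J) ts) = cls J (Op (sk_op code c (length ts)) (map (rep J) ts))"
    using c ts by (auto simp: gen_model_def dec_cls comp_def)
  then show ?thesis using cls_Op_rep[OF J sk_op_in[OF F c] ts] by simp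
qed

lemma gen_model_rl:
  assumes J: "J \<in> mem K" and c: "(c, length ts) \<in> rels L" and s: "finite s" "s \<subseteq> univ J"
    and ts: "\<And>t. t \<in> set ts \<Longrightarrow> t \<in> Terms J \<and> gens t \<subseteq> s"
  shows "rl (gen_model J) c (map (cls J) ts) \<longleftrightarrow> rl M c (map (ev J s) ts)"
proof -
  let ?r = "\<Union>t\<in>set ts. gens (rep J t)"
  let ?u = "?r \<union> s"
  have reps: "rep J t \<in> Terms J" if "t \<in> set ts" for t using rep(1) ts[OF that] by blast
  have u: "finite ?u" "?u \<subseteq> univ J"
    using s Terms_gens[OF reps] by (auto simp: finite_gens)
  have "set (map (cls J) ts) \<subseteq> cls J ` Terms J" using ts by auto
  then have "rl (gen_model J) c (map (cls J) ts) \<longleftrightarrow> rl M c (map (ev J ?r) (map (rep J) ts))"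
    using c by (simp add: gen_model_def dec_cls comp_def)
  also have "\<dots> \<longleftrightarrow> rl M c (map (ev J ?u) (map (rep J) ts))"
    by (rule rl_coherent[OF J u]) (use c reps in auto)
  also have "map (ev J ?u) (map (rep J) ts) = map (ev J ?u) ts"
  proof -
    have "ev J ?u (rep J t) = ev J ?u t" if t: "t \<in> set ts" for t
    proof -
      have tT: "t \<in> Terms J" "gens t \<subseteq> ?u" "gens (rep J t) \<subseteq> ?u" using ts[OF t] t by auto
      show ?thesis using equal_in_iff[OF J u tT(1) rep(1)[OF tT(1)] tT(2,3)] rep(2)[OF tT(1)] by simp
    qed
    then show ?thesis by simp
  qed
  also have "rl M c (map (ev J ?u) ts) \<longleftrightarrow> rl M c (map (ev J s) ts)"
    by (rule rl_coherent[OF J u _ c ts, symmetric]) auto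
  finally show ?thesis .
qed

lemma ev_sk_op:
  assumes J: "J \<in> mem K" and c: "(c, length ts) \<in> funs L" and s: "finite s" "s \<subseteq> univ J"
    and ts: "\<And>t. t \<in> set ts \<Longrightarrow> t \<in> Terms J \<and> gens t \<subseteq> s"
  shows "ev J s (Op (sk_op code c (length ts)) ts) = fn M c (map (ev J s) ts)"
proof -
  have "set (map (ev J s) ts) \<subseteq> univ M" using ev_in[OF J s] ts by auto
  then have "fn Ms (sk_op code c (length ts)) (map (ev J s) ts) = fn M c (map (ev J s) ts)"
    using sk_op_fn[OF F code M M_nonempty, of c "map (ev J s) ts"] c by simp
  then show ?thesis unfolding ev_def[abs_def] sval.simps .
qed

text \<open>
  Terms of the original language evaluated at Skolem terms are again Skolem terms over the same
  generators, and their values in \<open>M\<close> correspond.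
\<close>

lemma gen_model_tval:
  assumes J: "J \<in> mem K" and s: "finite s" "s \<subseteq> univ J"
  shows "wf_trm L u \<Longrightarrow> (\<And>k. k \<in> tvars u \<Longrightarrow> v k \<in> Terms J \<and> gens (v k) \<subseteq> s) \<Longrightarrow>
    \<exists>t. t \<in> Terms J \<and> gens t \<subseteq> s \<and> tval (gen_model J) (cls J \<circ> v) u = cls J t \<and> ev J s t = tval M (ev J s \<circ> v) u"
proof (induction u)
  case (Var k)
  then show ?case by (intro exI[of _ "v k"]) simp
next
  case (App c us)
  have "\<forall>u\<in>set us. \<exists>t. t \<in> Terms J \<and> gens t \<subseteq> s \<and> tval (gen_model J) (cls J \<circ> v) u = cls J t \<and>
      ev J s t = tval M (ev J s \<circ> v) u"
  proof
    fix u assume u: "u \<in> set us"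
    show "\<exists>t. t \<in> Terms J \<and> gens t \<subseteq> s \<and> tval (gen_model J) (cls J \<circ> v) u = cls J t \<and>
      ev J s t = tval M (ev J s \<circ> v) u"
      by (rule App.IH[OF u]) (use App.prems u in \<open>auto simp: list_all_iff\<close>)
  qed
  from bchoice[OF this] obtain g where g: "\<forall>u\<in>set us. g u \<in> Terms J \<and> gens (g u) \<subseteq> s \<and>
      tval (gen_model J) (cls J \<circ> v) u = cls J (g u) \<and> ev J s (g u) = tval M (ev J s \<circ> v) u"
    by (rule exE)
  let ?ts = "map g us"
  let ?t = "Op (sk_op code c (length ?ts)) ?ts"
  have c: "(c, length ?ts) \<in> funs L" using App.prems(1) by simp
  have ts: "\<And>t. t \<in> set ?ts \<Longrightarrow> t \<in> Terms J \<and> gens t \<subseteq> s" using g by auto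
  have 1: "map (tval (gen_model J) (cls J \<circ> v)) us = map (cls J) ?ts" using g by simp
  have 2: "map (ev J s) ?ts = map (tval M (ev J s \<circ> v)) us" using g by simp
  have "?t \<in> Terms J" by (rule Op_Terms[OF sk_op_in[OF F c]]) (use ts in auto)
  moreover have "gens ?t \<subseteq> s" using ts by auto
  moreover have "tval (gen_model J) (cls J \<circ> v) (App c us) = cls J ?t"
    unfolding tval.simps 1 by (rule gen_model_fn[OF J c]) (use ts in auto)
  moreover have "ev J s ?t = tval M (ev J s \<circ> v) (App c us)"
    unfolding tval.simps 2[symmetric] by (rule ev_sk_op[OF J c s ts])
  ultimately show ?case by blast
qed

text \<open>
  The analogue of Los's theorem.  In the quantifier step a witness in \<open>M\<close> is the value of a Skolem
  term, so that it is present in the generated model, and conversely a witness in the generated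
  model is a term over finitely many further generators, which coherence allows to be discarded.
\<close>

lemma gen_model_sat:
  assumes J: "J \<in> mem K"
  shows "\<phi> \<in> \<F> \<Longrightarrow> finite s \<Longrightarrow> s \<subseteq> univ J \<Longrightarrow> (\<And>k. k \<in> fv \<phi> \<Longrightarrow> v k \<in> Terms J \<and> gens (v k) \<subseteq> s) \<Longrightarrow>
    sat (gen_model J) \<phi> (cls J \<circ> v) \<longleftrightarrow> sat M \<phi> (ev J s \<circ> v)"
proof (induction \<phi> arbitrary: s v)
  case (Eq a b)
  have wf: "wf_trm L a" "wf_trm L b" using fragment_wf[OF F Eq(1)] by auto
  obtain t where t: "t \<in> Terms J" "gens t \<subseteq> s" "tval (gen_model J) (cls J \<circ> v) a = cls J t"
      "ev J s t = tval M (ev J s \<circ> v) a"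
    using gen_model_tval[OF J Eq(2,3) wf(1), of v] Eq(4) by auto
  obtain t' where t': "t' \<in> Terms J" "gens t' \<subseteq> s" "tval (gen_model J) (cls J \<circ> v) b = cls J t'"
      "ev J s t' = tval M (ev J s \<circ> v) b"
    using gen_model_tval[OF J Eq(2,3) wf(2), of v] Eq(4) by auto
  show ?case
    unfolding sat.simps t(3) t'(3) t(4)[symmetric] t'(4)[symmetric]
    by (rule cls_eq_iff[OF J Eq(2,3) t(1) t'(1) t(2) t'(2)])
next
  case (Rel c us)
  have wf: "(c, length us) \<in> rels L" "\<forall>u\<in>set us. wf_trm L u"
    using fragment_wf[OF F Rel(1)] by (auto simp: list_all_iff)
  have "\<forall>u\<in>set us. \<exists>t. t \<in> Terms J \<and> gens t \<subseteq> s \<and> tval (gen_model J) (cls J \<circ> v) u = cls J t \<and>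
      ev J s t = tval M (ev J s \<circ> v) u"
  proof
    fix u assume u: "u \<in> set us"
    show "\<exists>t. t \<in> Terms J \<and> gens t \<subseteq> s \<and> tval (gen_model J) (cls J \<circ> v) u = cls J t \<and>
      ev J s t = tval M (ev J s \<circ> v) u"
      by (rule gen_model_tval[OF J Rel(2,3)]) (use wf(2) Rel(4) u in auto)
  qed
  from bchoice[OF this] obtain g where g: "\<forall>u\<in>set us. g u \<in> Terms J \<and> gens (g u) \<subseteq> s \<and>
      tval (gen_model J) (cls J \<circ> v) u = cls J (g u) \<and> ev J s (g u) = tval M (ev J s \<circ> v) u"
    by (rule exE)
  let ?ts = "map g us"
  have 1: "map (tval (gen_model J) (cls J \<circ> v)) us = map (cls J) ?ts" using g by simp
  have 2: "map (tval M (ev J s \<circ> v)) us = map (ev J s) ?ts" using g by simp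
  show ?case
    unfolding sat.simps 1 2 by (rule gen_model_rl[OF J _ Rel(2,3)]) (use wf(1) g in auto)
next
  case (Neg \<phi>)
  have "sat (gen_model J) \<phi> (cls J \<circ> v) \<longleftrightarrow> sat M \<phi> (ev J s \<circ> v)"
    by (rule Neg.IH) (use Neg.prems fragment_sub(1)[OF F] in auto)
  then show ?case unfolding sat.simps by blast
next
  case (And \<phi> \<psi>)
  have "sat (gen_model J) \<phi> (cls J \<circ> v) \<longleftrightarrow> sat M \<phi> (ev J s \<circ> v)"
    by (rule And.IH(1)) (use And.prems fragment_sub(2)[OF F] in auto)
  moreover have "sat (gen_model J) \<psi> (cls J \<circ> v) \<longleftrightarrow> sat M \<psi> (ev J s \<circ> v)"
    by (rule And.IH(2)) (use And.prems fragment_sub(2)[OF F] in auto)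
  ultimately show ?case unfolding sat.simps by blast
next
  case (Conj I g)
  have "sat (gen_model J) (g i) (cls J \<circ> v) \<longleftrightarrow> sat M (g i) (ev J s \<circ> v)" if "i \<in> I" for i
    by (rule Conj.IH) (use Conj.prems fragment_sub(4)[OF F _ that] that in auto)
  then show ?case unfolding sat.simps by blast
next
  case (Ex x \<phi>)
  have \<phi>: "\<phi> \<in> \<F>" using Ex.prems(1) fragment_sub(3)[OF F] by blast
  note fin = fragment_finite_fv[OF F Ex.prems(1)]
  have upd: "cls J \<circ> v(x := t) = (cls J \<circ> v)(x := cls J t)" "ev J r \<circ> v(x := t) = (ev J r \<circ> v)(x := ev J r t)"
    for t r by auto
  have ev_v: "(ev J s \<circ> v) ` fv (Ex x \<phi>) \<subseteq> univ M"
  proof (rule image_subsetI)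
    fix k assume "k \<in> fv (Ex x \<phi>)"
    from Ex.prems(4)[OF this] show "(ev J s \<circ> v) k \<in> univ M"
      using ev_in[OF J Ex.prems(2,3)] by simp
  qed
  show ?case
  proof
    assume "sat (gen_model J) (Ex x \<phi>) (cls J \<circ> v)"
    then obtain t where t: "t \<in> Terms J" "sat (gen_model J) \<phi> (cls J \<circ> v(x := t))"
      unfolding sat.simps upd by (auto simp: gen_model_def)
    let ?r = "s \<union> gens t"
    have r: "finite ?r" "?r \<subseteq> univ J" using Ex.prems(2,3) Terms_gens[OF t(1)] by (auto simp: finite_gens)
    have "sat (gen_model J) \<phi> (cls J \<circ> v(x := t)) \<longleftrightarrow> sat M \<phi> (ev J ?r \<circ> v(x := t))"
    proof (rule Ex.IH[OF \<phi> r])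
      fix k assume "k \<in> fv \<phi>"
      then show "(v(x := t)) k \<in> Terms J \<and> gens ((v(x := t)) k) \<subseteq> ?r"
        using Ex.prems(4)[of k] t(1) by (cases "k = x") auto
    qed
    then have "sat M \<phi> ((ev J ?r \<circ> v)(x := ev J ?r t))" using t(2) unfolding upd by blast
    moreover have "ev J ?r t \<in> univ M" by (rule ev_in[OF J r t(1)]) auto
    ultimately have "sat M (Ex x \<phi>) (ev J ?r \<circ> v)" unfolding sat.simps by blast
    moreover have "sat M (Ex x \<phi>) (ev J s \<circ> v) \<longleftrightarrow> sat M (Ex x \<phi>) (ev J ?r \<circ> v)"
      by (rule sat_coherent[OF J r _ Ex.prems(1) Ex.prems(4)]) auto
    ultimately show "sat M (Ex x \<phi>) (ev J s \<circ> v)" by blast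
  next
    assume sat: "sat M (Ex x \<phi>) (ev J s \<circ> v)"
    let ?ts = "map v (args (Ex x \<phi>))"
    let ?t = "Op (code (Ex x \<phi>)) ?ts"
    have ts: "t \<in> Terms J \<and> gens t \<subseteq> s" if "t \<in> set ?ts" for t
      using that Ex.prems(4) unfolding set_map set_args[OF fin] by blast
    have "(code (Ex x \<phi>), card (fv (Ex x \<phi>))) \<in> funs Ls"
      unfolding sk_lang_def using Ex.prems(1) by auto
    then have "(code (Ex x \<phi>), length ?ts) \<in> funs Ls"
      by (simp only: length_map length_args[OF fin])
    then have t: "?t \<in> Terms J" by (rule Op_Terms) (use ts in blast)
    have ts_s: "gens ?t \<subseteq> s" using ts by auto
    have "ev J s ?t = fn Ms (code (Ex x \<phi>)) (map (ev J s \<circ> v) (args (Ex x \<phi>)))"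
      unfolding ev_def[abs_def] sval.simps map_map ..
    then have "sat M \<phi> ((ev J s \<circ> v)(x := ev J s ?t))"
      using sk_struct_fn[OF F code Ex.prems(1) ev_v M_nonempty sat] by simp
    then have "sat M \<phi> (ev J s \<circ> v(x := ?t))" unfolding upd .
    moreover have "sat (gen_model J) \<phi> (cls J \<circ> v(x := ?t)) \<longleftrightarrow> sat M \<phi> (ev J s \<circ> v(x := ?t))"
    proof (rule Ex.IH[OF \<phi> Ex.prems(2,3)])
      fix k assume "k \<in> fv \<phi>"
      then show "(v(x := ?t)) k \<in> Terms J \<and> gens ((v(x := ?t)) k) \<subseteq> s"
        using Ex.prems(4)[of k] t ts_s by (cases "k = x") auto
    qed
    ultimately have "sat (gen_model J) \<phi> ((cls J \<circ> v)(x := cls J ?t))" unfolding upd by blast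
    then show "sat (gen_model J) (Ex x \<phi>) (cls J \<circ> v)"
      unfolding sat.simps using t by (auto simp: gen_model_def)
  qed
qed

lemma gen_model_struct:
  assumes J: "J \<in> mem K"
  shows "is_struct L (gen_model J)"
proof -
  have "small_lang Ls" by (rule small_sk_lang[OF U F])
  then have "small TYPE('u) (funs Ls)"
    using small_inj_on[of Inl "funs Ls" "funs Ls <+> rels Ls"] unfolding small_lang_def lang_card_def small_def by auto
  then have "small TYPE('u) {t. syms t \<subseteq> fst ` funs Ls \<and> gens t \<subseteq> univ J}"
    by (rule small_sterms[OF U small_image struct_small[OF class_struct[OF K J]]])
  then have "small TYPE('u) (Terms J)"
    by (rule small_subset) (auto simp: Terms_def dest: wf_sterm_syms)
  then have small: "small TYPE('u) (univ (gen_model J))" by (simp add: gen_model_def small_image)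
  have closed: "fn (gen_model J) c xs \<in> univ (gen_model J)"
    if "(c, length xs) \<in> funs L" "set xs \<subseteq> univ (gen_model J)" for c xs
  proof -
    have "set (map dec xs) \<subseteq> Terms J" using that(2) dec_Terms by auto
    then have "Op (sk_op code c (length xs)) (map dec xs) \<in> Terms J"
      using Op_Terms[of _ "map dec xs"] sk_op_in[OF F that(1)] by simp
    then show ?thesis using that by (simp add: gen_model_def)
  qed
  have undef: "fn (gen_model J) c xs = undefined"
    if "\<not> ((c, length xs) \<in> funs L \<and> set xs \<subseteq> univ (gen_model J))" for c xs
    using that by (auto simp: gen_model_def)
  have rels: "(c, length xs) \<in> rels L \<and> set xs \<subseteq> univ (gen_model J)" if "rl (gen_model J) c xs" for c xs
    using that by (simp add: gen_model_def)
  show ?thesis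
    unfolding is_struct_def
  proof (intro conjI allI impI small)
    fix c xs
    show "if (c, length xs) \<in> funs L \<and> set xs \<subseteq> univ (gen_model J)
      then fn (gen_model J) c xs \<in> univ (gen_model J) else fn (gen_model J) c xs = undefined"
      unfolding if_bool_eq_conj using closed[of c xs] undef[of c xs] by blast
  qed (use rels in blast)+
qed

lemma gen_model_models:
  assumes J: "J \<in> mem K" and T: "is_theory L T" "T \<subseteq> \<F>" and MT: "M \<in> models L T"
  shows "gen_model J \<in> models L T"
proof -
  have "sat (gen_model J) \<phi> v" if "\<phi> \<in> T" for \<phi> v
  proof -
    have \<phi>: "\<phi> \<in> \<F>" "fv \<phi> = {}" using T that unfolding is_theory_def by auto
    let ?w = "\<lambda>_. Gen undefined :: ('u, 'u) sterm"
    have "sat M \<phi> (ev J {} \<circ> ?w)" using MT that unfolding models_def by blast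
    then have "sat (gen_model J) \<phi> (cls J \<circ> ?w)"
      using gen_model_sat[OF J \<phi>(1), of "{}" ?w] \<phi>(2) by simp
    moreover have "sat (gen_model J) \<phi> (cls J \<circ> ?w) \<longleftrightarrow> sat (gen_model J) \<phi> v"
      by (rule sat_cong) (simp add: \<phi>(2))
    ultimately show ?thesis by blast
  qed
  then show ?thesis using gen_model_struct[OF J] unfolding models_def by blast
qed

text \<open>
  A \<open>K\<close>-embedding acts on terms by renaming the generators.  Defined for every function \<open>f\<close>, through the
  chosen representatives, so that composites can be computed on terms directly.
\<close>

definition gen_map :: "'u struct \<Rightarrow> 'u struct \<Rightarrow> ('u \<Rightarrow> 'u) \<Rightarrow> 'u \<Rightarrow> 'u" where
  "gen_map J J' f = (\<lambda>x\<in>univ (gen_model J). cls J' (map_sterm id f (dec x)))"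

lemma map_Terms:
  "K_embedding K J J' f \<Longrightarrow> t \<in> Terms J \<Longrightarrow> map_sterm id f t \<in> Terms J'"
  using K_embedding_into[of K J J' f] by (auto simp: Terms_def wf_sterm_map sterm.set_map)

lemma cls_in: "t \<in> Terms J \<Longrightarrow> cls J t \<in> univ (gen_model J)"
  by (simp add: gen_model_def)

text \<open>
  Independence of the representing term: \<open>\<sigma>\<close> is invariant under \<open>f\<close>, so that terms that are equal over \<open>J\<close>
  have images that are equal over \<open>J'\<close>.
\<close>

lemma gen_map_cls:
  assumes J: "J \<in> mem K" "J' \<in> mem K" and f: "K_embedding K J J' f" and t: "t \<in> Terms J"
  shows "gen_map J J' f (cls J t) = cls J' (map_sterm id f t)"
proof -
  let ?s = "gens t \<union> gens (rep J t)"
  note r = rep(1)[OF t]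
  have s: "finite ?s" "?s \<subseteq> univ J" using Terms_gens[OF t] Terms_gens[OF r] by (auto simp: finite_gens)
  have "ev J ?s t = ev J ?s (rep J t)" using rep(2)[OF t] by (simp add: equal_in_def)
  then have "ev J' (f ` ?s) (map_sterm id f t) = ev J' (f ` ?s) (map_sterm id f (rep J t))"
    using ev_natural[OF J f s, of t] ev_natural[OF J f s, of "rep J t"] by simp
  moreover have "finite (f ` ?s)" "f ` ?s \<subseteq> univ J'" using s K_embedding_into[OF f] by blast+
  moreover have "gens (map_sterm id f t) \<subseteq> f ` ?s" "gens (map_sterm id f (rep J t)) \<subseteq> f ` ?s"
    by (auto simp: sterm.set_map)
  ultimately have "cls J' (map_sterm id f t) = cls J' (map_sterm id f (rep J t))"
    using cls_eq_iff[OF J(2) _ _ map_Terms[OF f t] map_Terms[OF f r]] by blast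
  then show ?thesis using cls_in[OF t] by (simp add: gen_map_def dec_cls)
qed

lemma gen_map_into:
  assumes "J \<in> mem K" "J' \<in> mem K" "K_embedding K J J' f"
  shows "gen_map J J' f ` univ (gen_model J) \<subseteq> univ (gen_model J')"
  using cls_in map_Terms[OF assms(3)] dec_Terms unfolding gen_map_def by auto

lemma gen_map_elementary:
  assumes J: "J \<in> mem K" "J' \<in> mem K" and f: "K_embedding K J J' f"
  shows "elementary \<F> (gen_model J) (gen_model J') (gen_map J J' f)"
  unfolding elementary_def
proof (intro ballI allI impI)
  fix \<phi> v assume \<phi>: "\<phi> \<in> \<F>" and v: "v ` fv \<phi> \<subseteq> univ (gen_model J)"
  note fin = fragment_finite_fv[OF F \<phi>]
  define w where "w = dec \<circ> v"
  let ?s = "\<Union>k\<in>fv \<phi>. gens (w k)"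
  have w: "w k \<in> Terms J" "cls J (w k) = v k" if "k \<in> fv \<phi>" for k
    using v that dec_Terms[of "v k" J] cls_dec[OF J(1), of "v k"] by (auto simp: w_def)
  have s: "finite ?s" "?s \<subseteq> univ J" using fin w(1) Terms_gens by (auto simp: finite_gens)
  have fs: "finite (f ` ?s)" "f ` ?s \<subseteq> univ J'" using s K_embedding_into[OF f] by blast+
  let ?w' = "\<lambda>k. map_sterm id f (w k)"
  have "sat (gen_model J) \<phi> v \<longleftrightarrow> sat (gen_model J) \<phi> (cls J \<circ> w)"
    by (rule sat_cong) (simp add: w(2))
  also have "\<dots> \<longleftrightarrow> sat M \<phi> (ev J ?s \<circ> w)"
    by (rule gen_model_sat[OF J(1) \<phi> s]) (use w(1) in auto)
  also have "\<dots> \<longleftrightarrow> sat M \<phi> (ev J' (f ` ?s) \<circ> ?w')"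
  proof (rule sat_cong)
    fix k assume "k \<in> fv \<phi>"
    then have "gens (w k) \<subseteq> ?s" by blast
    then show "(ev J ?s \<circ> w) k = (ev J' (f ` ?s) \<circ> ?w') k" using ev_natural[OF J f s] by simp
  qed
  also have "\<dots> \<longleftrightarrow> sat (gen_model J') \<phi> (cls J' \<circ> ?w')"
    by (rule gen_model_sat[OF J(2) \<phi> fs, symmetric]) (use map_Terms[OF f w(1)] in \<open>auto simp: sterm.set_map\<close>)
  also have "\<dots> \<longleftrightarrow> sat (gen_model J') \<phi> (gen_map J J' f \<circ> v)"
    by (rule sat_cong) (simp add: gen_map_cls[OF J f w(1)] w(2)[symmetric])
  finally show "sat (gen_model J) \<phi> v \<longleftrightarrow> sat (gen_model J') \<phi> (gen_map J J' f \<circ> v)" .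
qed

definition gen_ftor :: "('u struct, 'u \<Rightarrow> 'u, 'u struct, 'u \<Rightarrow> 'u) ftor" where
  "gen_ftor = \<lparr> omap = gen_model, amap = gen_map \<rparr>"

lemma map_sterm_cong_gens: "(\<And>x. x \<in> gens t \<Longrightarrow> f x = g x) \<Longrightarrow> map_sterm id f t = map_sterm id g t"
  by (rule sterm.map_cong) auto

lemma gen_ftor_functor:
  assumes T: "is_theory L T" "T \<subseteq> \<F>" and MT: "M \<in> models L T"
  shows "is_functor (class_cat K) (model_cat L T \<F>) gen_ftor"
  unfolding is_functor_def gen_ftor_def ftor.simps class_cat_simps model_cat_simps
proof (intro conjI ballI)
  fix J assume J: "J \<in> mem K"
  show "gen_model J \<in> models L T" by (rule gen_model_models[OF J T MT])
  show "gen_map J J (restrict id (univ J)) = restrict id (univ (gen_model J))"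
  proof
    fix x
    have "map_sterm id (restrict id (univ J)) (dec x) = dec x" if x: "x \<in> univ (gen_model J)"
    proof -
      have "map_sterm id (restrict id (univ J)) (dec x) = map_sterm id id (dec x)"
        by (rule map_sterm_cong_gens) (use Terms_gens[OF dec_Terms[OF x]] in auto)
      then show ?thesis by (simp add: sterm.map_id)
    qed
    then show "gen_map J J (restrict id (univ J)) x = restrict id (univ (gen_model J)) x"
      using cls_dec[OF J, of x] by (simp add: gen_map_def)
  qed
next
  fix J J' f assume J: "J \<in> mem K" "J' \<in> mem K" and "f \<in> hom (class_cat K) J J'"
  then have f: "K_embedding K J J' f" by (simp add: class_cat_simps)
  show "gen_map J J' f \<in> hom (model_cat L T \<F>) (gen_model J) (gen_model J')"
    unfolding model_hom[OF F gen_model_models[OF J(1) T MT]]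
    using gen_map_into[OF J f] gen_map_elementary[OF J f] by (simp add: gen_map_def)
next
  fix J J' J'' f g assume J: "J \<in> mem K" "J' \<in> mem K" "J'' \<in> mem K"
    and "f \<in> hom (class_cat K) J J'" "g \<in> hom (class_cat K) J' J''"
  then have f: "K_embedding K J J' f" and g: "K_embedding K J' J'' g" by (simp_all add: class_cat_simps)
  show "gen_map J J'' (compose (univ J) g f) = compose (univ (gen_model J)) (gen_map J' J'' g) (gen_map J J' f)"
  proof
    fix x
    show "gen_map J J'' (compose (univ J) g f) x = compose (univ (gen_model J)) (gen_map J' J'' g) (gen_map J J' f) x"
    proof (cases "x \<in> univ (gen_model J)")
      case True
      note x = dec_Terms[OF True]
      have "map_sterm id (compose (univ J) g f) (dec x) = map_sterm id (g \<circ> f) (dec x)"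
        by (rule map_sterm_cong_gens) (use Terms_gens[OF x] in \<open>auto simp: compose_def\<close>)
      also have "\<dots> = map_sterm id g (map_sterm id f (dec x))" by (simp add: sterm.map_comp)
      finally have eq: "map_sterm id (compose (univ J) g f) (dec x) = map_sterm id g (map_sterm id f (dec x))" .
      have "compose (univ (gen_model J)) (gen_map J' J'' g) (gen_map J J' f) x =
          gen_map J' J'' g (cls J' (map_sterm id f (dec x)))"
        using True by (simp add: compose_def gen_map_def)
      also have "\<dots> = cls J'' (map_sterm id g (map_sterm id f (dec x)))"
        by (rule gen_map_cls[OF J(2,3) g map_Terms[OF f x]])
      finally show ?thesis using True eq by (simp add: gen_map_def)
    qed (simp add: gen_map_def compose_def)
  qed
qed

text \<open>
  The generators are distinct elements of the generated model because \<open>\<sigma>\<close> is injective, and the induced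
  map sends the generator \<open>x\<close> to the generator \<open>f x\<close>.
\<close>

lemma gen_ftor_faithful: "faithful (class_cat K) gen_ftor"
  unfolding faithful_def gen_ftor_def ftor.simps class_cat_simps
proof (intro ballI inj_onI)
  fix J J' f g assume J: "J \<in> mem K" "J' \<in> mem K" and fh: "f \<in> hom (class_cat K) J J'"
    and gh: "g \<in> hom (class_cat K) J J'" and eq: "gen_map J J' f = gen_map J J' g"
  have f: "f \<in> extensional (univ J)" "K_embedding K J J' f" and g: "g \<in> extensional (univ J)" "K_embedding K J J' g"
    using fh gh by (simp_all add: class_cat_simps)
  show "f = g"
  proof (rule extensionalityI[OF f(1) g(1)])
    fix x assume x: "x \<in> univ J"
    have t: "Gen x \<in> Terms J" using x by (simp add: Terms_def)
    have "cls J' (Gen (f x)) = cls J' (Gen (g x))"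
      using gen_map_cls[OF J f(2) t] gen_map_cls[OF J g(2) t] eq by simp
    moreover have s: "finite {f x, g x}" "{f x, g x} \<subseteq> univ J'"
      using x K_embedding_into[OF f(2)] K_embedding_into[OF g(2)] by auto
    moreover have "Gen (f x) \<in> Terms J'" "Gen (g x) \<in> Terms J'" using s by (simp_all add: Terms_def)
    ultimately have "ev J' {f x, g x} (Gen (f x)) = ev J' {f x, g x} (Gen (g x))"
      using cls_eq_iff[OF J(2) s, of "Gen (f x)" "Gen (g x)"] by simp
    then have "\<sigma> J' {f x, g x} (f x) = \<sigma> J' {f x, g x} (g x)" by (simp add: ev_def)
    then show "f x = g x" by (rule inj_onD[OF \<sigma>_inj[OF J(2) s]]) simp_all
  qed
qed

text \<open>
  A term has finitely many generators; if \<open>X\<close> is the directed union of the images of the \<open>D i\<close>, they all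
  lie in one of these images, so that the images of the generated models cover.
\<close>

lemma gen_ftor_directed_union:
  assumes T: "is_theory L T" "T \<subseteq> \<F>" and MT: "M \<in> models L T" and union: "is_directed_union P r K D X \<iota>"
  shows "is_directed_colimit P r (model_cat L T \<F>) (comp_ftor gen_ftor D) (omap gen_ftor X)
    (\<lambda>i. amap gen_ftor (omap D i) X (\<iota> i))"
proof -
  have P: "small TYPE('u) P" and dir: "directed_poset P r"
    and D: "is_functor (poset_cat P r) (class_cat K) D"
    and cocone: "is_cocone (poset_cat P r) (class_cat K) D X \<iota>"
    and univ_X: "univ X = (\<Union>i\<in>P. \<iota> i ` univ (omap D i))"
    using union unfolding is_directed_union_def is_directed_colimit_def is_colimit_def by simp_all
  note G = gen_ftor_functor[OF T MT]
  note X = class_cocone(1)[OF dir D cocone] and Di = class_cocone(2)[OF dir D cocone]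
    and \<iota> = class_cocone(4)[OF dir D cocone] and mono = class_cocone(6)[OF dir D cocone]
  have "\<exists>i\<in>P. x \<in> gen_map (omap D i) X (\<iota> i) ` univ (gen_model (omap D i))" if x: "x \<in> univ (gen_model X)" for x
  proof -
    note t = dec_Terms[OF x]
    obtain i where i: "i \<in> P" "gens (dec x) \<subseteq> \<iota> i ` univ (omap D i)"
      using directed_finite_subset[where S = "gens (dec x)" and A = "\<lambda>i. \<iota> i ` univ (omap D i)", OF dir mono]
        Terms_gens[OF t] finite_gens unfolding univ_X by blast
    let ?g = "inv_into (univ (omap D i)) (\<iota> i)"
    let ?t = "map_sterm id ?g (dec x)"
    have "map_sterm id (\<iota> i) ?t = map_sterm id (\<iota> i \<circ> ?g) (dec x)" by (simp add: sterm.map_comp)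
    also have "\<dots> = map_sterm id id (dec x)"
    proof (rule map_sterm_cong_gens)
      fix a assume "a \<in> gens (dec x)"
      then have "a \<in> \<iota> i ` univ (omap D i)" using i(2) by blast
      then show "(\<iota> i \<circ> ?g) a = id a" by (simp add: f_inv_into_f)
    qed
    finally have eq: "map_sterm id (\<iota> i) ?t = dec x" by (simp add: sterm.map_id)
    have tT: "?t \<in> Terms (omap D i)"
      using t i(2) inv_into_into[of _ "\<iota> i" "univ (omap D i)"] by (auto simp: Terms_def wf_sterm_map sterm.set_map)
    have "gen_map (omap D i) X (\<iota> i) (cls (omap D i) ?t) = x"
      using gen_map_cls[OF Di[OF i(1)] X \<iota>[OF i(1)] tT] eq cls_dec[OF X x] by simp
    then show ?thesis using i(1) cls_in[OF tT] by (metis image_eqI)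
  qed
  then have "is_colimit (poset_cat P r) (model_cat L T \<F>) (comp_ftor gen_ftor D) (omap gen_ftor X)
      (\<lambda>i. amap gen_ftor (omap D i) X (\<iota> i))"
    by (intro covering_cocone_colimit[OF F dir functor_comp[OF D G] functor_cocone[OF G D cocone]])
      (auto simp: gen_ftor_def comp_ftor_def)
  then show ?thesis using P dir functor_comp[OF D G] unfolding is_directed_colimit_def by simp
qed

end

section \<open>Directed colimits in an axiomatizable class\<close>

lemma K_embedding_cong:
  assumes M: "is_struct (clang K) M" and f: "K_embedding K M N f" and eq: "\<And>x. x \<in> univ M \<Longrightarrow> f x = g x"
  shows "K_embedding K M N g"
proof -
  have map: "map g xs = map f xs" if "set xs \<subseteq> univ M" for xs
    using eq that by (auto simp: subset_iff)
  have im: "g ` univ M = f ` univ M" using eq by (auto simp: image_iff)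
  have inj: "inj_on g (univ M)" using f eq unfolding K_embedding_def embedding_def by (simp cong: inj_on_cong)
  have fn: "g (fn M c xs) = fn N c (map g xs)"
    if "(c, length xs) \<in> funs (clang K)" "set xs \<subseteq> univ M" for c xs
    unfolding map[OF that(2)] using f eq[OF struct_fn_closed[OF M that]] that
    unfolding K_embedding_def embedding_def homomorphism_def by metis
  have rl: "rl M c xs \<longleftrightarrow> rl N c (map g xs)"
    if "(c, length xs) \<in> rels (clang K)" "set xs \<subseteq> univ M" for c xs
    unfolding map[OF that(2)] using f that
    unfolding K_embedding_def embedding_def homomorphism_def by blast
  have into: "g ` univ M \<subseteq> univ N" unfolding im by (rule K_embedding_into[OF f])
  have "embedding (clang K) M N g"
    unfolding embedding_def homomorphism_def
    by (intro conjI allI impI inj into; elim conjE) (simp_all only: fn rl)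
  then show ?thesis using f unfolding K_embedding_def im by simp
qed

lemma embedding_into_super:
  assumes f: "embedding L M V f" and sub: "substruct V N"
  shows "embedding L M N f"
proof -
  have inj: "inj_on f (univ M)" and im: "f ` univ M \<subseteq> univ V" and hom: "homomorphism L M V f"
    using f by (auto simp: embedding_def homomorphism_def)
  have into: "f ` univ M \<subseteq> univ N" using im substruct_subset[OF sub] by blast
  have V: "set (map f xs) \<subseteq> univ V" if "set xs \<subseteq> univ M" for xs
    unfolding set_map using im image_mono[OF that, of f] by blast
  have fn: "f (fn M c xs) = fn N c (map f xs)" if "(c, length xs) \<in> funs L" "set xs \<subseteq> univ M" for c xs
    using hom_fn[OF hom that] substruct_fn[OF sub V[OF that(2)]] by simp
  have rl: "rl M c xs \<longleftrightarrow> rl N c (map f xs)" if "(c, length xs) \<in> rels L" "set xs \<subseteq> univ M" for c xs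
    using f that substruct_rl[OF sub V[OF that(2)], of c] unfolding embedding_def homomorphism_def by blast
  show ?thesis
    unfolding embedding_def homomorphism_def
    by (intro conjI allI impI inj into; elim conjE) (simp_all only: fn rl)
qed

lemma induced_struct:
  fixes L :: "'u lang"
  assumes X: "is_struct L X" and A: "A \<subseteq> univ X"
    and closed: "\<And>c xs. (c, length xs) \<in> funs L \<Longrightarrow> set xs \<subseteq> A \<Longrightarrow> fn X c xs \<in> A"
  shows "is_struct L (induced X A)"
proof -
  have "small TYPE('u) A" by (rule small_subset[OF struct_small[OF X] A])
  moreover have "fn (induced X A) c xs \<in> A" if "(c, length xs) \<in> funs L" "set xs \<subseteq> A" for c xs
    using closed that by (simp add: induced_simps)
  moreover have "fn (induced X A) c xs = undefined" if "\<not> ((c, length xs) \<in> funs L \<and> set xs \<subseteq> A)" for c xs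
    using that struct_fn_undefined[OF X, of c xs] by (auto simp: induced_simps)
  moreover have "(c, length xs) \<in> rels L \<and> set xs \<subseteq> A" if "rl (induced X A) c xs" for c xs
    using that struct_rl[OF X, of c xs] by (simp add: induced_simps)
  ultimately show ?thesis unfolding is_struct_def if_bool_eq_conj induced_simps(1) by blast
qed

lemma induced_induced: "B \<subseteq> A \<Longrightarrow> induced (induced X A) B = induced X B"
  unfolding induced_def by (auto simp: fun_eq_iff)

lemma elementary_id_sat:
  "elementary \<F> M N id \<Longrightarrow> \<phi> \<in> \<F> \<Longrightarrow> v ` fv \<phi> \<subseteq> univ M \<Longrightarrow> sat M \<phi> v \<longleftrightarrow> sat N \<phi> v"
  using elementaryD[of \<F> M N id \<phi> v] by simp

text \<open>
  The Tarski--Vaught argument: the finitely many parameters of an existential formula lie in a single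
  \<open>A i\<close>, and its elementarity in \<open>X\<close> provides a witness there.
\<close>

lemma directed_union_elementary:
  assumes F: "fragment L \<F>" and X: "is_struct L X" and dir: "directed_poset P r"
    and mono: "\<And>i j. (i, j) \<in> r \<Longrightarrow> A i \<subseteq> A j" and A: "\<And>i. i \<in> P \<Longrightarrow> A i \<subseteq> univ X"
    and A_struct: "\<And>i. i \<in> P \<Longrightarrow> is_struct L (induced X (A i))"
    and el: "\<And>i. i \<in> P \<Longrightarrow> elementary \<F> (induced X (A i)) X id"
  shows "is_struct L (induced X (\<Union>i\<in>P. A i))" and "elementary \<F> (induced X (\<Union>i\<in>P. A i)) X id"
proof -
  let ?B = "\<Union>i\<in>P. A i"
  let ?V = "induced X ?B"
  have fin: "\<exists>i\<in>P. S \<subseteq> A i" if "finite S" "S \<subseteq> ?B" for S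
    by (rule directed_finite_subset[OF dir mono that])
  have B: "?B \<subseteq> univ X" using A by blast
  show V: "is_struct L ?V"
  proof (rule induced_struct[OF X B])
    fix c xs assume c: "(c, length xs) \<in> funs L" and xs: "set xs \<subseteq> ?B"
    obtain i where i: "i \<in> P" "set xs \<subseteq> A i" using fin[OF _ xs] by blast
    have "fn (induced X (A i)) c xs \<in> A i"
      using struct_fn_closed[OF A_struct[OF i(1)] c] i(2) by (simp add: induced_simps)
    then show "fn X c xs \<in> ?B" using i by (auto simp: induced_simps)
  qed
  have sub: "substruct ?V X" using B by (simp add: substruct_def induced_simps(1))
  then have hom: "homomorphism L ?V X id" using substruct_embedding[of ?V X L] unfolding embedding_def by blast
  have "sat ?V \<phi> v \<longleftrightarrow> sat X \<phi> v" if "\<phi> \<in> \<F>" "v ` fv \<phi> \<subseteq> ?B" for \<phi> v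
    using that
  proof (induction \<phi> arbitrary: v)
    case (Eq s t)
    have "wf_trm L s" "wf_trm L t" using fragment_wf[OF F Eq(1)] by auto
    moreover have "v ` tvars s \<subseteq> univ ?V" "v ` tvars t \<subseteq> univ ?V" using Eq(2) by (auto simp: induced_simps)
    ultimately have "tval ?V v s = tval X v s" "tval ?V v t = tval X v t"
      using tval_hom[OF V hom, of s v] tval_hom[OF V hom, of t v] by simp_all
    then show ?case unfolding sat.simps by simp
  next
    case (Rel c ts)
    have wf: "\<forall>t\<in>set ts. wf_trm L t" using fragment_wf[OF F Rel(1)] by (auto simp: list_all_iff)
    have ts: "tval ?V v t = tval X v t \<and> tval ?V v t \<in> univ ?V" if t: "t \<in> set ts" for t
    proof -
      have "v ` tvars t \<subseteq> univ ?V" using Rel(2) t by (auto simp: induced_simps)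
      then have "tval ?V v t \<in> univ ?V \<and> id (tval ?V v t) = tval X (id \<circ> v) t"
        using tval_hom[OF V hom, of t v] wf t by blast
      then show ?thesis unfolding id_apply id_comp by blast
    qed
    then have eq: "map (tval ?V v) ts = map (tval X v) ts" by simp
    have "set (map (tval ?V v) ts) \<subseteq> univ ?V" unfolding set_map using ts by blast
    from substruct_rl[OF sub this, of c] show ?case unfolding sat.simps eq .
  next
    case (Neg \<phi>)
    have "sat ?V \<phi> v \<longleftrightarrow> sat X \<phi> v" by (rule Neg.IH) (use Neg.prems fragment_sub(1)[OF F] in auto)
    then show ?case unfolding sat.simps by blast
  next
    case (And \<phi> \<psi>)
    have "sat ?V \<phi> v \<longleftrightarrow> sat X \<phi> v" by (rule And.IH(1)) (use And.prems fragment_sub(2)[OF F] in auto)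
    moreover have "sat ?V \<psi> v \<longleftrightarrow> sat X \<psi> v" by (rule And.IH(2)) (use And.prems fragment_sub(2)[OF F] in auto)
    ultimately show ?case unfolding sat.simps by blast
  next
    case (Conj I g)
    have "sat ?V (g i) v \<longleftrightarrow> sat X (g i) v" if i: "i \<in> I" for i
    proof (rule Conj.IH[OF _ fragment_sub(4)[OF F Conj.prems(1) i]])
      show "g i \<in> range g" by simp
      show "v ` fv (g i) \<subseteq> ?B" using Conj.prems(2) i by fastforce
    qed
    then show ?case unfolding sat.simps by blast
  next
    case (Ex x \<phi>)
    have \<phi>: "\<phi> \<in> \<F>" using Ex.prems(1) fragment_sub(3)[OF F] by blast
    have upd: "sat ?V \<phi> (v(x := a)) \<longleftrightarrow> sat X \<phi> (v(x := a))" if "a \<in> ?B" for a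
      by (rule Ex.IH[OF \<phi>]) (use Ex.prems(2) that in \<open>auto simp: image_subset_iff\<close>)
    show ?case
    proof
      assume "sat ?V (Ex x \<phi>) v"
      then obtain a where a: "a \<in> ?B" "sat ?V \<phi> (v(x := a))" unfolding sat.simps induced_simps by blast
      then show "sat X (Ex x \<phi>) v" using upd B unfolding sat.simps by blast
    next
      assume sat: "sat X (Ex x \<phi>) v"
      obtain i where i: "i \<in> P" "v ` fv (Ex x \<phi>) \<subseteq> A i"
        using fin[OF finite_imageI[OF fragment_finite_fv[OF F Ex.prems(1)]] Ex.prems(2)] by blast
      have "sat (induced X (A i)) (Ex x \<phi>) v"
        using elementary_id_sat[OF el[OF i(1)] Ex.prems(1), of v] i(2) sat by (simp only: induced_simps)
      then obtain a where a: "a \<in> A i" "sat (induced X (A i)) \<phi> (v(x := a))"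
        unfolding sat.simps induced_simps by blast
      have "v(x := a) ` fv \<phi> \<subseteq> univ (induced X (A i))" using i(2) a(1) by (auto simp: induced_simps)
      then have "sat X \<phi> (v(x := a))" using elementary_id_sat[OF el[OF i(1)] \<phi>] a(2) by blast
      then show "sat ?V (Ex x \<phi>) v"
        using upd a(1) i(1) unfolding sat.simps induced_simps by blast
    qed
  qed
  then show "elementary \<F> ?V X id" unfolding elementary_def induced_simps by simp
qed

text \<open>
  The union \<open>V\<close> of the images inside a colimit \<open>X\<close> is a member of the class and receives the cocone,
  so that there is a map \<open>X \<rightarrow> V\<close>; followed by the inclusion it is the identity of \<open>X\<close>, whence \<open>V = X\<close>.
\<close>

lemma axiomatizable_colimits_are_unions:
  fixes K :: "'u abstract_class"
  assumes K: "is_abstract_class K" and ax: "axiomatizable K"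
  shows "directed_colimits_are_unions K"
  unfolding directed_colimits_are_unions_def
proof (intro allI impI)
  fix P :: "'u set" and r D X \<iota>
  assume colim: "is_directed_colimit P r (class_cat K) D X \<iota>"
  let ?L = "clang K"
  obtain T \<F> where T: "is_theory ?L T" "T \<subseteq> \<F>" and F: "fragment ?L \<F>"
    and mem: "mem K = models ?L T"
    and le: "le K = {(M, N). M \<in> mem K \<and> N \<in> mem K \<and> substruct M N \<and> elementary \<F> M N id}"
    using ax unfolding axiomatizable_def by auto
  have dir: "directed_poset P r" and D: "is_functor (poset_cat P r) (class_cat K) D"
    and cocone: "is_cocone (poset_cat P r) (class_cat K) D X \<iota>"
    using colim unfolding is_directed_colimit_def is_colimit_def by auto
  have univ: "\<exists>!u. u \<in> hom (class_cat K) X Y \<and>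
      (\<forall>i\<in>P. compose (univ (omap D i)) u (\<iota> i) = \<kappa> i)"
    if "is_cocone (poset_cat P r) (class_cat K) D Y \<kappa>" for Y \<kappa>
    using colim that unfolding is_directed_colimit_def is_colimit_def poset_cat_simps class_cat_simps by blast
  note cc = class_cocone[OF dir D cocone]
  note X = cc(1) and Xs = class_struct[OF K cc(1)]
  define A where "A i = \<iota> i ` univ (omap D i)" for i
  have mono: "(i, j) \<in> r \<Longrightarrow> A i \<subseteq> A j" for i j using cc(6) unfolding A_def .
  have A_le: "(induced X (A i), X) \<in> le K" if "i \<in> P" for i
    using cc(4)[OF that] unfolding K_embedding_def A_def by blast
  have A: "A i \<subseteq> univ X" "induced X (A i) \<in> mem K" "elementary \<F> (induced X (A i)) X id" if "i \<in> P" for i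
    using A_le[OF that] substruct_subset[of "induced X (A i)" X] unfolding le induced_simps by auto
  define B where "B = (\<Union>i\<in>P. A i)"
  let ?V = "induced X B"
  have V: "is_struct ?L ?V" "elementary \<F> ?V X id"
    using directed_union_elementary[where A = A, OF F Xs dir mono A(1) class_struct[OF K A(2)] A(3)]
    unfolding B_def by blast+
  have B: "B \<subseteq> univ X" using A(1) unfolding B_def by blast
  have sub: "substruct ?V X" using B by (simp add: substruct_def induced_simps(1))
  have Vm: "?V \<in> mem K"
  proof -
    have "sat ?V \<phi> v" if "\<phi> \<in> T" for \<phi> v
    proof -
      have "\<phi> \<in> \<F>" "fv \<phi> = {}" using T that unfolding is_theory_def by auto
      moreover have "sat X \<phi> v" using X that unfolding mem models_def by blast
      ultimately show ?thesis using elementary_id_sat[OF V(2), of \<phi> v] by simp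
    qed
    then show ?thesis using V(1) unfolding mem models_def by blast
  qed
  have VX: "(?V, X) \<in> le K" unfolding le using Vm X sub V(2) by blast
  have AV: "induced ?V (A i) = induced X (A i)" if "i \<in> P" for i
    using induced_induced[of "A i" B X] that unfolding B_def by blast
  have A_le_V: "(induced ?V (A i), ?V) \<in> le K" if i: "i \<in> P" for i
  proof -
    have "sat (induced X (A i)) \<phi> v \<longleftrightarrow> sat ?V \<phi> v" if "\<phi> \<in> \<F>" "v ` fv \<phi> \<subseteq> A i" for \<phi> v
    proof -
      have "v ` fv \<phi> \<subseteq> B" using that(2) i unfolding B_def by blast
      then show ?thesis
        using elementary_id_sat[OF A(3)[OF i] that(1), of v] elementary_id_sat[OF V(2) that(1), of v] that(2)
        by (simp add: induced_simps(1))
    qed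
    then have "elementary \<F> (induced X (A i)) ?V id" by (simp add: elementary_def induced_simps(1))
    moreover have "substruct (induced X (A i)) ?V"
      unfolding substruct_def induced_simps(1) AV[OF i] using i unfolding B_def by auto
    ultimately show ?thesis unfolding AV[OF i] le using A(2)[OF i] Vm by blast
  qed
  have V_emb: "K_embedding K (omap D i) ?V (\<iota> i)" if i: "i \<in> P" for i
  proof -
    have in_B: "\<iota> i ` univ (omap D i) \<subseteq> B" using i unfolding B_def A_def by blast
    have "set (map (\<iota> i) xs) \<subseteq> B" if "set xs \<subseteq> univ (omap D i)" for xs
      using in_B that by auto
    then have "embedding ?L (omap D i) ?V (\<iota> i)"
      using cc(4)[OF i] in_B unfolding K_embedding_def embedding_def homomorphism_def induced_simps by simp
    then show ?thesis using A_le_V[OF i] unfolding K_embedding_def A_def by blast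
  qed
  have "is_cocone (poset_cat P r) (class_cat K) D ?V \<iota>"
    using cocone Vm V_emb cc(3) unfolding is_cocone_def poset_cat_simps class_cat_simps by blast
  then obtain u where u: "u \<in> hom (class_cat K) X ?V" "\<forall>i\<in>P. compose (univ (omap D i)) u (\<iota> i) = \<iota> i"
    using univ by blast
  have u_ext: "u \<in> extensional (univ X)" and u_emb: "K_embedding K X ?V u"
    using u(1) by (simp_all add: class_cat_simps)
  have u_im: "u ` univ X \<subseteq> B" using K_embedding_into[OF u_emb] by (simp add: induced_simps(1))
  have "K_embedding K X X u"
  proof -
    have "embedding ?L X ?V u" using u_emb by (simp add: K_embedding_def)
    then have "embedding ?L X X u" using sub by (rule embedding_into_super)
    moreover have "(induced ?V (u ` univ X), ?V) \<in> le K" using u_emb by (simp add: K_embedding_def)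
    then have "(induced X (u ` univ X), X) \<in> le K"
      using VX class_facts(2)[OF K] unfolding induced_induced[OF u_im] partial_order_on_def preorder_on_def
      by (meson transD)
    ultimately show ?thesis by (simp add: K_embedding_def)
  qed
  then have u_hom: "u \<in> hom (class_cat K) X X" using u_ext by (simp add: class_cat_simps)
  have "K_embedding K X X (restrict id (univ X))"
    by (rule K_embedding_cong[OF Xs K_embedding_inclusion[OF K class_le_refl[OF K X]]]) simp
  then have id_hom: "restrict id (univ X) \<in> hom (class_cat K) X X" by (simp add: class_cat_simps)
  have id_cmp: "compose (univ (omap D i)) (restrict id (univ X)) (\<iota> i) = \<iota> i" if i: "i \<in> P" for i
  proof (rule extensionalityI[OF compose_extensional cc(3)[OF i]])
    fix a assume a: "a \<in> univ (omap D i)"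
    have "\<iota> i a \<in> univ X" using K_embedding_into[OF cc(4)[OF i]] a by blast
    then show "compose (univ (omap D i)) (restrict id (univ X)) (\<iota> i) a = \<iota> i a"
      using a by (simp add: compose_eq)
  qed
  have "u = restrict id (univ X)"
    using univ[OF cocone] u_hom u(2) id_hom id_cmp by blast
  then have "univ X \<subseteq> B" using u_im by auto
  then have "univ X = (\<Union>i\<in>P. \<iota> i ` univ (omap D i))" using B unfolding B_def A_def by blast
  then show "is_directed_union P r K D X \<iota>" using colim unfolding is_directed_union_def by blast
qed

section \<open>The functor into a large elementary category\<close>

text \<open>
  Choose a big \<open>I\<close> for the cardinal of the Skolemized language and a model \<open>M\<close> of size at least that of \<open>I\<close>.
  The Erdos--Rado property of an injection \<open>I \<rightarrow> M\<close> into the Skolemization of \<open>M\<close> gives the indiscernibles,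
  these give the functor into the models, and an equivalence carries it to \<open>C\<close>.
\<close>

lemma erdos_rado_functor:
  fixes K :: "'u abstract_class" and C :: "('o, 'a) category"
  assumes U: "inaccessible TYPE('u)" and ER: "erdos_rado_class K lt big"
    and elem: "elementary_category TYPE('u) C" and large: "large TYPE('u) C"
  shows "\<exists>F. is_functor (class_cat K) C F \<and> faithful (class_cat K) F \<and> preserves_directed_unions K C F"
proof -
  obtain L :: "'u lang" and T \<F> where C: "is_category C" and L: "small_lang L" and T: "is_theory L T" "T \<subseteq> \<F>"
    and F: "fragment L \<F>" and equiv: "equivalent_cats C (model_cat L T \<F>)"
    using elem unfolding elementary_category_def by blast
  have ord: "ordered_class K lt" and big: "bigness_notion K big"
    using ER unfolding erdos_rado_class_def by auto
  have K: "is_abstract_class K" using ord unfolding ordered_class_def by blast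
  obtain f where f: "\<And>\<mu> :: 'u rel. small_card \<mu> \<Longrightarrow> small_card (f \<mu> :: 'u rel)"
    and realize: "\<And>\<mu> L I M h. small_card \<mu> \<Longrightarrow> lang_card L \<le>o \<mu> \<Longrightarrow> I \<in> big (f \<mu>) \<Longrightarrow> is_struct L M \<Longrightarrow>
           inj_on h (univ I) \<Longrightarrow> h ` univ I \<subseteq> univ M \<Longrightarrow>
           \<exists>\<Phi>. blueprint K lt L \<Phi> \<and>
              (\<forall>p\<in>inc_types K lt. \<exists>a. set a \<subseteq> univ I \<and> increasing lt I a \<and> tp K a I = p \<and>
                 tp (all_structs L) (map h a) M = \<Phi> p)"
  proof -
    from ER obtain f :: "'u rel \<Rightarrow> 'u rel" where
      1: "\<forall>\<mu>. small_card \<mu> \<longrightarrow> small_card (f \<mu>)" and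
      2: "\<forall>\<mu> L I M h.
           small_card \<mu> \<and> lang_card L \<le>o \<mu> \<and> I \<in> big (f \<mu>) \<and> is_struct L M \<and>
           inj_on h (univ I) \<and> h ` univ I \<subseteq> univ M \<longrightarrow>
           (\<exists>\<Phi>. blueprint K lt L \<Phi> \<and>
              (\<forall>p\<in>inc_types K lt. \<exists>a. set a \<subseteq> univ I \<and> increasing lt I a \<and> tp K a I = p \<and>
                 tp (all_structs L) (map h a) M = \<Phi> p))"
      unfolding erdos_rado_class_def by (elim conjE exE)
    show ?thesis by (rule that[of f]) (simp add: 1, rule 2[rule_format], intro conjI)
  qed
  obtain code :: "'u fm \<Rightarrow> 'u" where code: "inj_on code \<F>"
    using small_code[OF conjunct1[OF F[unfolded fragment_def]]] by blast
  obtain enc :: "('u, 'u) sterm \<Rightarrow> 'u" where enc: "inj enc"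
    using sterm_coding[OF inaccessible_infinite[OF U]] by auto
  \<comment> \<open>The cardinal of the Skolemized language, represented by a subset of \<open>'u\<close>.\<close>
  let ?L = "sk_lang code \<F>"
  have "small TYPE('u) (funs ?L <+> rels ?L)"
    using small_sk_lang[OF U F, of code] unfolding small_lang_def lang_card_def small_def .
  then obtain g and B :: "'u set" where g: "bij_betw g (funs ?L <+> rels ?L) B" and B: "small TYPE('u) B"
    by (rule small_transfer)
  have \<mu>: "small_card |B|" using B card_of_Card_order unfolding small_card_def small_def by blast
  have L\<mu>: "lang_card ?L \<le>o |B|"
    unfolding lang_card_def using g card_of_ordIso ordIso_imp_ordLeq by blast
  have "big (f |B| ) \<subseteq> mem K" "big (f |B| ) \<noteq> {}"
    using big f[OF \<mu>] unfolding bigness_notion_def by simp_all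
  then obtain I where I: "I \<in> big (f |B| )" "I \<in> mem K" by blast
  \<comment> \<open>The extra point makes the model nonempty.\<close>
  have "small TYPE('u) (insert undefined (univ I))"
    using small_Un[OF U small_finite[OF U, of "{undefined}"] struct_small[OF class_struct[OF K I(2)]]] by simp
  from large_has_large_models[OF U C large L T(1) F equiv this]
  obtain M where MT: "M \<in> models L T" and "|insert undefined (univ I)| \<le>o |univ M|" by blast
  then obtain h where h: "inj_on h (insert undefined (univ I))" "h ` insert undefined (univ I) \<subseteq> univ M"
    using card_of_ordLeq by metis
  have ne: "univ M \<noteq> {}" using h(2) by blast
  let ?M = "sk_struct code \<F> M"
  have Ms: "is_struct ?L ?M" by (rule sk_struct_is_struct[OF models_struct[OF MT] ne])
  have h': "inj_on h (univ I)" "h ` univ I \<subseteq> univ ?M"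
    using h by (auto simp: sk_struct_univ)
  obtain \<Phi> where \<Phi>: "blueprint K lt ?L \<Phi>"
    and real: "\<forall>p\<in>inc_types K lt. \<exists>a. set a \<subseteq> univ I \<and> increasing lt I a \<and> tp K a I = p \<and>
                 tp (all_structs ?L) (map h a) ?M = \<Phi> p"
    using realize[OF \<mu> L\<mu> I(1) Ms h'] by blast
  obtain \<sigma> where \<sigma>: "indiscernible_system K ?L ?M \<sigma>"
    using erdos_rado_indiscernibles[OF ord I(2) Ms h' \<Phi> real] by blast
  interpret generated_models K L \<F> M code \<sigma> enc
    by unfold_locales (rule U K F models_struct[OF MT] ne code \<sigma> enc)+
  let ?D = "model_cat L T \<F>"
  have D: "is_category ?D" by (rule model_cat_category[OF F])
  obtain G where w: "weak_equivalence ?D C G"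
    using equivalent_cats_weak[OF D C equivalent_cats_sym[OF equiv]] by blast
  then have G: "is_functor ?D C G"
    and G_inj: "\<And>X Y. X \<in> obj ?D \<Longrightarrow> Y \<in> obj ?D \<Longrightarrow> inj_on (amap G X Y) (hom ?D X Y)"
    unfolding weak_equivalence_def bij_betw_def by auto
  note E = gen_ftor_functor[OF T MT]
  let ?F = "comp_ftor G gen_ftor"
  have "is_functor (class_cat K) C ?F" by (rule functor_comp[OF E G])
  moreover have "faithful (class_cat K) ?F"
    unfolding faithful_def comp_ftor_def ftor.simps
  proof (intro ballI inj_onI)
    fix X Y f g assume X: "X \<in> obj (class_cat K)" and Y: "Y \<in> obj (class_cat K)"
      and f: "f \<in> hom (class_cat K) X Y" and g: "g \<in> hom (class_cat K) X Y"
      and eq: "amap G (omap gen_ftor X) (omap gen_ftor Y) (amap gen_ftor X Y f) =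
        amap G (omap gen_ftor X) (omap gen_ftor Y) (amap gen_ftor X Y g)"
    have "amap gen_ftor X Y f = amap gen_ftor X Y g"
      by (rule inj_onD[OF G_inj[OF ftor_obj[OF E X] ftor_obj[OF E Y]] eq ftor_hom[OF E X Y f] ftor_hom[OF E X Y g]])
    moreover have "inj_on (amap gen_ftor X Y) (hom (class_cat K) X Y)"
      using gen_ftor_faithful X Y unfolding faithful_def by blast
    ultimately show "f = g" using f g by (simp add: inj_on_eq_iff)
  qed
  moreover have "preserves_directed_unions K C ?F"
    unfolding preserves_directed_unions_def
  proof (intro allI impI)
    fix P r D' X \<iota> assume "is_directed_union P r K D' X \<iota>"
    from weak_equivalence_directed_colimit[OF D C w gen_ftor_directed_union[OF T MT this]]
    show "is_directed_colimit P r C (comp_ftor ?F D') (omap ?F X) (\<lambda>i. amap ?F (omap D' i) X (\<iota> i))"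
      by (simp add: comp_ftor_def)
  qed
  ultimately show ?thesis by blast
qed

lemma preserves_directed_colimitsI:
  assumes "directed_colimits_are_unions K" "preserves_directed_unions K C F"
  shows "preserves_directed_colimits TYPE('u) (class_cat (K :: 'u abstract_class)) C F"
  unfolding preserves_directed_colimits_def
proof (intro allI impI)
  fix P :: "'u set" and r D X \<iota>
  assume "is_directed_colimit P r (class_cat K) D X \<iota>"
  then have "is_directed_union P r K D X \<iota>"
    using assms(1) unfolding directed_colimits_are_unions_def by simp
  then show "is_directed_colimit P r C (comp_ftor F D) (omap F X) (\<lambda>i. amap F (omap D i) X (\<iota> i))"
    using assms(2) unfolding preserves_directed_unions_def by simp
qed

theorem theorem5p4:
  fixes K :: "'u abstract_class" and lt :: 'u and big :: "'u rel \<Rightarrow> 'u struct set"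
  assumes "inaccessible TYPE('u)"
    and "erdos_rado_class K lt big"
  shows "(\<forall>C :: ('o, 'a) category. elementary_category TYPE('u) C \<and> large TYPE('u) C \<longrightarrow>
            (\<exists>F. is_functor (class_cat K) C F \<and> faithful (class_cat K) F \<and>
                 preserves_directed_unions K C F \<and>
                 (directed_colimits_are_unions K \<longrightarrow>
                    preserves_directed_colimits TYPE('u) (class_cat K) C F))) \<and>
         (axiomatizable K \<longrightarrow> minimal_elementary TYPE('o) TYPE('a) K)"
proof (intro conjI allI impI)
  fix C :: "('o, 'a) category"
  assume "elementary_category TYPE('u) C \<and> large TYPE('u) C"
  then obtain F where "is_functor (class_cat K) C F" "faithful (class_cat K) F" "preserves_directed_unions K C F"
    using erdos_rado_functor[OF assms] by blast
  then show "\<exists>F. is_functor (class_cat K) C F \<and> faithful (class_cat K) F \<and>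
                 preserves_directed_unions K C F \<and>
                 (directed_colimits_are_unions K \<longrightarrow>
                    preserves_directed_colimits TYPE('u) (class_cat K) C F)"
    using preserves_directed_colimitsI by blast
next
  assume ax: "axiomatizable K"
  have "is_abstract_class K" using assms(2) unfolding erdos_rado_class_def ordered_class_def by blast
  then have unions: "directed_colimits_are_unions K" using ax by (rule axiomatizable_colimits_are_unions)
  show "minimal_elementary TYPE('o) TYPE('a) K"
    unfolding minimal_elementary_def
  proof (intro allI impI)
    fix C :: "('o, 'a) category"
    assume "elementary_category TYPE('u) C \<and> large TYPE('u) C"
    then obtain F where "is_functor (class_cat K) C F" "faithful (class_cat K) F" "preserves_directed_unions K C F"
      using erdos_rado_functor[OF assms] by blast
    then show "\<exists>F. is_functor (class_cat K) C F \<and> faithful (class_cat K) F \<and>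
             preserves_directed_colimits TYPE('u) (class_cat K) C F"
      using preserves_directed_colimitsI[OF unions] by blast
  qed
qed

end
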